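(* Let $G$ be a locally compact group, and consider the continuous semigroup homomorphisms $\theta^{\mathrm{wap}}:(G_d)^{\mathrm{wap}}\to K_{\mathrm{WAP}}$ and $\theta_1:K_{\mathrm{WAP}}\to(G_d)^{\mathrm{wap}}$. Then $\theta_1\circ\theta^{\mathrm{wap}}$ is the identity on $(G_d)^{\mathrm{wap}}$, and so $\theta^{\mathrm{wap}}$ is a homeomorphism onto its range.
   Context: For a Banach algebra $A$, $\mu\in A^*$ is weakly almost periodic, $\mu\in\mathrm{WAP}(A)$, if the map $A\to A^*$, $a\mapsto a\cdot\mu$, where $\langle a\cdot\mu,b\rangle=\langle\mu,ba\rangle$, is weakly compact. $M(G)=C_0(G)^*$ is the measure algebra with convolution, and $M(G)^*=C_0(G)^{**}$ is a commutative von Neumann algebra. $\mathrm{WAP}(M(G))$ is a unital C$^*$-subalgebra of $M(G)^*$, so it equals $C(K_{\mathrm{WAP}})$ where $K_{\mathrm{WAP}}$ is its character space. The Arens products on $M(G)^{**}$ drop to a separately weak$^*$-continuous product $\Box$ on $\mathrm{WAP}(M(G))^*$, which restricts to a separately continuous semigroup product on $K_{\mathrm{WAP}}$. (First Arens product on $A^{**}$: $\langle\Phi\Box\Psi,\mu\rangle=\langle\Phi,\Psi\cdot\mu\rangle$, $\langle\Psi\cdot\mu,a\rangle=\langle\Psi,\mu\cdot a\rangle$, $\langle\mu\cdot a,b\rangle=\langle\mu,ab\rangle$.) $G_d$ is $G$ with the discrete topology; $\mathrm{WAP}(G_d)=\mathrm{WAP}(\ell^1(G))\subseteq\ell^\infty(G)$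 is the C$^*$-algebra of weakly almost periodic functions on $G_d$, and $(G_d)^{\mathrm{wap}}$ is its character space, the weakly almost periodic compactification of $G_d$, a compact semitopological semigroup in which (the canonical image of) $G_d$ is dense, and which is universal for homomorphisms of $G_d$ into compact semitopological semigroups. The map $\theta:G_d\to K_{\mathrm{WAP}}$ sends $s$ to the character $F\mapsto\langle F,\delta_s\rangle$ on $\mathrm{WAP}(M(G))$; it is a semigroup homomorphism, and $\theta^{\mathrm{wap}}:(G_d)^{\mathrm{wap}}\to K_{\mathrm{WAP}}$ is the unique continuous homomorphism extending $\theta$ along $G_d\to(G_d)^{\mathrm{wap}}$. Writing $M(G)=M_c(G)\oplus_1\ell^1(G)$ (non-atomic plus atomic measures), let $P:M(G)\to\ell^1(G)$ be the projection, an algebra homomorphism. Then $P^*:\ell^\infty(G)\to M(G)^*$ is a $*$-homomorphism mapping $\mathrm{WAP}(G_d)$ into $\mathrm{WAP}(M(G))$, and $\theta_1:K_{\mathrm{WAP}}\to(G_d)^{\mathrm{wap}}$ is the induced continuous semigroup homomorphism: $F(\theta_1(k))=P^*(F)(k)$ for $F\in\mathrm{WAP}(G_d)=C((G_d)^{\mathrm{wap}})$, $k\in K_{\mathrm{WAP}}$. *)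

theory Defs
  imports "HOL-Analysis.Analysis"
begin

text \<open>
  The group \<open>G\<close> is a type of class \<^class>\<open>topological_group_add\<close>. This class does not include
  commutativity: \<open>s + t\<close> stands for the group product \<open>st\<close>, \<open>- s\<close> for the inverse of \<open>s\<close>.

  HOL-Analysis has no complex normed spaces. Every Banach space needed here is a space of
  complex-valued functions with pointwise operations (\<open>C\<^sub>0(G)\<close> and \<open>\<ell>\<^sup>1(G)\<close> on \<open>G\<close>, a dual space
  on the space it is dual to), so it is given by its set of vectors and its norm. A functional
  on \<open>V\<close> is represented by a total function that is \<open>0\<close> outside \<open>V\<close>; in this way
  equality of functionals is equality of functions, and the topology of pointwise convergence on
  the function type (the \<^class>\<open>topological_space\<close> instance of functions) induces
  the weak* topology on sets of functionals.
\<close>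

type_synonym 'x functional = "('x \<Rightarrow> complex) \<Rightarrow> complex"

definition linear_functional :: "('x \<Rightarrow> complex) set \<Rightarrow> 'x functional \<Rightarrow> bool" where
  "linear_functional V \<phi> \<longleftrightarrow>
     (\<forall>f. f \<notin> V \<longrightarrow> \<phi> f = 0) \<and>
     (\<forall>f\<in>V. \<forall>g\<in>V. \<phi> (\<lambda>x. f x + g x) = \<phi> f + \<phi> g) \<and>
     (\<forall>c. \<forall>f\<in>V. \<phi> (\<lambda>x. c * f x) = c * \<phi> f)"

definition dual :: "('x \<Rightarrow> complex) set \<Rightarrow> (('x \<Rightarrow> complex) \<Rightarrow> real) \<Rightarrow> 'x functional set" where
  "dual V N = {\<phi>. linear_functional V \<phi> \<and> (\<exists>B. \<forall>f\<in>V. norm (\<phi> f) \<le> B * N f)}"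

definition dual_norm ::
  "('x \<Rightarrow> complex) set \<Rightarrow> (('x \<Rightarrow> complex) \<Rightarrow> real) \<Rightarrow> 'x functional \<Rightarrow> real" where
  "dual_norm V N \<phi> = (SUP f\<in>{f\<in>V. N f \<le> 1}. norm (\<phi> f))"

definition weak_topology ::
  "('x \<Rightarrow> complex) set \<Rightarrow> (('x \<Rightarrow> complex) \<Rightarrow> real) \<Rightarrow> ('x \<Rightarrow> complex) topology" where
  "weak_topology V N =
     pullback_topology V (\<lambda>x \<phi>. if \<phi> \<in> dual V N then \<phi> x else 0) euclidean"

definition weakly_compact ::
  "('x \<Rightarrow> complex) set \<Rightarrow> (('x \<Rightarrow> complex) \<Rightarrow> real) \<Rightarrow>
   ('y \<Rightarrow> complex) set \<Rightarrow> (('y \<Rightarrow> complex) \<Rightarrow> real) \<Rightarrow>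
   (('x \<Rightarrow> complex) \<Rightarrow> ('y \<Rightarrow> complex)) \<Rightarrow> bool" where
  "weakly_compact V N W N' T \<longleftrightarrow>
     compactin (weak_topology W N')
       (weak_topology W N' closure_of (T ` {f\<in>V. N f \<le> 1}))"

record 'x balgebra =
  vecs :: "('x \<Rightarrow> complex) set"
  nrm :: "('x \<Rightarrow> complex) \<Rightarrow> real"
  mul :: "('x \<Rightarrow> complex) \<Rightarrow> ('x \<Rightarrow> complex) \<Rightarrow> ('x \<Rightarrow> complex)"

definition adual :: "'x balgebra \<Rightarrow> 'x functional set" where
  "adual A = dual (vecs A) (nrm A)"

definition adual_norm :: "'x balgebra \<Rightarrow> 'x functional \<Rightarrow> real" where
  "adual_norm A = dual_norm (vecs A) (nrm A)"

definition lact :: "'x balgebra \<Rightarrow> ('x \<Rightarrow> complex) \<Rightarrow> 'x functional \<Rightarrow> 'x functional" where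
  "lact A a \<mu> = (\<lambda>b. if b \<in> vecs A then \<mu> (mul A b a) else 0)"

definition ract :: "'x balgebra \<Rightarrow> 'x functional \<Rightarrow> ('x \<Rightarrow> complex) \<Rightarrow> 'x functional" where
  "ract A \<mu> a = (\<lambda>b. if b \<in> vecs A then \<mu> (mul A a b) else 0)"

definition WAP :: "'x balgebra \<Rightarrow> 'x functional set" where
  "WAP A = {\<mu> \<in> adual A.
     weakly_compact (vecs A) (nrm A) (adual A) (adual_norm A) (\<lambda>a. lact A a \<mu>)}"

text \<open>The first Arens product, for functionals \<open>\<Phi>\<close>, \<open>\<Psi>\<close> on a submodule \<open>X\<close> of the dual of \<open>A\<close>
  with \<open>\<Psi> \<cdot> \<mu> \<in> X\<close> for \<open>\<mu> \<in> X\<close>. For \<open>X = adual A\<close> this is the product of the bidual, for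
  \<open>X = WAP A\<close> the product it induces on the dual of \<open>WAP A\<close>.\<close>

definition arens ::
  "'x balgebra \<Rightarrow> 'x functional set \<Rightarrow>
   ('x \<Rightarrow> complex) functional \<Rightarrow> ('x \<Rightarrow> complex) functional \<Rightarrow> ('x \<Rightarrow> complex) functional"
  where
  "arens A X \<Phi> \<Psi> =
     (\<lambda>\<mu>. if \<mu> \<in> X then \<Phi> (\<lambda>a. if a \<in> vecs A then \<Psi> (ract A \<mu> a) else 0) else 0)"

definition characters ::
  "('x \<Rightarrow> complex) set \<Rightarrow> (('x \<Rightarrow> complex) \<Rightarrow> ('x \<Rightarrow> complex) \<Rightarrow> ('x \<Rightarrow> complex)) \<Rightarrow>
   'x functional set" where
  "characters X m = {\<phi>. linear_functional X \<phi> \<and>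
     (\<forall>F\<in>X. \<forall>H\<in>X. \<phi> (m F H) = \<phi> F * \<phi> H) \<and> (\<exists>F\<in>X. \<phi> F \<noteq> 0)}"

definition C0 :: "('g::topological_group_add) balgebra" where
  "C0 = \<lparr>vecs = {f. continuous_on UNIV f \<and> (\<forall>e>0. \<exists>K. compact K \<and> (\<forall>x. x \<notin> K \<longrightarrow> norm (f x) < e))},
         nrm = (\<lambda>f. SUP x. norm (f x)),
         mul = (\<lambda>f g x. f x * g x)\<rparr>"

text \<open>\<open>M(G)\<close> is the dual of \<open>C\<^sub>0(G)\<close>; a measure \<open>\<mu>\<close> is the functional \<open>f \<mapsto> \<integral> f d\<mu>\<close>, and the
  convolution is \<open>\<langle>\<mu> * \<nu>, f\<rangle> = \<integral> \<integral> f(st) d\<nu>(t) d\<mu>(s)\<close>.\<close>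

definition MG :: "(('g::topological_group_add) \<Rightarrow> complex) balgebra" where
  "MG = \<lparr>vecs = adual C0,
         nrm = adual_norm C0,
         mul = (\<lambda>\<mu> \<nu> f. if f \<in> vecs C0 then \<mu> (\<lambda>s. \<nu> (\<lambda>t. f (s + t))) else 0)\<rparr>"

definition dirac :: "'g::topological_group_add \<Rightarrow> 'g functional" where
  "dirac s = (\<lambda>f. if f \<in> vecs C0 then f s else 0)"

text \<open>The product of the von Neumann algebra \<open>M(G)\<^sup>* = C\<^sub>0(G)\<^sup>*\<^sup>*\<close>, i.e. the Arens product of the
  bidual of the C*-algebra \<open>C\<^sub>0(G)\<close>.\<close>

definition MG_dual_mul ::
  "('g::topological_group_add \<Rightarrow> complex) functional \<Rightarrow> ('g \<Rightarrow> complex) functional \<Rightarrow>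
   ('g \<Rightarrow> complex) functional" where
  "MG_dual_mul = arens C0 (adual C0)"

definition K_WAP :: "('g::topological_group_add functional) functional set" where
  "K_WAP = characters (WAP MG) MG_dual_mul"

definition K_WAP_mul ::
  "('g::topological_group_add functional) functional \<Rightarrow>
   ('g functional) functional \<Rightarrow> ('g functional) functional" where
  "K_WAP_mul = arens MG (WAP MG)"

definition l1 :: "('g::group_add) balgebra" where
  "l1 = \<lparr>vecs = {a. (\<lambda>s. norm (a s)) summable_on UNIV},
         nrm = (\<lambda>a. \<Sum>\<^sub>\<infinity>s. norm (a s)),
         mul = (\<lambda>a b s. \<Sum>\<^sub>\<infinity>t. a t * b (- t + s))\<rparr>"

definition l1_functional :: "('g::group_add \<Rightarrow> complex) \<Rightarrow> 'g functional" where
  "l1_functional F = (\<lambda>a. if a \<in> vecs l1 then (\<Sum>\<^sub>\<infinity>s. F s * a s) else 0)"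

definition WAP_Gd :: "('g::group_add \<Rightarrow> complex) set" where
  "WAP_Gd = {F. bounded (range F) \<and> l1_functional F \<in> WAP l1}"

definition Gd_wap :: "('g::group_add) functional set" where
  "Gd_wap = characters WAP_Gd (\<lambda>F H s. F s * H s)"

definition Gd_wap_embed :: "'g::group_add \<Rightarrow> 'g functional" where
  "Gd_wap_embed s = (\<lambda>F. if F \<in> WAP_Gd then F s else 0)"

text \<open>The Arens product of \<open>WAP(\<ell>\<^sup>1(G))\<^sup>*\<close>, written on functions: for the point mass \<open>a\<close> at \<open>s\<close>,
  \<open>F \<cdot> a\<close> is \<open>t \<mapsto> F(st)\<close>, so \<open>\<psi> \<cdot> F\<close> is \<open>s \<mapsto> \<psi>(t \<mapsto> F(st))\<close>.\<close>

definition Gd_wap_mul ::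
  "('g::group_add) functional \<Rightarrow> 'g functional \<Rightarrow> 'g functional" where
  "Gd_wap_mul \<phi> \<psi> = (\<lambda>F. if F \<in> WAP_Gd then \<phi> (\<lambda>s. \<psi> (\<lambda>t. F (s + t))) else 0)"

definition theta ::
  "'g::topological_group_add \<Rightarrow> ('g functional) functional" where
  "theta s = (\<lambda>F. if F \<in> WAP MG then F (dirac s) else 0)"

text \<open>As the image of \<open>G\<close> is dense in \<^const>\<open>Gd_wap\<close>, this determines \<open>T\<close> on \<^const>\<open>Gd_wap\<close>.\<close>

definition is_theta_wap ::
  "(('g::topological_group_add) functional \<Rightarrow> ('g functional) functional) \<Rightarrow> bool"
  where
  "is_theta_wap T \<longleftrightarrow>
     T \<in> Gd_wap \<rightarrow> K_WAP \<and>
     continuous_on Gd_wap T \<and>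
     (\<forall>\<phi>\<in>Gd_wap. \<forall>\<psi>\<in>Gd_wap. T (Gd_wap_mul \<phi> \<psi>) = K_WAP_mul (T \<phi>) (T \<psi>)) \<and>
     (\<forall>s. T (Gd_wap_embed s) = theta s)"

text \<open>\<open>|\<mu>|(U)\<close> for open \<open>U\<close>, by the Riesz representation theorem, and \<open>|\<mu>|({s})\<close>, by outer
  regularity. Since measures are regular, \<open>\<mu>\<close> is non-atomic iff \<open>|\<mu>|({s}) = 0\<close> for all \<open>s\<close>.\<close>

definition variation_open :: "('g::topological_group_add) functional \<Rightarrow> 'g set \<Rightarrow> real" where
  "variation_open \<mu> U =
     (SUP f\<in>{f \<in> vecs C0. (\<forall>x. norm (f x) \<le> 1) \<and> (\<forall>x. x \<notin> U \<longrightarrow> f x = 0)}. norm (\<mu> f))"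

definition variation_point :: "('g::topological_group_add) functional \<Rightarrow> 'g \<Rightarrow> real" where
  "variation_point \<mu> s = (INF U\<in>{U. open U \<and> s \<in> U}. variation_open \<mu> U)"

definition M_c :: "('g::topological_group_add) functional set" where
  "M_c = {\<mu> \<in> vecs MG. \<forall>s. variation_point \<mu> s = 0}"

definition atomic_measure :: "('g::topological_group_add \<Rightarrow> complex) \<Rightarrow> 'g functional" where
  "atomic_measure a = (\<lambda>f. if f \<in> vecs C0 then (\<Sum>\<^sub>\<infinity>s. a s * f s) else 0)"

definition atomic_part :: "('g::topological_group_add) functional \<Rightarrow> ('g \<Rightarrow> complex)" where
  "atomic_part \<mu> = (THE a. a \<in> vecs l1 \<and> (\<lambda>f. \<mu> f - atomic_measure a f) \<in> M_c)"

definition atomic_part_adj ::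
  "('g::topological_group_add \<Rightarrow> complex) \<Rightarrow> ('g \<Rightarrow> complex) functional" where
  "atomic_part_adj F = (\<lambda>\<mu>. if \<mu> \<in> vecs MG then l1_functional F (atomic_part \<mu>) else 0)"

definition theta1 ::
  "('g::topological_group_add functional) functional \<Rightarrow> 'g functional" where
  "theta1 k = (\<lambda>F. if F \<in> WAP_Gd then k (atomic_part_adj F) else 0)"

end

theory Submission
  imports Defs
begin

text \<open>
  The map \<open>\<theta>\<^sub>1 \<circ> \<theta>\<^sup>w\<^sup>a\<^sup>p\<close> is continuous and fixes the image of \<open>G\<close>, so it is the identity once that image is
  dense in \<^const>\<open>Gd_wap\<close>.

  Density holds because \<^const>\<open>WAP_Gd\<close> is closed under products, conjugation and inverses of
  functions bounded away from \<open>0\<close>: a character outside the closure would vanish on an invertible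
  sum of squares. These closure properties are clear from Grothendieck's criterion that the iterated
  limits of \<open>F (s\<^sub>k + t\<^sub>n)\<close> agree, when limits are taken with a multiplicative generalized limit.
  That the criterion implies weak compactness on all of \<open>\<ell>\<^sup>1\<close>, not only on point masses, amounts to
  \<open>\<Phi>\<^sub>s \<Psi>\<^sub>t F (s + t) = \<Psi>\<^sub>t \<Phi>\<^sub>s F (s + t)\<close> for all functionals \<open>\<Phi>\<close>, \<open>\<Psi>\<close> on \<open>\<ell>\<^sup>\<infinity>\<close>; this replaces the
  theorem of Krein and Smulian and rests on a combinatorial form of bounded convergence.

  That \<open>P\<^sup>*\<close> preserves weak almost periodicity needs \<open>P\<close> to be a contractive algebra homomorphism. Measures
  being functionals, the mass of a point is read off from test functions supported near it.
\<close>

subsection \<open>Generalized limits of bounded sequences\<close>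

text \<open>Nested generalized limits exist for every bounded function, so the criterion carries no
  clause on existence, and since they are multiplicative, products and inverses are dealt with by
  computation. The membership of P^*F in \<open>WAP MG\<close> cannot be bypassed:
  \<open>theta s\<close> is 0 off \<open>WAP MG\<close>, and otherwise
  \<open>theta1 (theta s)\<close> would give 0 in place of F s. The real work in P being
  multiplicative is that a convolution with a non-atomic factor has no atoms. If the right factor is
  non-atomic, its translates by all s occur at once, so smallness uniform over translates is needed,
  and this comes from tightness. Local compactness provides bump functions; they make the mass of a
  point unique and let it be found as a limit. Disjointly supported test functions are the common
  device: with suitable phases their values add up in modulus while the function stays bounded by 1,
  which bounds sums by the norm.\<close>

lemma closure_fun_iff:
  fixes x :: "'a \<Rightarrow> complex"
  shows "x \<in> closure A \<longleftrightarrow>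
    (\<forall>I e. finite I \<and> 0 < e \<longrightarrow> (\<exists>y\<in>A. \<forall>i\<in>I. norm (y i - x i) < e))"
proof
  assume x: "x \<in> closure A"
  show "\<forall>I e. finite I \<and> 0 < e \<longrightarrow> (\<exists>y\<in>A. \<forall>i\<in>I. norm (y i - x i) < e)"
  proof (intro allI impI)
    fix I :: "'a set" and e :: real assume Ie: "finite I \<and> 0 < e"
    define U where "U = (\<Inter>i\<in>I. {y::'a \<Rightarrow> complex. norm (y i - x i) < e})"
    have "open U"
      unfolding U_def using Ie
      by (intro open_INT ballI open_Collect_less continuous_intros) auto
    moreover have "x \<in> U" using Ie by (simp add: U_def)
    ultimately have "A \<inter> U \<noteq> {}"
      using x by (metis closure_iff_nhds_not_empty inf_commute order_refl)
    then show "\<exists>y\<in>A. \<forall>i\<in>I. norm (y i - x i) < e" by (auto simp: U_def)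
  qed
next
  assume *: "\<forall>I e. finite I \<and> 0 < e \<longrightarrow> (\<exists>y\<in>A. \<forall>i\<in>I. norm (y i - x i) < e)"
  show "x \<in> closure A"
    unfolding closure_iff_nhds_not_empty
  proof (intro allI impI)
    fix S U assume "U \<subseteq> S" "open U" "x \<in> U"
    then have "openin (product_topology (\<lambda>i. euclidean) UNIV) U"
      by (simp add: euclidean_product_topology)
    from product_topology_open_contains_basis[OF this \<open>x \<in> U\<close>]
    obtain X where X: "x \<in> (\<Pi>\<^sub>E i\<in>UNIV. X i)" "\<forall>i. open (X i)"
      "finite {i. X i \<noteq> UNIV}" "(\<Pi>\<^sub>E i\<in>UNIV. X i) \<subseteq> U" by auto
    have "\<forall>i. \<exists>e>0. ball (x i) e \<subseteq> X i"
      using X(1,2) by (metis PiE_mem UNIV_I openE)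
    then obtain e where e: "\<And>i. e i > 0" "\<And>i. ball (x i) (e i) \<subseteq> X i" by metis
    define I where "I = {i. X i \<noteq> UNIV}"
    \<comment> \<open>The inserted 1 keeps the minimum meaningful when I is empty.\<close>
    define d where "d = Min (insert 1 (e ` I))"
    have "finite I" "d > 0" using X(3) e by (auto simp: d_def I_def)
    with * obtain y where y: "y \<in> A" "\<forall>i\<in>I. norm (y i - x i) < d" by blast
    have "y i \<in> X i" for i
    proof (cases "i \<in> I")
      case True
      have "d \<le> e i" unfolding d_def using \<open>finite I\<close> True by (intro Min_le) auto
      with y True have "norm (y i - x i) < e i" by force
      then have "y i \<in> ball (x i) (e i)" by (simp add: dist_norm norm_minus_commute)
      then show ?thesis using e by blast
    qed (auto simp: I_def)
    then have "y \<in> U" using X(4) by (auto simp: PiE_def)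
    with y(1) \<open>U \<subseteq> S\<close> show "A \<inter> S \<noteq> {}" by blast
  qed
qed

definition linf :: "('x \<Rightarrow> complex) set" where
  "linf = {f. bounded (range f)}"

lemma linf_iff: "f \<in> linf \<longleftrightarrow> (\<exists>C. \<forall>x. norm (f x) \<le> C)"
  by (auto simp: linf_def bounded_iff)

lemma linfI: "(\<And>x. norm (f x) \<le> C) \<Longrightarrow> f \<in> linf"
  by (auto simp: linf_iff)

lemma linf_const [simp]: "(\<lambda>x. c) \<in> linf"
  by (rule linfI[of _ "norm c"]) simp

lemma linf_add: "f \<in> linf \<Longrightarrow> g \<in> linf \<Longrightarrow> (\<lambda>x. f x + g x) \<in> linf"
  unfolding linf_iff by (meson norm_triangle_mono)

lemma linf_mult: "f \<in> linf \<Longrightarrow> g \<in> linf \<Longrightarrow> (\<lambda>x. f x * g x) \<in> linf"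
  unfolding linf_iff norm_mult by (meson mult_mono norm_ge_zero order_trans)

lemma linf_sum: "(\<And>i. i \<in> I \<Longrightarrow> f i \<in> linf) \<Longrightarrow> (\<lambda>x. \<Sum>i\<in>I. f i x) \<in> linf"
  by (induction I rule: infinite_finite_induct) (auto intro: linf_add)

lemma linf_diff: "f \<in> linf \<Longrightarrow> g \<in> linf \<Longrightarrow> (\<lambda>x. f x - g x) \<in> linf"
  using linf_add[of f "\<lambda>x. (-1) * g x"] linf_mult[of "\<lambda>x. -1" g] by simp

lemma linf_comp: "f \<in> linf \<Longrightarrow> (\<lambda>x. f (h x)) \<in> linf"
  by (auto simp: linf_iff)

lemma linf_bound:
  assumes "f \<in> linf"
  obtains C where "C > 0" "\<And>x. norm (f x) \<le> C"
proof -
  from assms obtain C where "\<And>x. norm (f x) \<le> C" by (auto simp: linf_iff)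
  then have "\<And>x. norm (f x) \<le> max C 1" by (simp add: le_max_iff_disj)
  then show ?thesis by (meson that max.cobounded2 less_le_trans zero_less_one)
qed

text \<open>\<open>L\<close> is a cluster point of the evaluations. Approximating finitely many sequences at a common
  index makes it multiplicative, as an ultrafilter limit is.\<close>

lemma ex_generalized_limit:
  "\<exists>L :: nat functional. (\<forall>f. f \<notin> linf \<longrightarrow> L f = 0) \<and>
     (\<forall>I e N. finite I \<and> I \<subseteq> linf \<and> e > 0 \<longrightarrow> (\<exists>n\<ge>N. \<forall>f\<in>I. norm (f n - L f) < e))"
proof -
  \<comment> \<open>Extending by 0 off \<open>linf\<close> makes every coordinate of
    \<open>ev n\<close> bounded in n, so the evaluations lie in a product of discs and Tychonoff
    applies.\<close>
  define ev :: "nat \<Rightarrow> nat functional" where "ev = (\<lambda>n f. if f \<in> linf then f n else 0)"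
  have "\<forall>f. \<exists>C. \<forall>n. norm (ev n f) \<le> C"
  proof
    fix f show "\<exists>C. \<forall>n. norm (ev n f) \<le> C"
    proof (cases "f \<in> linf")
      case True
      then show ?thesis by (auto simp: linf_iff ev_def)
    next
      case False
      then show ?thesis by (auto simp: ev_def)
    qed
  qed
  then obtain C where C: "\<And>f n. norm (ev n f) \<le> C f" by metis
  define K :: "nat functional set" where "K = (\<Pi>\<^sub>E f\<in>UNIV. cball 0 (C f))"
  have "compactin (product_topology (\<lambda>i. euclidean) UNIV) K"
    unfolding K_def by (subst compactin_PiE) auto
  then have "compact K" by (simp add: euclidean_product_topology)
  have "ev n \<in> K" for n using C by (auto simp: K_def)
  then have "eventually (\<lambda>x. x \<in> K) (filtermap ev sequentially)"
    by (simp add: eventually_filtermap)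
  moreover have "filtermap ev sequentially \<noteq> bot" by (simp add: filtermap_bot_iff)
  ultimately obtain L where L: "inf (nhds L) (filtermap ev sequentially) \<noteq> bot"
    using \<open>compact K\<close> by (auto simp: compact_filter)
  \<comment> \<open>A cluster point lies in the closure of every tail of the sequence; this provides
    arbitrarily large common indices.\<close>
  have near: "\<exists>n\<ge>N. \<forall>f\<in>I. norm (ev n f - L f) < e" if "finite I" "e > 0" for I e N
  proof (rule ccontr)
    assume no: "\<not> ?thesis"
    have "L \<in> closure (ev ` {N..})"
      unfolding closure_iff_nhds_not_empty
    proof (intro allI impI notI)
      fix S U assume *: "U \<subseteq> S" "open U" "L \<in> U" "ev ` {N..} \<inter> S = {}"
      have "eventually (\<lambda>x. x \<in> U) (nhds L)" using * by (simp add: eventually_nhds_in_open)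
      moreover have "eventually (\<lambda>x. x \<notin> U) (filtermap ev sequentially)"
        unfolding eventually_filtermap eventually_sequentially using * by blast
      ultimately have "eventually (\<lambda>x. False) (inf (nhds L) (filtermap ev sequentially))"
        unfolding eventually_inf by blast
      then show False using L by (simp add: trivial_limit_def)
    qed
    then have "\<exists>y\<in>ev ` {N..}. \<forall>f\<in>I. norm (y f - L f) < e"
      unfolding closure_fun_iff using that by blast
    with no show False by auto
  qed
  have "L f = 0" if "f \<notin> linf" for f
  proof (rule ccontr)
    assume "L f \<noteq> 0"
    then show False using near[of "{f}" "norm (L f)" 0] that by (simp add: ev_def)
  qed
  moreover have "\<exists>n\<ge>N. \<forall>f\<in>I. norm (f n - L f) < e" if "finite I" "I \<subseteq> linf" "e > 0" for I e N
  proof -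
    from near[OF that(1,3), of N] obtain n where "n \<ge> N" "\<forall>f\<in>I. norm (ev n f - L f) < e" by auto
    then show ?thesis using that(2) by (intro exI[of _ n]) (auto simp: ev_def subset_iff)
  qed
  ultimately show ?thesis by blast
qed

definition ulim :: "nat functional" where
  "ulim = (SOME L. (\<forall>f. f \<notin> linf \<longrightarrow> L f = 0) \<and>
     (\<forall>I e N. finite I \<and> I \<subseteq> linf \<and> e > 0 \<longrightarrow> (\<exists>n\<ge>N. \<forall>f\<in>I. norm (f n - L f) < e)))"

lemma ulim_outside: "f \<notin> linf \<Longrightarrow> ulim f = 0"
  and ulim_approx: "finite I \<Longrightarrow> I \<subseteq> linf \<Longrightarrow> e > 0 \<Longrightarrow> \<exists>n\<ge>N. \<forall>f\<in>I. norm (f n - ulim f) < e"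
  using someI_ex[OF ex_generalized_limit] unfolding ulim_def[symmetric] by blast+

text \<open>Any closed relation that eventually holds between the terms passes to the limits,
  because \<open>ulim_approx\<close> reaches all three limits at one common index. Three places
  suffice for a sum or a product; shorter relations repeat an argument.\<close>

lemma ulim_closed:
  assumes S: "closed S" and fgh: "f \<in> linf" "g \<in> linf" "h \<in> linf"
    and "\<And>n. n \<ge> N \<Longrightarrow> (f n, g n, h n) \<in> S"
  shows "(ulim f, ulim g, ulim h) \<in> S"
proof -
  have "\<exists>y\<in>S. dist y (ulim f, ulim g, ulim h) < e" if "e > 0" for e
  proof -
    obtain n where n: "n \<ge> N" "\<forall>k\<in>{f, g, h}. norm (k n - ulim k) < e / 3"
      using ulim_approx[of "{f, g, h}" "e / 3" N] fgh \<open>e > 0\<close> by auto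
    have dist_le: "dist (a, b) (c, d) \<le> dist a c + dist b d"
      for a c :: "'u::metric_space" and b d :: "'v::metric_space"
      by (simp add: dist_Pair_Pair sqrt_sum_squares_le_sum)
    have "dist (f n, g n, h n) (ulim f, ulim g, ulim h)
        \<le> dist (f n) (ulim f) + dist (g n, h n) (ulim g, ulim h)"
      by (rule dist_le)
    also have "\<dots> \<le> dist (f n) (ulim f) + (dist (g n) (ulim g) + dist (h n) (ulim h))"
      by (intro add_left_mono dist_le)
    also have "\<dots> < e" using n(2) by (simp add: dist_norm)
    finally show ?thesis using assms(5)[OF n(1)] by blast
  qed
  then have "(ulim f, ulim g, ulim h) \<in> closure S" by (simp add: closure_approachable)
  with S show ?thesis by (simp add: closure_closed)
qed

lemma ulim_add: "f \<in> linf \<Longrightarrow> g \<in> linf \<Longrightarrow> ulim (\<lambda>n. f n + g n) = ulim f + ulim g"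
  using ulim_closed[of "{(a, b, c). c = a + b}" f g "\<lambda>n. f n + g n" 0]
  by (force simp: case_prod_unfold linf_add intro!: closed_Collect_eq continuous_intros)

lemma ulim_mult: "f \<in> linf \<Longrightarrow> g \<in> linf \<Longrightarrow> ulim (\<lambda>n. f n * g n) = ulim f * ulim g"
  using ulim_closed[of "{(a, b, c). c = a * b}" f g "\<lambda>n. f n * g n" 0]
  by (force simp: case_prod_unfold linf_mult intro!: closed_Collect_eq continuous_intros)

lemma ulim_const [simp]: "ulim (\<lambda>n. c) = c"
  using ulim_closed[of "{(a, b, d). a = c}" "\<lambda>n. c" "\<lambda>n. c" "\<lambda>n. c" 0]
  by (force simp: case_prod_unfold intro!: closed_Collect_eq continuous_intros)

text \<open>The convention that \<open>ulim\<close> is 0 on unbounded sequences is compatible with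
  scaling: for c \<noteq> 0 the scaled sequence is unbounded as well, and for c = 0 both sides
  vanish.\<close>

lemma ulim_cmult: "ulim (\<lambda>n. c * f n) = c * ulim f"
proof (cases "f \<in> linf")
  case True
  then show ?thesis using ulim_mult[of "\<lambda>n. c" f] by simp
next
  case False
  then have "c = 0 \<or> (\<lambda>n. c * f n) \<notin> linf"
    using linf_mult[of "\<lambda>n. inverse c" "\<lambda>n. c * f n"] by (auto simp: field_simps)
  then show ?thesis using False by (auto simp: ulim_outside)
qed

lemma ulim_diff: "f \<in> linf \<Longrightarrow> g \<in> linf \<Longrightarrow> ulim (\<lambda>n. f n - g n) = ulim f - ulim g"
  using ulim_add[of f "\<lambda>n. (-1) * g n"] linf_mult[of "\<lambda>n. -1" g] ulim_cmult[of "-1" g] by simp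

lemma linf_cnj: "f \<in> linf \<Longrightarrow> (\<lambda>x. cnj (f x)) \<in> linf"
  by (simp add: linf_iff)

lemma ulim_cnj: "f \<in> linf \<Longrightarrow> ulim (\<lambda>n. cnj (f n)) = cnj (ulim f)"
  using ulim_closed[of "{(a, b, c). b = cnj a}" f "\<lambda>n. cnj (f n)" f 0]
  by (force simp: case_prod_unfold linf_cnj intro!: closed_Collect_eq continuous_intros)

lemma ulim_norm_le:
  assumes "f \<in> linf" "\<And>n. n \<ge> N \<Longrightarrow> norm (f n) \<le> C"
  shows "norm (ulim f) \<le> C"
  using ulim_closed[of "{(a, b, c). norm a \<le> C}" f f f N] assms
  by (force simp: case_prod_unfold intro!: closed_Collect_le continuous_intros)

lemma ulim_norm_ge:
  assumes "f \<in> linf" "\<And>n. n \<ge> N \<Longrightarrow> C \<le> norm (f n)"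
  shows "C \<le> norm (ulim f)"
  using ulim_closed[of "{(a, b, c). C \<le> norm a}" f f f N] assms
  by (force simp: case_prod_unfold intro!: closed_Collect_le continuous_intros)

lemma linf_ulim:
  assumes "\<And>s n. norm (f s n) \<le> C"
  shows "(\<lambda>s. ulim (f s)) \<in> linf"
  by (rule linfI[of _ C], rule ulim_norm_le[of _ 0]) (use assms in \<open>auto intro: linfI\<close>)

text \<open>The ball of radius M in the dual of the bounded functions. The estimate quantifies over
  all pointwise bounds C instead of naming the sup norm, so suprema never have to be evaluated, and
  each condition is closed in the pointwise topology.\<close>

definition linf_dual :: "real \<Rightarrow> 'x functional set" where
  "linf_dual M = {\<Phi>. linear_functional linf \<Phi> \<and>
     (\<forall>f C. (\<forall>x. norm (f x) \<le> C) \<longrightarrow> norm (\<Phi> f) \<le> M * C)}"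

lemma linf_dualD:
  assumes "\<Phi> \<in> linf_dual M"
  shows linf_dual_outside: "f \<notin> linf \<Longrightarrow> \<Phi> f = 0"
    and linf_dual_add: "f \<in> linf \<Longrightarrow> g \<in> linf \<Longrightarrow> \<Phi> (\<lambda>x. f x + g x) = \<Phi> f + \<Phi> g"
    and linf_dual_cmult: "f \<in> linf \<Longrightarrow> \<Phi> (\<lambda>x. c * f x) = c * \<Phi> f"
    and linf_dual_bound: "(\<And>x. norm (f x) \<le> C) \<Longrightarrow> norm (\<Phi> f) \<le> M * C"
  using assms unfolding linf_dual_def linear_functional_def by blast+

lemma linf_dual_nonneg: "\<Phi> \<in> linf_dual M \<Longrightarrow> 0 \<le> M"
  using linf_dual_bound[of \<Phi> M "\<lambda>x. 0" 1] by (simp add: order_trans[OF norm_ge_zero])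

lemma linf_dual_diff:
  "\<Phi> \<in> linf_dual M \<Longrightarrow> f \<in> linf \<Longrightarrow> g \<in> linf \<Longrightarrow> \<Phi> (\<lambda>x. f x - g x) = \<Phi> f - \<Phi> g"
  using linf_dual_add[of \<Phi> M f "\<lambda>x. (-1) * g x"] linf_dual_cmult[of \<Phi> M g "-1"]
    linf_mult[of "\<lambda>x. -1" g] by simp

lemma linf_dual_sum:
  assumes "\<Phi> \<in> linf_dual M" "\<And>i. i \<in> I \<Longrightarrow> f i \<in> linf"
  shows "\<Phi> (\<lambda>x. \<Sum>i\<in>I. f i x) = (\<Sum>i\<in>I. \<Phi> (f i))"
proof -
  have "\<Phi> (\<lambda>x. 0) = 0" using linf_dual_cmult[OF assms(1), of "\<lambda>x. 0" 0] by simp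
  then show ?thesis
    using assms(2)
    by (induction I rule: infinite_finite_induct)
      (simp_all add: linf_dual_add[OF assms(1)] linf_sum)
qed

lemma linf_slice:
  assumes "\<Phi> \<in> linf_dual M" "\<And>s t. norm (f s t) \<le> C"
  shows "(\<lambda>s. \<Phi> (f s)) \<in> linf"
  by (rule linfI, rule linf_dual_bound[OF assms(1)], rule assms(2))

subsection \<open>Interchange of bounded functionals\<close>

text \<open>The factor \<open>cnj (sgn z)\<close> rotates z onto its modulus. Multiplying test
  functions by it turns norms into values of a functional, so that they add up.\<close>

lemma cnj_sgn_mult: "cnj (sgn z) * z = of_real (norm z)"
proof (cases "z = 0")
  case False
  have "cnj z * z = of_real (norm z) * of_real (norm z)"
    using complex_norm_square[of z] by (simp add: mult.commute power2_eq_square)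
  with False show ?thesis by (simp add: sgn_eq field_simps)
qed simp

lemma norm_cnj_sgn_le: "norm (cnj (sgn z)) \<le> 1"
  by (simp add: norm_sgn)

lemma norm_disjoint_add_le:
  fixes a b :: complex
  assumes "a = 0 \<or> b = 0" "norm a \<le> C" "norm b \<le> C"
  shows "norm (a + b) \<le> C"
  using assms by auto

text \<open>The total variation of a bounded functional on \<open>\<ell>\<^sup>\<infinity>\<close>, as a finitely additive set function;
  the phase of a test function is free, so that the real part suffices.\<close>

definition variation :: "'s functional \<Rightarrow> 's set \<Rightarrow> real" where
  "variation \<Phi> A = (SUP h\<in>{h. (\<forall>x. norm (h x) \<le> 1) \<and> (\<forall>x. x \<notin> A \<longrightarrow> h x = 0)}. Re (\<Phi> h))"

lemma Re_linf_dual_le: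
  assumes "\<Phi> \<in> linf_dual M" "\<And>x. norm (h x) \<le> 1"
  shows "Re (\<Phi> h) \<le> M"
  using linf_dual_bound[OF assms(1), of h 1] assms(2) complex_Re_le_cmod[of "\<Phi> h"] by simp

lemma Re_le_variation:
  assumes "\<Phi> \<in> linf_dual M" "\<And>x. norm (h x) \<le> 1" "\<And>x. x \<notin> A \<Longrightarrow> h x = 0"
  shows "Re (\<Phi> h) \<le> variation \<Phi> A"
  unfolding variation_def
proof (rule cSUP_upper)
  show "bdd_above ((\<lambda>h. Re (\<Phi> h)) ` {h. (\<forall>x. norm (h x) \<le> 1) \<and> (\<forall>x. x \<notin> A \<longrightarrow> h x = 0)})"
    using Re_linf_dual_le[OF assms(1)] by (auto simp: bdd_above_def)
qed (use assms in auto)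

lemma variation_le:
  assumes "\<And>h. (\<And>x. norm (h x) \<le> 1) \<Longrightarrow> (\<And>x. x \<notin> A \<Longrightarrow> h x = 0) \<Longrightarrow> Re (\<Phi> h) \<le> v"
  shows "variation \<Phi> A \<le> v"
  unfolding variation_def
proof (rule cSUP_least)
  show "{h. (\<forall>x. norm (h x :: complex) \<le> 1) \<and> (\<forall>x. x \<notin> A \<longrightarrow> h x = 0)} \<noteq> {}"
    by (auto intro!: exI[of _ "\<lambda>x. 0"])
qed (use assms in auto)

lemma variation_nonneg:
  assumes "\<Phi> \<in> linf_dual M"
  shows "0 \<le> variation \<Phi> A"
  using Re_le_variation[OF assms, of "\<lambda>x. 0" A] linf_dual_bound[OF assms, of "\<lambda>x. 0" 0] by simp

text \<open>A test function on the union restricts to test functions on the two pieces; conversely,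
  test functions with disjoint supports add up to one that is still bounded by 1.\<close>

lemma variation_Un_disjoint:
  assumes \<Phi>: "\<Phi> \<in> linf_dual M" and AB: "A \<inter> B = {}"
  shows "variation \<Phi> (A \<union> B) = variation \<Phi> A + variation \<Phi> B"
proof (rule antisym)
  show "variation \<Phi> (A \<union> B) \<le> variation \<Phi> A + variation \<Phi> B"
  proof (rule variation_le)
    fix h :: "'a \<Rightarrow> complex" assume h: "\<And>x. norm (h x) \<le> 1" "\<And>x. x \<notin> A \<union> B \<Longrightarrow> h x = 0"
    let ?f = "\<lambda>x. if x \<in> A then h x else 0" and ?g = "\<lambda>x. if x \<in> B then h x else 0"
    have fg: "?f \<in> linf" "?g \<in> linf" using h by (auto intro!: linfI[of _ 1])
    have "h = (\<lambda>x. ?f x + ?g x)" using h AB by (auto simp: fun_eq_iff)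
    then have "\<Phi> h = \<Phi> ?f + \<Phi> ?g" using linf_dual_add[OF \<Phi> fg] by metis
    then have "Re (\<Phi> h) = Re (\<Phi> ?f) + Re (\<Phi> ?g)" by simp
    also have "\<dots> \<le> variation \<Phi> A + variation \<Phi> B"
      using h by (intro add_mono Re_le_variation[OF \<Phi>]) auto
    finally show "Re (\<Phi> h) \<le> variation \<Phi> A + variation \<Phi> B" .
  qed
  \<comment> \<open>One supremum is released at a time: the first test function is fixed while the
    second varies.\<close>
  have "variation \<Phi> A \<le> variation \<Phi> (A \<union> B) - variation \<Phi> B"
  proof (rule variation_le)
    fix f :: "'a \<Rightarrow> complex" assume f: "\<And>x. norm (f x) \<le> 1" "\<And>x. x \<notin> A \<Longrightarrow> f x = 0"
    have "variation \<Phi> B \<le> variation \<Phi> (A \<union> B) - Re (\<Phi> f)"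
    proof (rule variation_le)
      fix g :: "'a \<Rightarrow> complex" assume g: "\<And>x. norm (g x) \<le> 1" "\<And>x. x \<notin> B \<Longrightarrow> g x = 0"
      have "f x = 0 \<or> g x = 0" for x using f(2) g(2) AB by blast
      then have "Re (\<Phi> (\<lambda>x. f x + g x)) \<le> variation \<Phi> (A \<union> B)"
        using f g by (intro Re_le_variation[OF \<Phi>] norm_disjoint_add_le) auto
      moreover have "\<Phi> (\<lambda>x. f x + g x) = \<Phi> f + \<Phi> g"
        using f g by (intro linf_dual_add[OF \<Phi>]) (auto intro!: linfI[of _ 1])
      ultimately show "Re (\<Phi> g) \<le> variation \<Phi> (A \<union> B) - Re (\<Phi> f)" by simp
    qed
    then show "Re (\<Phi> f) \<le> variation \<Phi> (A \<union> B) - variation \<Phi> B" by simp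
  qed
  then show "variation \<Phi> A + variation \<Phi> B \<le> variation \<Phi> (A \<union> B)" by simp
qed

text \<open>A Chebyshev-type splitting of f at level \<delta>: the part where f is large is tested
  by the variation of that set, the rest is uniformly at most \<delta> and costs at most M times
  \<delta>.\<close>

lemma norm_le_variation:
  assumes \<Phi>: "\<Phi> \<in> linf_dual M" and f: "\<And>x. norm (f x) \<le> C" and "C > 0" "\<delta> \<ge> 0"
  shows "norm (\<Phi> f) \<le> C * variation \<Phi> {x. \<delta> \<le> norm (f x)} + M * \<delta>"
proof -
  let ?A = "{x. \<delta> \<le> norm (f x)}"
  define g where "g = (\<lambda>x. if x \<in> ?A then f x else 0)"
  define k where "k = (\<lambda>x. if x \<in> ?A then 0 else f x)"
  define z where "z = cnj (sgn (\<Phi> g))"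
  have norms: "norm (g x) \<le> C" "norm (k x) \<le> C" "norm (k x) \<le> \<delta>" for x
    using f[of x] \<open>C > 0\<close> \<open>\<delta> \<ge> 0\<close> by (auto simp: g_def k_def)
  then have gk: "g \<in> linf" "k \<in> linf" by (blast intro: linfI)+
  have "f = (\<lambda>x. g x + k x)" by (auto simp: g_def k_def)
  then have "\<Phi> f = \<Phi> g + \<Phi> k" using linf_dual_add[OF \<Phi> gk] by metis
  moreover have "norm (\<Phi> k) \<le> M * \<delta>" using norms by (intro linf_dual_bound[OF \<Phi>])
  moreover have "norm (\<Phi> g) \<le> C * variation \<Phi> ?A"
  proof -
    have "norm (z / of_real C * g x) \<le> 1" for x
    proof -
      have "norm (z / of_real C * g x) = norm z * (norm (g x) / C)"
        using \<open>C > 0\<close> by (simp add: norm_mult norm_divide)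
      also have "\<dots> \<le> 1 * 1"
        using norms(1)[of x] \<open>C > 0\<close> norm_cnj_sgn_le[of "\<Phi> g"]
        by (intro mult_mono) (auto simp: z_def)
      finally show ?thesis by simp
    qed
    then have "Re (\<Phi> (\<lambda>x. z / of_real C * g x)) \<le> variation \<Phi> ?A"
      by (intro Re_le_variation[OF \<Phi>]) (auto simp: g_def)
    also have "\<Phi> (\<lambda>x. z / of_real C * g x) = of_real (norm (\<Phi> g) / C)"
      unfolding linf_dual_cmult[OF \<Phi> gk(1)] by (simp add: z_def cnj_sgn_mult)
    finally show ?thesis using \<open>C > 0\<close> by (simp add: field_simps)
  qed
  ultimately show ?thesis using norm_triangle_ineq[of "\<Phi> g" "\<Phi> k"] by simp
qed

section \<open>Finitely additive set functions on the whole power set\<close>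

locale content =
  fixes v :: "'s set \<Rightarrow> real"
  assumes nonneg: "0 \<le> v A"
    and additive: "A \<inter> B = {} \<Longrightarrow> v (A \<union> B) = v A + v B"
begin

lemma empty [simp]: "v {} = 0"
  using additive[of "{}" "{}"] by simp

lemma mono: "A \<subseteq> B \<Longrightarrow> v A \<le> v B"
  using additive[of A "B - A"] nonneg[of "B - A"] by (simp add: Un_absorb1)

lemma subadditive: "v (A \<union> B) \<le> v A + v B"
  using additive[of A "B - A"] mono[of "B - A" B] by simp

lemma finite_subadditive: "finite J \<Longrightarrow> v (\<Union>j\<in>J. A j) \<le> (\<Sum>j\<in>J. v (A j))"
  by (induction J rule: finite_induct) (auto intro: order_trans[OF subadditive])

text \<open>If almost all pairwise intersections were small, the union of enough of the sets would
  be too large.\<close>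

lemma ex_large_intersections:
  assumes N: "infinite N" and "\<eta> > 0" and large: "\<And>n. n \<in> N \<Longrightarrow> \<eta> \<le> v (B \<inter> A n)"
  obtains m \<eta>' where "m \<in> N" "\<eta>' > 0" "infinite {n \<in> N. \<eta>' \<le> v (B \<inter> A m \<inter> A n)}"
proof (rule ccontr)
  assume "\<not> thesis"
  then have small: "\<And>m \<eta>'. m \<in> N \<Longrightarrow> \<eta>' > 0 \<Longrightarrow> finite {n \<in> N. \<eta>' \<le> v (B \<inter> A m \<inter> A n)}"
    using that by blast
  have "\<exists>J. finite J \<and> J \<subseteq> N \<and> real j * (\<eta> / 2) \<le> v (B \<inter> (\<Union>n\<in>J. A n))" for j
  proof (induction j)
    case 0
    show ?case by (rule exI[of _ "{}"]) simp
  next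
    case (Suc j)
    then obtain J where J: "finite J" "J \<subseteq> N" "real j * (\<eta> / 2) \<le> v (B \<inter> (\<Union>n\<in>J. A n))"
      by blast
    \<comment> \<open>Small enough that \<open>card J\<close> intersections together weigh at most
      \<eta> / 2; the added 1 avoids division by 0 for empty J.\<close>
    define \<eta>' where "\<eta>' = \<eta> / (2 * (real (card J) + 1))"
    have "\<eta>' > 0" using \<open>\<eta> > 0\<close> by (simp add: \<eta>'_def)
    then have "finite (\<Union>m\<in>J. {n \<in> N. \<eta>' \<le> v (B \<inter> A m \<inter> A n)})"
      using J small by blast
    then have "infinite (N - (\<Union>m\<in>J. {n \<in> N. \<eta>' \<le> v (B \<inter> A m \<inter> A n)}))"
      using N by (rule Diff_infinite_finite)
    then obtain n where "n \<in> N - (\<Union>m\<in>J. {n \<in> N. \<eta>' \<le> v (B \<inter> A m \<inter> A n)})"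
      using infinite_imp_nonempty by blast
    then have n: "n \<in> N" "\<And>m. m \<in> J \<Longrightarrow> v (B \<inter> A m \<inter> A n) \<le> \<eta>'" by force+
    let ?U = "\<Union>n\<in>J. A n"
    have "v (B \<inter> A n \<inter> ?U) \<le> (\<Sum>m\<in>J. v (B \<inter> A m \<inter> A n))"
    proof -
      have "B \<inter> A n \<inter> ?U = (\<Union>m\<in>J. B \<inter> A m \<inter> A n)" by blast
      then show ?thesis by (simp only:) (rule finite_subadditive[OF J(1)])
    qed
    also have "\<dots> \<le> real (card J) * \<eta>'"
      using n(2) by (rule sum_bounded_above)
    also have "\<dots> \<le> \<eta> / 2" using \<open>\<eta> > 0\<close> by (simp add: \<eta>'_def field_simps)
    finally have "v (B \<inter> A n \<inter> ?U) \<le> \<eta> / 2" .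
    moreover have "v (B \<inter> A n) = v (B \<inter> A n \<inter> ?U) + v (B \<inter> A n - ?U)"
      using additive[of "B \<inter> A n \<inter> ?U" "B \<inter> A n - ?U"] by (simp add: Int_Diff_Un Int_Diff_disjoint)
    \<comment> \<open>Inside B the set \<open>A n\<close> weighs at least \<eta> and overlaps the
      union by at most \<eta> / 2, so it contributes at least \<eta> / 2.\<close>
    moreover have "v (B \<inter> (\<Union>n\<in>insert n J. A n)) = v (B \<inter> ?U) + v (B \<inter> A n - ?U)"
    proof -
      have "B \<inter> (\<Union>n\<in>insert n J. A n) = (B \<inter> ?U) \<union> (B \<inter> A n - ?U)"
        "(B \<inter> ?U) \<inter> (B \<inter> A n - ?U) = {}" by blast+
      then show ?thesis by (metis additive)
    qed
    ultimately have "real (Suc j) * (\<eta> / 2) \<le> v (B \<inter> (\<Union>n\<in>insert n J. A n))"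
      using large[OF n(1)] J(3) by (simp add: field_simps)
    then show ?case using J n by (intro exI[of _ "insert n J"]) auto
  qed
  moreover obtain j :: nat where "v UNIV < real j * (\<eta> / 2)"
    using \<open>\<eta> > 0\<close> ex_less_of_nat_mult[of "\<eta> / 2"] by auto
  moreover have "v (B \<inter> (\<Union>n\<in>J. A n)) \<le> v UNIV" for J by (rule mono) simp
  ultimately show False by (meson not_le order_trans)
qed

text \<open>The state of the recursion is the intersection B so far and an infinite set N of indices
  whose sets meet B in mass bounded below. The lower bound may shrink from step to step: positivity
  alone keeps the intersections nonempty.\<close>

lemma ex_subsequence_intersecting:
  assumes "\<eta> > 0" and large: "\<And>n. \<eta> \<le> v (A n)"
  obtains m :: "nat \<Rightarrow> nat" where "strict_mono m" "\<And>k. (\<Inter>i\<le>k. A (m i)) \<noteq> {}"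
proof -
  define P where "P = (\<lambda>(k::nat) (B, N). infinite N \<and> (\<exists>\<eta>>0. \<forall>n\<in>N. \<eta> \<le> v (B \<inter> A n)))"
  define Q where "Q = (\<lambda>(k::nat) (B, N) (B', N'). \<exists>m\<in>N. N' \<subseteq> N \<inter> {m<..} \<and> B' = B \<inter> A m)"
  have "\<exists>f. \<forall>k. P k (f k) \<and> Q k (f k) (f (Suc k))"
  proof (rule dependent_nat_choice)
    show "\<exists>x. P 0 x" using assms by (intro exI[of _ "(UNIV, UNIV)"]) (auto simp: P_def)
  next
    fix x k assume "P k x"
    then obtain B N \<eta> where x: "x = (B, N)" "infinite N" "\<eta> > 0" "\<And>n. n \<in> N \<Longrightarrow> \<eta> \<le> v (B \<inter> A n)"
      by (cases x) (auto simp: P_def)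
    from x(2-4) obtain m \<eta>' where m: "m \<in> N" "\<eta>' > 0" "infinite {n \<in> N. \<eta>' \<le> v (B \<inter> A m \<inter> A n)}"
      by (rule ex_large_intersections)
    \<comment> \<open>Discarding the indices up to m forces the chosen indices to increase strictly
      and still leaves infinitely many.\<close>
    let ?N = "{n \<in> N. \<eta>' \<le> v (B \<inter> A m \<inter> A n)} - {..m}"
    have "P (Suc k) (B \<inter> A m, ?N)" using m by (auto simp: P_def)
    moreover have "Q k x (B \<inter> A m, ?N)"
      using m(1) unfolding Q_def x(1) prod.case by (intro bexI[of _ m]) auto
    ultimately
    show "\<exists>y. P (Suc k) y \<and> Q k x y" by blast
  qed
  then obtain f where f: "\<And>k. P k (f k)" "\<And>k. Q k (f k) (f (Suc k))" by blast
  define B where "B = fst \<circ> f"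
  define N where "N = snd \<circ> f"
  have "\<forall>k. \<exists>m\<in>N k. N (Suc k) \<subseteq> N k \<inter> {m<..} \<and> B (Suc k) = B k \<inter> A m"
    using f(2) by (simp add: Q_def B_def N_def case_prod_unfold)
  then obtain m where m: "\<And>k. m k \<in> N k" "\<And>k. N (Suc k) \<subseteq> N k \<inter> {m k<..}"
    "\<And>k. B (Suc k) = B k \<inter> A (m k)" by metis
  have "strict_mono m" unfolding strict_mono_Suc_iff using m by fastforce
  moreover have "(\<Inter>i\<le>k. A (m i)) \<noteq> {}" for k
  proof -
    have "B (Suc k) \<subseteq> (\<Inter>i\<le>k. A (m i))"
    proof (induction k)
      case (Suc k)
      then show ?case unfolding m(3)[of "Suc k"] by (auto simp: atMost_Suc)
    qed (auto simp: m(3))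
    moreover have "B (Suc k) \<noteq> {}"
    proof
      assume "B (Suc k) = {}"
      then have "infinite (N (Suc k))" "\<exists>\<eta>>0. \<forall>n\<in>N (Suc k). \<eta> \<le> 0"
        using f(1)[of "Suc k"] by (auto simp: P_def B_def N_def case_prod_unfold)
      then show False by (metis all_not_in_conv finite.emptyI not_le)
    qed
    ultimately show ?thesis by blast
  qed
  ultimately show thesis by (rule that)
qed

end

text \<open>A substitute for the bounded convergence theorem.\<close>

lemma ex_subsequence_large:
  fixes f :: "nat \<Rightarrow> 's \<Rightarrow> complex"
  assumes \<Phi>: "\<Phi> \<in> linf_dual M" and "C > 0" and f: "\<And>n x. norm (f n x) \<le> C"
    and \<epsilon>: "\<And>n. \<epsilon> \<le> norm (\<Phi> (f n))" and \<delta>: "\<delta> \<ge> 0" "M * \<delta> < \<epsilon>"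
  obtains m :: "nat \<Rightarrow> nat" where "strict_mono m" "\<And>k. \<exists>x. \<forall>i\<le>k. \<delta> \<le> norm (f (m i) x)"
proof -
  interpret content "variation \<Phi>"
    by standard (rule variation_nonneg[OF \<Phi>], rule variation_Un_disjoint[OF \<Phi>])
  let ?A = "\<lambda>n. {x. \<delta> \<le> norm (f n x)}"
  have large: "(\<epsilon> - M * \<delta>) / C \<le> variation \<Phi> (?A n)" for n
    using norm_le_variation[OF \<Phi>, of "f n" C \<delta>] f \<delta>(1) \<epsilon>[of n] \<open>C > 0\<close>
    by (simp add: field_simps)
  have pos: "(\<epsilon> - M * \<delta>) / C > 0" using \<delta> \<open>C > 0\<close> by simp
  show thesis
  proof (rule ex_subsequence_intersecting[of _ ?A, OF pos large])
    fix m :: "nat \<Rightarrow> nat"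
    assume m: "strict_mono m" "\<And>k. (\<Inter>i\<le>k. ?A (m i)) \<noteq> {}"
    have "\<exists>x. \<forall>i\<le>k. \<delta> \<le> norm (f (m i) x)" for k
    proof -
      obtain x where "x \<in> (\<Inter>i\<le>k. ?A (m i))" using m(2) by blast
      then show ?thesis by auto
    qed
    with m(1) show thesis by (rule that)
  qed
qed

text \<open>A grid of squares of side e / 2 cuts the plane into cells; bounded functions meet only
  finitely many cells, so the points have finitely many joint cell patterns. The map r replaces a
  point by a representative of its pattern.\<close>

lemma ex_finite_oscillation:
  fixes F :: "('s \<Rightarrow> complex) set"
  assumes "finite F" "F \<subseteq> linf" "e > 0"
  obtains r :: "'s \<Rightarrow> 's" where "finite (range r)" "\<And>f s. f \<in> F \<Longrightarrow> norm (f s - f (r s)) < e"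
    "\<And>s. r (r s) = r s"
proof -
  define q :: "complex \<Rightarrow> int \<times> int" where "q z = (\<lfloor>Re z * 2 / e\<rfloor>, \<lfloor>Im z * 2 / e\<rfloor>)" for z
  have near: "norm (z - w) < e" if "q z = q w" for z w
  proof -
    have close: "\<bar>a - b\<bar> < e / 2" if eq: "\<lfloor>a * 2 / e\<rfloor> = \<lfloor>b * 2 / e\<rfloor>" for a b
    proof -
      have "\<bar>a * 2 / e - b * 2 / e\<bar> < 1"
        using floor_correct[of "a * 2 / e"] floor_correct[of "b * 2 / e"] eq by linarith
      then have "\<bar>a * 2 - b * 2\<bar> < e"
        using \<open>e > 0\<close> by (simp add: diff_divide_distrib[symmetric] abs_divide)
      then show ?thesis by linarith
    qed
    have "norm (z - w) \<le> \<bar>Re (z - w)\<bar> + \<bar>Im (z - w)\<bar>" by (rule cmod_le)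
    also have "\<dots> < e" using close[of "Re z" "Re w"] close[of "Im z" "Im w"] that by (simp add: q_def)
    finally show ?thesis .
  qed
  have fin: "finite (q ` range f)" if "f \<in> F" for f
  proof -
    have "f \<in> linf" using that assms by blast
    then obtain C where C: "\<And>s. norm (f s) \<le> C" by (auto simp: linf_iff)
    have sub: "\<lfloor>a * 2 / e\<rfloor> \<in> {\<lfloor>- C * 2 / e\<rfloor>..\<lfloor>C * 2 / e\<rfloor>}" if "\<bar>a\<bar> \<le> C" for a
    proof -
      have "- C * 2 / e \<le> a * 2 / e" "a * 2 / e \<le> C * 2 / e"
        using that \<open>e > 0\<close> by (intro divide_right_mono; simp)+
      then show ?thesis by (simp add: floor_mono)
    qed
    have "q (f s) \<in> {\<lfloor>- C * 2 / e\<rfloor>..\<lfloor>C * 2 / e\<rfloor>} \<times> {\<lfloor>- C * 2 / e\<rfloor>..\<lfloor>C * 2 / e\<rfloor>}" for s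
      using sub[of "Re (f s)"] sub[of "Im (f s)"] C[of s]
        abs_Re_le_cmod[of "f s"] abs_Im_le_cmod[of "f s"] by (auto simp: q_def)
    then show ?thesis
      by (intro finite_subset[OF _ finite_cartesian_product[OF finite_atLeastAtMost_int finite_atLeastAtMost_int]])
        blast
  qed
  define R where "R = (\<lambda>s. \<lambda>f\<in>F. q (f s))"
  have "range R \<subseteq> (\<Pi>\<^sub>E f\<in>F. q ` range f)" by (auto simp: R_def)
  then have "finite (range R)" using finite_PiE[OF assms(1) fin] by (rule finite_subset)
  \<comment> \<open>The representative depends on s only through \<open>R s\<close>; finiteness of
    the range and idempotence both come from this.\<close>
  define r where "r s = (SOME s'. R s' = R s)" for s
  have r: "R (r s) = R s" for s unfolding r_def by (rule someI[of _ s]) simp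
  have "range r = (\<lambda>y. SOME s'. R s' = y) ` range R" by (auto simp: r_def)
  then have "finite (range r)" using \<open>finite (range R)\<close> by simp
  moreover have "norm (f s - f (r s)) < e" if "f \<in> F" for f s
    using fun_cong[OF r[of s], of f] that by (intro near) (simp add: R_def)
  moreover have "r (r s) = r s" for s using r[of s] by (simp add: r_def)
  ultimately show thesis by (rule that)
qed

text \<open>Grothendieck's double limit condition, with \<open>ulim\<close> in place of ordinary
  limits. T confines the second argument, so that the condition can be stated for a set of
  functionals or for the range of one sequence.\<close>

definition iterated_limits_agree :: "'t set \<Rightarrow> ('s \<Rightarrow> 't \<Rightarrow> complex) \<Rightarrow> bool" where
  "iterated_limits_agree T f \<longleftrightarrow> (\<forall>s t. (\<forall>n. t n \<in> T) \<longrightarrow>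
     ulim (\<lambda>k. ulim (\<lambda>n. f (s k) (t n))) = ulim (\<lambda>n. ulim (\<lambda>k. f (s k) (t n))))"

text \<open>Grothendieck's argument: a functional respects a pointwise limit \<open>g\<close> of the functions
  \<open>f (\<cdot>, t)\<close>. Otherwise choose \<open>t n\<close> so that \<open>h = f - g\<close> is small at \<open>t n\<close> on finite nets for the
  earlier \<open>t i\<close> but \<open>\<Phi> h (\<cdot>, t n)\<close> stays away from \<open>0\<close>; points of those nets where many of the
  \<open>h (\<cdot>, t i)\<close> are large violate the interchange of limits.\<close>

lemma linf_dual_pointwise_limit:
  fixes f :: "'s \<Rightarrow> 't \<Rightarrow> complex"
  assumes \<Phi>: "\<Phi> \<in> linf_dual M" and f: "\<And>s t. t \<in> T \<Longrightarrow> norm (f s t) \<le> C"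
    and agree: "iterated_limits_agree T f"
    and approx: "\<And>D e. finite D \<Longrightarrow> e > 0 \<Longrightarrow>
      \<exists>t\<in>T. (\<forall>s\<in>D. norm (f s t - g s) < e) \<and> norm (\<Phi> (\<lambda>s. f s t) - c) < e"
  shows "\<Phi> g = c"
proof (rule ccontr)
  assume "\<Phi> g \<noteq> c"
  define \<epsilon> where "\<epsilon> = norm (\<Phi> g - c) / 2"
  have "\<epsilon> > 0" using \<open>\<Phi> g \<noteq> c\<close> by (simp add: \<epsilon>_def)
  have "M \<ge> 0" using linf_dual_nonneg[OF \<Phi>] .
  have g: "norm (g s) \<le> C + 1" for s
  proof -
    obtain t where t: "t \<in> T" "norm (f s t - g s) < 1" using approx[of "{s}" 1] by auto
    show ?thesis using norm_triangle_ineq2[of "g s" "f s t"] t f[OF t(1), of s]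
      by (simp add: norm_minus_commute)
  qed
  define h where "h = (\<lambda>s t. f s t - g s)"
  define C' where "C' = max 1 (2 * C + 1)"
  have h: "norm (h s t) \<le> C'" if "t \<in> T" for s t
    using norm_triangle_ineq4[of "f s t" "g s"] f[OF that, of s] g[of s] by (simp add: h_def C'_def)
  have \<Phi>h: "\<Phi> (\<lambda>s. h s t) = \<Phi> (\<lambda>s. f s t) - \<Phi> g" if "t \<in> T" for t
    unfolding h_def using f[OF that] g by (intro linf_dual_diff[OF \<Phi>]) (blast intro: linfI)+
  \<comment> \<open>The factor M + 1 gives \<open>M * \<delta> < \<epsilon>\<close>, which the
    extraction of a subsequence demands.\<close>
  define \<delta> where "\<delta> = \<epsilon> / (M + 1) / 2"
  have "\<delta> > 0" using \<open>\<epsilon> > 0\<close> \<open>M \<ge> 0\<close> by (simp add: \<delta>_def)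
  have "M * \<delta> < \<epsilon>" using \<open>\<epsilon> > 0\<close> \<open>M \<ge> 0\<close> unfolding \<delta>_def by (simp add: field_simps add_nonneg_pos)
  \<comment> \<open>Total boundedness: for the finitely many t \<in> J, every point s can be
    replaced by one of finitely many net points with error below \<delta> / 2.\<close>
  have "\<exists>D. finite D \<and> (\<forall>s. \<exists>s'\<in>D. \<forall>t\<in>J. norm (h s t - h s' t) < \<delta> / 2)"
    if "finite J" "J \<subseteq> T" for J
  proof -
    let ?F = "(\<lambda>t s. h s t) ` J"
    have "finite ?F" "?F \<subseteq> linf" using that h by (auto intro!: linfI[of _ C'])
    then obtain r where "finite (range r)" "\<And>f s. f \<in> ?F \<Longrightarrow> norm (f s - f (r s)) < \<delta> / 2"
      using ex_finite_oscillation[of ?F "\<delta> / 2"] \<open>\<delta> > 0\<close> by (metis half_gt_zero)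
    then show ?thesis by (intro exI[of _ "range r"]) force
  qed
  then obtain net where net: "\<And>J. finite J \<Longrightarrow> J \<subseteq> T \<Longrightarrow> finite (net J)"
    "\<And>J s. finite J \<Longrightarrow> J \<subseteq> T \<Longrightarrow> \<exists>s'\<in>net J. \<forall>t\<in>J. norm (h s t - h s' t) < \<delta> / 2"
    by metis
  \<comment> \<open>At stage n the new function is small on the nets of all initial segments of t,
    while \<Phi> still sees it.\<close>
  define P where "P = (\<lambda>(t::nat \<Rightarrow> 't) n r. r \<in> T \<and> \<epsilon> \<le> norm (\<Phi> (\<lambda>s. h s r)) \<and>
    (\<forall>j\<le>n. \<forall>s\<in>net (t ` {..<j}). norm (h s r) < 1 / Suc n))"
  have "\<exists>t. \<forall>n. P t n (t n)"
  proof (rule dependent_wellorder_choice)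
    fix r :: 't and t t' :: "nat \<Rightarrow> 't" and n
    assume "\<And>y. y < n \<Longrightarrow> t y = t' y"
    then have "t ` {..<j} = t' ` {..<j}" if "j \<le> n" for j using that by (intro image_cong) auto
    then show "P t n r = P t' n r" by (simp add: P_def)
  next
    fix n and t :: "nat \<Rightarrow> 't"
    assume IH: "\<And>y. y < n \<Longrightarrow> P t y (t y)"
    let ?D = "\<Union>j\<le>n. net (t ` {..<j})"
    have "finite ?D" using IH by (auto intro!: net(1) simp: P_def)
    then obtain r where r: "r \<in> T" "\<forall>s\<in>?D. norm (f s r - g s) < min \<epsilon> (1 / Suc n)"
      "norm (\<Phi> (\<lambda>s. f s r) - c) < min \<epsilon> (1 / Suc n)"
      using approx[of ?D "min \<epsilon> (1 / Suc n)"] \<open>\<epsilon> > 0\<close> by auto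
    have "2 * \<epsilon> \<le> norm (\<Phi> (\<lambda>s. f s r) - c) + norm (\<Phi> (\<lambda>s. h s r))"
      using norm_triangle_ineq4[of "\<Phi> (\<lambda>s. f s r) - c" "\<Phi> (\<lambda>s. h s r)"] \<Phi>h[OF r(1)]
      by (simp add: \<epsilon>_def)
    then have "P t n r" using r by (auto simp: P_def h_def)
    then show "\<exists>r. P t n r" by blast
  qed
  then obtain t where t: "\<And>n. P t n (t n)" by blast
  have tT: "t n \<in> T" for n using t by (auto simp: P_def)
  have "C' > 0" by (simp add: C'_def)
  moreover have "\<epsilon> \<le> norm (\<Phi> (\<lambda>s. h s (t n)))" for n using t by (auto simp: P_def)
  ultimately obtain m :: "nat \<Rightarrow> nat" where m: "strict_mono m" "\<And>k. \<exists>s. \<forall>i\<le>k. \<delta> \<le> norm (h s (t (m i)))"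
    using ex_subsequence_large[OF \<Phi>, of C' "\<lambda>n s. h s (t n)" \<epsilon> \<delta>] h[OF tT]
      \<open>\<delta> > 0\<close> \<open>M * \<delta> < \<epsilon>\<close> by (metis less_imp_le)
  \<comment> \<open>Moving the common point into the net of the first m k + 1 terms costs \<delta> /
    2, and the net is the place where the later functions are small.\<close>
  have "\<exists>s\<in>net (t ` {..<Suc (m k)}). \<forall>i\<le>k. \<delta> / 2 \<le> norm (h s (t (m i)))" for k
  proof -
    obtain s where s: "\<forall>i\<le>k. \<delta> \<le> norm (h s (t (m i)))" using m(2) by blast
    obtain s' where s': "s' \<in> net (t ` {..<Suc (m k)})"
      "\<forall>u\<in>t ` {..<Suc (m k)}. norm (h s u - h s' u) < \<delta> / 2"
      using net(2)[of "t ` {..<Suc (m k)}"] tT by blast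
    have "\<delta> / 2 \<le> norm (h s' (t (m i)))" if "i \<le> k" for i
    proof -
      have "m i \<le> m k" using that monoD[OF strict_mono_mono[OF m(1)]] by blast
      then have "norm (h s (t (m i)) - h s' (t (m i))) < \<delta> / 2"
        using s'(2) by (simp add: less_Suc_eq_le)
      moreover have "\<delta> \<le> norm (h s (t (m i)))" using s that by blast
      ultimately show ?thesis
        using norm_triangle_ineq2[of "h s (t (m i))" "h s' (t (m i))"] by linarith
    qed
    with s'(1) show ?thesis by blast
  qed
  then obtain s where s: "\<And>k. s k \<in> net (t ` {..<Suc (m k)})"
    "\<And>k i. i \<le> k \<Longrightarrow> \<delta> / 2 \<le> norm (h (s k) (t (m i)))" by metis
  have bounded: "(\<lambda>k. h (s k) (t n)) \<in> linf" "(\<lambda>i. h (s k) (t (m i))) \<in> linf" for k n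
    using h[OF tT] by (blast intro: linfI)+
  \<comment> \<open>For i > k the index m i comes after the net that contains \<open>s k\<close>,
    hence the bound 1 / Suc (m i), which tends to 0. In the other order, i \<le> k holds eventually
    and the values stay at least \<delta> / 2.\<close>
  have "ulim (\<lambda>i. h (s k) (t (m i))) = 0" for k
  proof -
    have "norm (ulim (\<lambda>i. h (s k) (t (m i)))) \<le> e" if e: "e > 0" for e
    proof -
      obtain N where N: "inverse (real (Suc N)) < e" using reals_Archimedean[OF e] by blast
      have "norm (h (s k) (t (m i))) \<le> e" if "i \<ge> max N (Suc k)" for i
      proof -
        have "m k < m i" using that strict_monoD[OF m(1)] by simp
        then have "norm (h (s k) (t (m i))) < 1 / Suc (m i)"
          using t[of "m i"] s(1)[of k] unfolding P_def by (metis Suc_leI)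
        also have "\<dots> \<le> inverse (Suc N)"
          using seq_suble[OF m(1), of i] that by (simp add: field_simps)
        finally show ?thesis using N by simp
      qed
      then show ?thesis using ulim_norm_le[OF bounded(2)] by blast
    qed
    then show ?thesis by (metis dense_ge norm_le_zero_iff)
  qed
  moreover have "\<delta> / 2 \<le> norm (ulim (\<lambda>i. ulim (\<lambda>k. h (s k) (t (m i)))))"
  proof (rule ulim_norm_ge[where N = 0])
    show "(\<lambda>i. ulim (\<lambda>k. h (s k) (t (m i)))) \<in> linf" using h[OF tT] by (rule linf_ulim)
    show "\<delta> / 2 \<le> norm (ulim (\<lambda>k. h (s k) (t (m i))))" for i
      using s(2) by (intro ulim_norm_ge[OF bounded(1)])
  qed
  \<comment> \<open>Passing from f to h subtracts the same number, the limit of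
    \<open>g (s k)\<close>, from both iterated limits, since g does not depend on i.\<close>
  moreover have "ulim (\<lambda>k. ulim (\<lambda>i. h (s k) (t (m i)))) = ulim (\<lambda>i. ulim (\<lambda>k. h (s k) (t (m i))))"
  proof -
    have fb: "(\<lambda>i. f (s k) (t (m i))) \<in> linf" "(\<lambda>k. f (s k) (t n)) \<in> linf"
      "(\<lambda>k. g (s k)) \<in> linf" for k n
      using f[OF tT] g by (blast intro: linfI)+
    have "(\<lambda>k. ulim (\<lambda>i. f (s k) (t (m i)))) \<in> linf" "(\<lambda>i. ulim (\<lambda>k. f (s k) (t (m i)))) \<in> linf"
      using f[OF tT] by (auto intro!: linf_ulim[of _ C])
    moreover have "ulim (\<lambda>k. ulim (\<lambda>i. f (s k) (t (m i)))) = ulim (\<lambda>i. ulim (\<lambda>k. f (s k) (t (m i))))"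
      using agree tT unfolding iterated_limits_agree_def by (elim allE[of _ s] allE[of _ "\<lambda>i. t (m i)"]) auto
    ultimately show ?thesis unfolding h_def by (simp add: ulim_diff fb)
  qed
  ultimately show False using \<open>\<delta> > 0\<close> by simp
qed

text \<open>The finitely supported members of the ball of radius M in l^1, seen as functionals on
  bounded functions. They commute with pointwise generalized limits by linearity alone.\<close>

definition finite_combinations :: "real \<Rightarrow> 's functional set" where
  "finite_combinations M = {a. \<exists>E c. finite E \<and> (\<Sum>t\<in>E. norm (c t)) \<le> M \<and>
     a = (\<lambda>h. if h \<in> linf then \<Sum>t\<in>E. c t * h t else 0)}"

lemma finite_combinations_linf_dual: "finite_combinations M \<subseteq> linf_dual M"
proof
  fix a :: "'s functional" assume "a \<in> finite_combinations M"
  then obtain E c where a: "finite E" "(\<Sum>t\<in>E. norm (c t)) \<le> M"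
    "a = (\<lambda>h. if h \<in> linf then \<Sum>t\<in>E. c t * h t else 0)" by (auto simp: finite_combinations_def)
  have "norm (a f) \<le> M * C" if f: "\<And>x. norm (f x) \<le> C" for f C
  proof -
    have "C \<ge> 0" using f[of undefined] norm_ge_zero order_trans by blast
    have "norm (a f) \<le> (\<Sum>t\<in>E. norm (c t) * C)"
      using f linfI[of f C] unfolding a(3)
      by (auto intro!: sum_norm_le simp: norm_mult mult_left_mono)
    also have "\<dots> \<le> M * C" using a(2) \<open>C \<ge> 0\<close> by (simp add: sum_distrib_right[symmetric] mult_right_mono)
    finally show ?thesis .
  qed
  then show "a \<in> linf_dual M"
    using linf_mult[of "\<lambda>x. _"] unfolding linf_dual_def linear_functional_def
    by (auto simp: a(3) linf_add sum.distrib sum_distrib_left algebra_simps)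
qed

text \<open>Goldstine's theorem for \<open>\<ell>\<^sup>1\<close>; no separation theorem is needed, since finitely many functions
  are almost constant on the pieces of a finite partition.\<close>

lemma finite_combinations_dense:
  assumes \<Psi>: "\<Psi> \<in> linf_dual M" and F: "finite F" "F \<subseteq> linf" and "e > 0"
  shows "\<exists>a\<in>finite_combinations M. \<forall>f\<in>F. norm (a f - \<Psi> f) < e"
proof -
  have "M \<ge> 0" using linf_dual_nonneg[OF \<Psi>] .
  define e' where "e' = e / (M + 1)"
  have "e' > 0" using \<open>e > 0\<close> \<open>M \<ge> 0\<close> by (simp add: e'_def)
  obtain r where r: "finite (range r)" "\<And>f s. f \<in> F \<Longrightarrow> norm (f s - f (r s)) < e'"
    "\<And>s. r (r s) = r s"
    using ex_finite_oscillation[OF F \<open>e' > 0\<close>] by blast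
  \<comment> \<open>Indicator functions of the cells of r; their values under \<Psi> become the
    coefficients.\<close>
  define p where "p = (\<lambda>u s. if r s = u then 1 else 0 :: complex)"
  have p: "p u \<in> linf" for u by (rule linfI[of _ 1]) (simp add: p_def)
  define c where "c = (\<lambda>u. \<Psi> (p u))"
  define a where "a = (\<lambda>h. if h \<in> linf then \<Sum>u\<in>range r. c u * h u else 0)"
  have expand: "(\<Sum>u\<in>range r. b u * p u s) = b (r s)" for b s
    using r(1) by (simp add: p_def if_distrib[of "(*) _"] cong: if_cong)
  have \<Psi>_sum: "\<Psi> (\<lambda>s. b (r s)) = (\<Sum>u\<in>range r. b u * c u)" for b
  proof -
    have "\<Psi> (\<lambda>s. b (r s)) = \<Psi> (\<lambda>s. \<Sum>u\<in>range r. b u * p u s)" by (simp add: expand)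
    also have "\<dots> = (\<Sum>u\<in>range r. \<Psi> (\<lambda>s. b u * p u s))"
      using p linf_mult[of "\<lambda>x. _"] by (intro linf_dual_sum[OF \<Psi>]) auto
    finally show ?thesis using p by (simp add: linf_dual_cmult[OF \<Psi>] c_def)
  qed
  \<comment> \<open>The phases of the coefficients, spread over the cells, form one function bounded
    by 1; its value under \<Psi> is the sum of the moduli.\<close>
  have "(\<Sum>u\<in>range r. norm (c u)) \<le> M"
  proof -
    let ?b = "\<lambda>u. cnj (sgn (c u))"
    have "of_real (\<Sum>u\<in>range r. norm (c u)) = \<Psi> (\<lambda>s. ?b (r s))"
      unfolding \<Psi>_sum[of ?b] by (simp add: cnj_sgn_mult)
    moreover have "norm (\<Psi> (\<lambda>s. ?b (r s))) \<le> M * 1"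
      using norm_cnj_sgn_le by (intro linf_dual_bound[OF \<Psi>])
    ultimately show ?thesis by (metis abs_le_D1 mult.right_neutral norm_of_real)
  qed
  then have "a \<in> finite_combinations M" using r(1) by (auto simp: finite_combinations_def a_def)
  moreover have "norm (a f - \<Psi> f) < e" if "f \<in> F" for f
  proof -
    have f: "f \<in> linf" using that F by blast
    have "a f = \<Psi> (\<lambda>s. f (r s))" using f by (simp add: a_def \<Psi>_sum mult.commute)
    then have "a f - \<Psi> f = \<Psi> (\<lambda>s. f (r s) - f s)"
      using f by (simp add: linf_dual_diff[OF \<Psi>] linf_comp)
    also have "norm \<dots> \<le> M * e'"
      using r(2)[OF that] by (intro linf_dual_bound[OF \<Psi>]) (simp add: norm_minus_commute less_imp_le)
    also have "\<dots> < e" using \<open>M \<ge> 0\<close> \<open>e > 0\<close> by (simp add: e'_def field_simps)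
    finally show ?thesis .
  qed
  ultimately show ?thesis by blast
qed

text \<open>Approximate \<Psi> by finite combinations, for which the interchange is linearity, and
  let \<open>linf_dual_pointwise_limit\<close> pass to the limit inside \<Phi>. This requires that
  the functions \<open>\<lambda>s. a (f s)\<close>, for such combinations a, again have agreeing
  iterated limits; that follows from a second use of the same lemma with the roles of the variables
  exchanged.\<close>

theorem interchange_functionals:
  fixes f :: "'s \<Rightarrow> 't \<Rightarrow> complex"
  assumes f: "\<And>s t. norm (f s t) \<le> C" and agree: "iterated_limits_agree UNIV f"
    and \<Phi>: "\<Phi> \<in> linf_dual M" and \<Psi>: "\<Psi> \<in> linf_dual M'"
  shows "\<Phi> (\<lambda>s. \<Psi> (f s)) = \<Psi> (\<lambda>t. \<Phi> (\<lambda>s. f s t))"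
proof -
  define T :: "'t functional set" where "T = finite_combinations M'"
  have T: "a \<in> linf_dual M'" if "a \<in> T" for a
    using that finite_combinations_linf_dual by (auto simp: T_def)
  have f1: "f s \<in> linf" "(\<lambda>s. f s t) \<in> linf" for s t using f by (blast intro: linfI)+
  have agree': "iterated_limits_agree UNIV (\<lambda>t s. f s t)"
    using agree by (auto simp: iterated_limits_agree_def)
  have "iterated_limits_agree T (\<lambda>s a. a (f s))"
    unfolding iterated_limits_agree_def
  proof (intro allI impI)
    fix s :: "nat \<Rightarrow> 's" and a :: "nat \<Rightarrow> 't functional" assume a: "\<forall>n. a n \<in> T"
    \<comment> \<open>The generalized limit of the combinations is a functional with the same norm
      bound, in general no longer finitely supported.\<close>
    define \<Theta> where "\<Theta> = (\<lambda>h. ulim (\<lambda>n. a n h))"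
    have al: "(\<lambda>n. a n h) \<in> linf" if h: "h \<in> linf" for h
    proof -
      obtain B where "\<And>x. norm (h x) \<le> B" using linf_bound[OF h] by blast
      then have "norm (a n h) \<le> M' * B" for n using linf_dual_bound[OF T] a by blast
      then show ?thesis by (rule linfI)
    qed
    have \<Theta>: "\<Theta> \<in> linf_dual M'"
      unfolding linf_dual_def linear_functional_def
    proof (safe)
      fix h :: "'t \<Rightarrow> complex" assume "h \<notin> linf"
      then have "a n h = 0" for n using linf_dual_outside[OF T] a by blast
      then show "\<Theta> h = 0" by (simp add: \<Theta>_def)
    next
      fix h k :: "'t \<Rightarrow> complex" assume hk: "h \<in> linf" "k \<in> linf"
      then have "a n (\<lambda>x. h x + k x) = a n h + a n k" for n
        using linf_dual_add[OF T] a by blast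
      with hk al show "\<Theta> (\<lambda>x. h x + k x) = \<Theta> h + \<Theta> k" by (simp add: \<Theta>_def ulim_add)
    next
      fix h :: "'t \<Rightarrow> complex" and c assume h: "h \<in> linf"
      then have "a n (\<lambda>x. c * h x) = c * a n h" for n
        using linf_dual_cmult[OF T] a by blast
      then show "\<Theta> (\<lambda>x. c * h x) = c * \<Theta> h" by (simp add: \<Theta>_def ulim_cmult)
    next
      fix h :: "'t \<Rightarrow> complex" and B assume h: "\<forall>x. norm (h x) \<le> B"
      then have "norm (a n h) \<le> M' * B" for n using linf_dual_bound[OF T] a by blast
      then show "norm (\<Theta> h) \<le> M' * B"
        unfolding \<Theta>_def by (intro ulim_norm_le[of _ 0]) (blast intro: linfI)+
    qed
    \<comment> \<open>Here the hypothesis on f enters: \<Theta> respects the pointwise limit of the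
      functions \<open>f (s k)\<close>. For a single \<open>a n\<close> the same exchange is a
      finite sum, and comparing the two gives equality of the nested limits.\<close>
    have "\<Theta> (\<lambda>t. ulim (\<lambda>k. f (s k) t)) = ulim (\<lambda>k. \<Theta> (f (s k)))"
    proof (rule linf_dual_pointwise_limit[OF \<Theta>, of "range s" "\<lambda>t s. f s t" C])
      show "iterated_limits_agree (range s) (\<lambda>t s. f s t)"
        using agree' by (auto simp: iterated_limits_agree_def)
      fix D :: "'t set" and e :: real assume "finite D" "e > 0"
      let ?I = "insert (\<lambda>k. \<Theta> (f (s k))) ((\<lambda>t k. f (s k) t) ` D)"
      have "finite ?I" "?I \<subseteq> linf"
        using \<open>finite D\<close> linf_slice[OF \<Theta>, of "\<lambda>k. f (s k)"] f f1 by (auto intro: linfI)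
      with \<open>e > 0\<close> obtain k where "\<forall>h\<in>?I. norm (h k - ulim h) < e" using ulim_approx by blast
      then show "\<exists>x\<in>range s. (\<forall>t\<in>D. norm (f x t - ulim (\<lambda>k. f (s k) t)) < e) \<and>
          norm (\<Theta> (f x) - ulim (\<lambda>k. \<Theta> (f (s k)))) < e"
        by (intro bexI[of _ "s k"]) auto
    qed (use f in auto)
    moreover have "a n (\<lambda>t. ulim (\<lambda>k. f (s k) t)) = ulim (\<lambda>k. a n (f (s k)))" for n
    proof -
      obtain E c where E: "finite E" "a n = (\<lambda>h. if h \<in> linf then \<Sum>t\<in>E. c t * h t else 0)"
        using a by (force simp: T_def finite_combinations_def)
      have "finite E \<Longrightarrow> ulim (\<lambda>k. \<Sum>t\<in>E. c t * f (s k) t) = (\<Sum>t\<in>E. c t * ulim (\<lambda>k. f (s k) t))"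
      proof (induction E rule: finite_induct)
        case (insert x E)
        have *: "(\<lambda>k. c t * f (s k) t) \<in> linf" for t
          using linf_mult[of "\<lambda>k. c t" "\<lambda>k. f (s k) t"] linf_comp[OF f1(2)[of t], of s] by simp
        then have "(\<lambda>k. \<Sum>t\<in>E. c t * f (s k) t) \<in> linf" by (intro linf_sum)
        with * insert show ?case by (simp add: ulim_add ulim_cmult)
      qed simp
      moreover have "(\<lambda>t. ulim (\<lambda>k. f (s k) t)) \<in> linf" by (rule linf_ulim) (rule f)
      ultimately show ?thesis using E f1 by simp
    qed
    ultimately show "ulim (\<lambda>k. ulim (\<lambda>n. a n (f (s k)))) = ulim (\<lambda>n. ulim (\<lambda>k. a n (f (s k))))"
      by (simp add: \<Theta>_def)
  qed
  moreover have "norm (a (f s)) \<le> M' * C" if "a \<in> T" for s a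
    using f by (intro linf_dual_bound[OF T[OF that]])
  ultimately show ?thesis
  proof (intro linf_dual_pointwise_limit[OF \<Phi>, of T "\<lambda>s a. a (f s)" "M' * C"])
    fix D :: "'s set" and e :: real assume "finite D" "e > 0"
    let ?F = "insert (\<lambda>t. \<Phi> (\<lambda>s. f s t)) (f ` D)"
    have "finite ?F" "?F \<subseteq> linf"
      using \<open>finite D\<close> linf_slice[OF \<Phi>, of "\<lambda>t s. f s t"] f f1 by auto
    then obtain a where a: "a \<in> T" "\<forall>h\<in>?F. norm (a h - \<Psi> h) < e"
      using finite_combinations_dense[OF \<Psi>] \<open>e > 0\<close> unfolding T_def by blast
    obtain E c where E: "finite E" "a = (\<lambda>h. if h \<in> linf then \<Sum>t\<in>E. c t * h t else 0)"
      using a(1) by (auto simp: T_def finite_combinations_def)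
    have *: "(\<lambda>s. c t * f s t) \<in> linf" for t
      using linf_mult[of "\<lambda>k. c t" "\<lambda>k. f k t"] f1 by simp
    have "\<Phi> (\<lambda>s. a (f s)) = (\<Sum>t\<in>E. c t * \<Phi> (\<lambda>s. f s t))"
      using E f1 * by (simp add: linf_dual_sum[OF \<Phi>] linf_dual_cmult[OF \<Phi>])
    also have "\<dots> = a (\<lambda>t. \<Phi> (\<lambda>s. f s t))"
      using E \<open>?F \<subseteq> linf\<close> by simp
    finally show "\<exists>a\<in>T. (\<forall>s\<in>D. norm (a (f s) - \<Psi> (f s)) < e) \<and>
        norm (\<Phi> (\<lambda>s. a (f s)) - \<Psi> (\<lambda>t. \<Phi> (\<lambda>s. f s t))) < e"
      using a by (intro bexI[of _ a]) auto
  qed auto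
qed

subsection \<open>Weakly almost periodic functions on the discrete group\<close>

lemma dual_norm_le:
  assumes "\<And>f. f \<in> V \<Longrightarrow> N f \<le> 1 \<Longrightarrow> norm (\<phi> f) \<le> B" and "f0 \<in> V" "N f0 \<le> 1"
  shows "dual_norm V N \<phi> \<le> B"
  unfolding dual_norm_def using assms by (intro cSUP_least) auto

lemma le_dual_norm:
  assumes \<phi>: "\<phi> \<in> dual V N" and N: "\<And>f. f \<in> V \<Longrightarrow> 0 \<le> N f" and f: "f \<in> V" "N f \<le> 1"
  shows "norm (\<phi> f) \<le> dual_norm V N \<phi>"
  unfolding dual_norm_def
proof (rule cSUP_upper)
  obtain B where B: "\<And>f. f \<in> V \<Longrightarrow> norm (\<phi> f) \<le> B * N f" using \<phi> by (auto simp: dual_def)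
  have "norm (\<phi> f) \<le> \<bar>B\<bar>" if "f \<in> V" "N f \<le> 1" for f
  proof -
    have "norm (\<phi> f) \<le> B * N f" using B that by blast
    also have "\<dots> \<le> \<bar>B\<bar> * 1" using N[OF that(1)] that(2) by (intro mult_mono) auto
    finally show ?thesis by simp
  qed
  then show "bdd_above ((\<lambda>f. norm (\<phi> f)) ` {f \<in> V. N f \<le> 1})" by (auto simp: bdd_above_def)
qed (use f in simp)

text \<open>Rescaling reduces to the unit ball. Where N vanishes, any bound of \<phi> forces the
  value 0.\<close>

lemma norm_le_dual_norm:
  assumes \<phi>: "\<phi> \<in> dual V N" and N: "\<And>f. f \<in> V \<Longrightarrow> 0 \<le> N f"
    and scale: "\<And>c f. f \<in> V \<Longrightarrow> (\<lambda>x. c * f x) \<in> V" "\<And>c f. f \<in> V \<Longrightarrow> N (\<lambda>x. c * f x) = norm c * N f"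
    and f: "f \<in> V"
  shows "norm (\<phi> f) \<le> dual_norm V N \<phi> * N f"
proof (cases "N f = 0")
  case True
  obtain B where "\<And>f. f \<in> V \<Longrightarrow> norm (\<phi> f) \<le> B * N f" using \<phi> by (auto simp: dual_def)
  from this[OF f] True show ?thesis by simp
next
  case False
  then have "N f > 0" using N[OF f] by simp
  let ?g = "\<lambda>x. of_real (inverse (N f)) * f x"
  have "norm (\<phi> ?g) \<le> dual_norm V N \<phi>"
    using \<open>N f > 0\<close> by (intro le_dual_norm[OF \<phi> N] scale(1) f) (simp_all add: scale(2)[OF f] norm_inverse)
  also have "\<phi> ?g = of_real (inverse (N f)) * \<phi> f"
    using \<phi> f unfolding dual_def linear_functional_def by blast
  finally have "norm (of_real (inverse (N f)) * \<phi> f) \<le> dual_norm V N \<phi>" .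
  moreover have "norm (of_real (inverse (N f)) * \<phi> f) = norm (\<phi> f) / N f"
    using \<open>N f > 0\<close> by (simp add: norm_mult norm_inverse divide_inverse mult.commute)
  ultimately have "norm (\<phi> f) / N f \<le> dual_norm V N \<phi>" by metis
  then show ?thesis using \<open>N f > 0\<close> by (simp add: field_simps)
qed

lemma dual_bound_nonneg:
  assumes "\<phi> \<in> dual V N" "\<And>f. f \<in> V \<Longrightarrow> 0 \<le> N f"
  obtains B where "B \<ge> 0" "\<And>f. f \<in> V \<Longrightarrow> norm (\<phi> f) \<le> B * N f"
proof -
  obtain B where B: "\<And>f. f \<in> V \<Longrightarrow> norm (\<phi> f) \<le> B * N f" using assms by (auto simp: dual_def)
  have "norm (\<phi> f) \<le> \<bar>B\<bar> * N f" if "f \<in> V" for f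
    by (rule order_trans[OF B[OF that]]) (simp add: mult_right_mono assms(2)[OF that])
  then show thesis by (intro that[of "\<bar>B\<bar>"]) auto
qed

lemma dualD:
  assumes "\<phi> \<in> dual V N"
  shows dual_outside: "f \<notin> V \<Longrightarrow> \<phi> f = 0"
    and dual_add: "f \<in> V \<Longrightarrow> g \<in> V \<Longrightarrow> \<phi> (\<lambda>x. f x + g x) = \<phi> f + \<phi> g"
    and dual_cmult: "f \<in> V \<Longrightarrow> \<phi> (\<lambda>x. c * f x) = c * \<phi> f"
  using assms unfolding dual_def linear_functional_def by blast+

lemma dual_add_mem:
  assumes "\<phi> \<in> dual V N" "\<psi> \<in> dual V N"
  shows "(\<lambda>f. \<phi> f + \<psi> f) \<in> dual V N"
proof -
  obtain B B' where "\<And>f. f \<in> V \<Longrightarrow> norm (\<phi> f) \<le> B * N f" "\<And>f. f \<in> V \<Longrightarrow> norm (\<psi> f) \<le> B' * N f"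
    using assms by (auto simp: dual_def)
  then have "\<And>f. f \<in> V \<Longrightarrow> norm (\<phi> f + \<psi> f) \<le> (B + B') * N f"
    unfolding distrib_right by (meson norm_triangle_mono)
  with assms show ?thesis
    unfolding dual_def linear_functional_def by (auto simp: algebra_simps intro!: exI[of _ "B + B'"])
qed

lemma dual_cmult_mem:
  assumes "\<phi> \<in> dual V N"
  shows "(\<lambda>f. c * \<phi> f) \<in> dual V N"
proof -
  obtain B where "\<And>f. f \<in> V \<Longrightarrow> norm (\<phi> f) \<le> B * N f" using assms by (auto simp: dual_def)
  then have "\<And>f. f \<in> V \<Longrightarrow> norm (c * \<phi> f) \<le> (norm c * B) * N f"
    by (simp add: norm_mult mult.assoc mult_left_mono)
  with assms show ?thesis
    unfolding dual_def linear_functional_def by (auto simp: algebra_simps intro!: exI[of _ "norm c * B"])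
qed

text \<open>The canonical map into the bidual, extended by 0; \<open>weak_topology\<close> is pulled
  back along it, so weak compactness becomes compactness in a product space.\<close>

definition weak_eval :: "('x \<Rightarrow> complex) set \<Rightarrow> (('x \<Rightarrow> complex) \<Rightarrow> real) \<Rightarrow> ('x \<Rightarrow> complex) \<Rightarrow> ('x functional \<Rightarrow> complex)"
  where "weak_eval V N x = (\<lambda>\<phi>. if \<phi> \<in> dual V N then \<phi> x else 0)"

lemma topspace_weak_topology [simp]: "topspace (weak_topology V N) = V"
  by (simp add: weak_topology_def topspace_pullback_topology)

lemma openin_weak_topology:
  "openin (weak_topology V N) S \<longleftrightarrow> (\<exists>U. open U \<and> S = weak_eval V N -` U \<inter> V)"
  by (simp add: weak_topology_def openin_pullback_topology weak_eval_def[abs_def])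

text \<open>Open sets of the pullback are preimages, so open covers of K and of its image
  correspond.\<close>

lemma compactin_weak_topology:
  "compactin (weak_topology V N) K \<longleftrightarrow> K \<subseteq> V \<and> compact (weak_eval V N ` K)"
proof safe
  assume K: "compactin (weak_topology V N) K"
  then show "x \<in> V" if "x \<in> K" for x
    using that compactin_subset_topspace[OF K] by auto
  have "continuous_map (weak_topology V N) euclidean (weak_eval V N)"
    unfolding continuous_map_def by (auto simp: openin_weak_topology intro!: exI)
  from image_compactin[OF K this] show "compact (weak_eval V N ` K)" by simp
next
  assume K: "K \<subseteq> V" "compact (weak_eval V N ` K)"
  show "compactin (weak_topology V N) K"
    unfolding compactin_def
  proof (intro conjI allI impI)
    fix \<U> assume *: "Ball \<U> (openin (weak_topology V N)) \<and> K \<subseteq> \<Union>\<U>"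
    then have "\<forall>S\<in>\<U>. \<exists>U. open U \<and> S = weak_eval V N -` U \<inter> V"
      by (simp add: openin_weak_topology Ball_def)
    then obtain u where u: "\<And>S. S \<in> \<U> \<Longrightarrow> open (u S)" "\<And>S. S \<in> \<U> \<Longrightarrow> S = weak_eval V N -` u S \<inter> V"
      by metis
    have "weak_eval V N ` K \<subseteq> (\<Union>S\<in>\<U>. u S)" using * u(2) by blast
    then obtain D where D: "D \<subseteq> \<U>" "finite D" "weak_eval V N ` K \<subseteq> (\<Union>S\<in>D. u S)"
      using compactE_image[OF K(2), of \<U> u] u(1) by metis
    have "K \<subseteq> \<Union>D"
    proof
      fix x assume "x \<in> K"
      then obtain S where "S \<in> D" "weak_eval V N x \<in> u S" using D(3) by blast
      moreover from this have "x \<in> S" using u(2)[of S] D(1) \<open>x \<in> K\<close> K(1) by blast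
      ultimately show "x \<in> \<Union>D" by blast
    qed
    with D show "\<exists>\<F>. finite \<F> \<and> \<F> \<subseteq> \<U> \<and> K \<subseteq> \<Union>\<F>" by blast
  qed (use K in simp)
qed

lemma compact_imp_closed_fun:
  fixes S :: "('a \<Rightarrow> complex) set"
  assumes "compact S"
  shows "closed S"
proof -
  have "Hausdorff_space (product_topology (\<lambda>i. euclidean :: complex topology) (UNIV :: 'a set))"
    by (simp add: Hausdorff_space_product_topology)
  from compactin_imp_closedin[OF this, of S] assms show ?thesis
    by (simp add: euclidean_product_topology)
qed

text \<open>It is enough to enclose the image in some weakly compact set. \<open>K'\<close> is K
  saturated under \<open>weak_eval\<close>: the preimage of a compact, hence closed, set, and thus
  closed whether or not functionals separate the points of W.\<close>

lemma weakly_compact_iff: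
  assumes T: "T ` {f \<in> V. N f \<le> 1} \<subseteq> W"
  shows "weakly_compact V N W N' T \<longleftrightarrow>
    (\<exists>K\<subseteq>W. compact (weak_eval W N' ` K) \<and> T ` {f \<in> V. N f \<le> 1} \<subseteq> K)" (is "?l \<longleftrightarrow> ?r")
proof
  assume ?l
  then have "compactin (weak_topology W N') (weak_topology W N' closure_of (T ` {f \<in> V. N f \<le> 1}))"
    by (simp add: weakly_compact_def)
  then show ?r
    unfolding compactin_weak_topology using closure_of_subset[of _ "weak_topology W N'"] T by auto
next
  assume ?r
  then obtain K where K: "K \<subseteq> W" "compact (weak_eval W N' ` K)" "T ` {f \<in> V. N f \<le> 1} \<subseteq> K"
    by blast
  define K' where "K' = {x \<in> W. weak_eval W N' x \<in> weak_eval W N' ` K}"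
  have "weak_eval W N' ` K' = weak_eval W N' ` K" using K(1) by (auto simp: K'_def)
  then have "compactin (weak_topology W N') K'"
    using K(2) by (auto simp: compactin_weak_topology K'_def)
  moreover have "closedin (weak_topology W N') K'"
  proof -
    have "W - K' = weak_eval W N' -` (- (weak_eval W N' ` K)) \<inter> W" by (auto simp: K'_def)
    then have "openin (weak_topology W N') (W - K')"
      unfolding openin_weak_topology using compact_imp_closed_fun[OF K(2)] by (metis open_Compl)
    then show ?thesis by (auto simp: closedin_def K'_def)
  qed
  moreover have "T ` {f \<in> V. N f \<le> 1} \<subseteq> K'" using K by (auto simp: K'_def)
  ultimately show ?l
    unfolding weakly_compact_def by (meson closed_compactin closedin_closure_of closure_of_minimal)
qed

text \<open>The coordinatewise generalized limit is approximated by some \<open>x k\<close> on any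
  finite set of coordinates, so it is in the closure. A cluster point produced by the fixed
  \<open>ulim\<close> can be compared with iterated limits.\<close>

lemma compact_ulim_mem:
  fixes x :: "nat \<Rightarrow> 'a \<Rightarrow> complex"
  assumes S: "compact S" "\<And>k. x k \<in> S"
  shows "(\<lambda>i. ulim (\<lambda>k. x k i)) \<in> S"
proof -
  have linf: "(\<lambda>k. x k i) \<in> linf" for i
  proof -
    have "compact ((\<lambda>y. y i) ` S)"
      by (rule compact_continuous_image[OF _ S(1)]) (rule continuous_on_product_then_coordinatewise, simp)
    then have "bounded ((\<lambda>y. y i) ` S)" by (rule compact_imp_bounded)
    then show ?thesis unfolding linf_def by (auto intro: bounded_subset simp: S(2))
  qed
  have "(\<lambda>i. ulim (\<lambda>k. x k i)) \<in> closure S"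
    unfolding closure_fun_iff
  proof (intro allI impI)
    fix I :: "'a set" and e :: real assume "finite I \<and> e > 0"
    moreover have "(\<lambda>i k. x k i) ` I \<subseteq> linf" using linf by auto
    ultimately obtain k where "\<forall>f\<in>(\<lambda>i k. x k i) ` I. norm (f k - ulim f) < e"
      using ulim_approx[of "(\<lambda>i k. x k i) ` I" e] by blast
    then show "\<exists>y\<in>S. \<forall>i\<in>I. norm (y i - ulim (\<lambda>k. x k i)) < e" using S(2) by auto
  qed
  then show ?thesis using compact_imp_closed_fun[OF S(1)] by (simp add: closure_closed)
qed

text \<open>Banach-Alaoglu: a closed subset of a product of discs. The coordinates outside
  \<open>linf\<close> get radius 0.\<close>

lemma compact_linf_dual: "compact (linf_dual M :: 'x functional set)"
proof -
  have "\<exists>C. \<forall>x. norm (f x) \<le> C" if "f \<in> linf" for f :: "'x \<Rightarrow> complex"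
    using that by (simp add: linf_iff)
  then obtain C where C: "\<And>f x. f \<in> linf \<Longrightarrow> norm (f x :: complex) \<le> C (f :: 'x \<Rightarrow> complex)" by metis
  define K :: "'x functional set" where
    "K = (\<Pi>\<^sub>E f\<in>UNIV. cball 0 (if f \<in> linf then M * C f else 0))"
  have "compactin (product_topology (\<lambda>i. euclidean) UNIV) K"
    unfolding K_def by (subst compactin_PiE) auto
  then have "compact K" by (simp add: euclidean_product_topology)
  moreover have "linf_dual M \<subseteq> K"
  proof
    fix \<Phi> :: "'x functional" assume \<Phi>: "\<Phi> \<in> linf_dual M"
    have "\<Phi> f \<in> cball 0 (if f \<in> linf then M * C f else 0)" for f
      using linf_dual_bound[OF \<Phi>, of f "C f"] C linf_dual_outside[OF \<Phi>, of f] by auto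
    then show "\<Phi> \<in> K" by (simp add: K_def PiE_def)
  qed
  moreover have "closed (linf_dual M :: 'x functional set)"
    unfolding linf_dual_def linear_functional_def Ball_def
    by (intro closed_Collect_conj closed_Collect_all closed_Collect_imp closed_Collect_eq
        closed_Collect_le continuous_intros open_Collect_const) auto
  ultimately show ?thesis by (metis compact_Int_closed inf.absorb_iff2)
qed

section \<open>The algebra l^1(G) and its pairing with bounded functions\<close>

lemma l1_iff: "a \<in> vecs l1 \<longleftrightarrow> (\<lambda>s. norm (a s)) summable_on UNIV"
  by (simp add: l1_def)

lemma nrm_l1: "nrm l1 a = (\<Sum>\<^sub>\<infinity>s. norm (a s))"
  by (simp add: l1_def)

lemma nrm_l1_nonneg: "0 \<le> nrm l1 a"
  by (simp add: nrm_l1 infsum_nonneg)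

lemma l1_cmult: "a \<in> vecs l1 \<Longrightarrow> (\<lambda>s. c * a s) \<in> vecs l1"
  by (simp add: l1_iff norm_mult summable_on_cmult_right)

lemma nrm_l1_cmult: "nrm l1 (\<lambda>s. c * a s) = norm c * nrm l1 a"
  by (simp add: nrm_l1 norm_mult infsum_cmult_right')

lemma l1_add: "a \<in> vecs l1 \<Longrightarrow> b \<in> vecs l1 \<Longrightarrow> (\<lambda>s. a s + b s) \<in> vecs l1"
  unfolding l1_iff
  by (rule summable_on_comparison_test[where f = "\<lambda>s. norm (a s) + norm (b s)"])
    (auto intro: norm_triangle_ineq summable_on_add)

lemma abs_summable_linf_l1:
  assumes "a \<in> vecs l1" "\<And>s. norm (F s) \<le> C"
  shows "(\<lambda>s. norm (F s * a s)) summable_on UNIV"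
proof -
  have "(\<lambda>s. C * norm (a s)) summable_on UNIV"
    using assms(1) by (simp add: l1_iff summable_on_cmult_right)
  then show ?thesis
    by (rule summable_on_comparison_test) (use assms(2) in \<open>auto simp: norm_mult intro!: mult_right_mono\<close>)
qed

lemma summable_linf_l1: "a \<in> vecs l1 \<Longrightarrow> F \<in> linf \<Longrightarrow> (\<lambda>s. F s * a s) summable_on UNIV"
  unfolding linf_iff by (blast intro: abs_summable_summable abs_summable_linf_l1)

lemma norm_infsum_linf_l1_le:
  assumes "a \<in> vecs l1" "\<And>s. norm (F s) \<le> C"
  shows "norm (\<Sum>\<^sub>\<infinity>s. F s * a s) \<le> C * nrm l1 a"
proof -
  have "norm (\<Sum>\<^sub>\<infinity>s. F s * a s) \<le> (\<Sum>\<^sub>\<infinity>s. norm (F s * a s))"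
    by (rule norm_infsum_bound) (rule abs_summable_linf_l1[OF assms])
  also have "\<dots> \<le> (\<Sum>\<^sub>\<infinity>s. C * norm (a s))"
    using assms by (intro infsum_mono abs_summable_linf_l1[OF assms])
      (auto simp: l1_iff norm_mult intro!: mult_right_mono summable_on_cmult_right)
  finally show ?thesis by (simp add: nrm_l1 infsum_cmult_right')
qed

lemma l1_functional_adual:
  assumes "F \<in> linf"
  shows "l1_functional F \<in> adual l1"
proof -
  obtain C where C: "\<And>s. norm (F s) \<le> C" using assms by (auto simp: linf_iff)
  have add: "(\<Sum>\<^sub>\<infinity>s. F s * (a s + b s)) = (\<Sum>\<^sub>\<infinity>s. F s * a s) + (\<Sum>\<^sub>\<infinity>s. F s * b s)"
    if "a \<in> vecs l1" "b \<in> vecs l1" for a b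
    using infsum_add[OF summable_linf_l1[OF that(1) assms] summable_linf_l1[OF that(2) assms]]
    by (simp add: distrib_left)
  have cmult: "(\<Sum>\<^sub>\<infinity>s. F s * (c * a s)) = c * (\<Sum>\<^sub>\<infinity>s. F s * a s)" for c a
    by (simp add: infsum_cmult_right'[symmetric] mult.left_commute)
  have "linear_functional (vecs l1) (l1_functional F)"
    unfolding linear_functional_def l1_functional_def by (simp add: l1_add l1_cmult add cmult)
  then show ?thesis
    using norm_infsum_linf_l1_le[where F = F and C = C] C unfolding adual_def dual_def
    by (auto simp: l1_functional_def intro!: exI[of _ C])
qed

lemma norm_le_adual_norm_l1:
  "\<mu> \<in> adual l1 \<Longrightarrow> a \<in> vecs l1 \<Longrightarrow> norm (\<mu> a) \<le> adual_norm l1 \<mu> * nrm l1 a"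
  unfolding adual_def adual_norm_def
  by (intro norm_le_dual_norm) (simp_all add: nrm_l1_nonneg l1_cmult nrm_l1_cmult)

lemma zero_l1 [simp]: "(\<lambda>s. 0) \<in> vecs l1" "nrm l1 (\<lambda>s. 0) = 0"
  by (simp_all add: l1_iff nrm_l1)

lemma adual_norm_l1_nonneg:
  assumes "\<mu> \<in> adual l1"
  shows "0 \<le> adual_norm l1 \<mu>"
proof -
  have "norm (\<mu> (\<lambda>s. 0)) \<le> adual_norm l1 \<mu>"
    using assms unfolding adual_def adual_norm_def
    by (intro le_dual_norm) (simp_all add: nrm_l1_nonneg)
  then show ?thesis by (rule order_trans[OF norm_ge_zero])
qed

lemma adual_norm_l1_functional_le:
  assumes "\<And>s. norm (F s) \<le> C"
  shows "adual_norm l1 (l1_functional F) \<le> C"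
  unfolding adual_norm_def
proof (rule dual_norm_le)
  have "0 \<le> C" using assms[of undefined] norm_ge_zero order_trans by blast
  fix a :: "'a \<Rightarrow> complex" assume a: "a \<in> vecs l1" "nrm l1 a \<le> 1"
  have "norm (l1_functional F a) \<le> C * nrm l1 a"
    using norm_infsum_linf_l1_le[OF a(1) assms] a(1) by (simp add: l1_functional_def)
  also have "\<dots> \<le> C * 1" using a(2) \<open>0 \<le> C\<close> by (rule mult_left_mono)
  finally show "norm (l1_functional F a) \<le> C" by simp
qed (rule zero_l1, simp)

lemma bij_translation: "bij (\<lambda>s. t + s :: 'g::group_add)"
  by (rule bij_betwI[of _ _ _ "\<lambda>s. - t + s"]) (auto simp: add.assoc[symmetric])

lemma convolution_abs_summable:
  assumes a: "a \<in> vecs l1" and b: "b \<in> vecs l1"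
  shows "(\<lambda>p. norm (case p of (t, s) \<Rightarrow> a t * b (- t + s))) summable_on (UNIV \<times> UNIV)"
proof -
  have bt: "(\<lambda>s. norm (b (- t + s))) summable_on UNIV" for t
    using b summable_on_reindex_bij_betw[OF bij_translation[of "- t"], of "\<lambda>s. norm (b s)"]
    by (simp add: l1_iff)
  have "(\<Sum>\<^sub>\<infinity>s. norm (a t) * norm (b (- t + s))) = nrm l1 b * norm (a t)" for t
    using infsum_reindex_bij_betw[OF bij_translation[of "- t"], of "\<lambda>s. norm (b s)"]
    by (simp add: infsum_cmult_right' nrm_l1 mult.commute)
  moreover have "(\<lambda>t. nrm l1 b * norm (a t)) summable_on UNIV"
    using a by (simp add: l1_iff summable_on_cmult_right)
  ultimately show ?thesis
    unfolding Infinite_Sum.abs_summable_on_Sigma_iff using bt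
    by (auto simp: norm_mult abs_mult nrm_l1_nonneg intro: summable_on_cmult_right)
qed

lemma mul_l1: "mul l1 a b = (\<lambda>s. \<Sum>\<^sub>\<infinity>t. a t * b (- t + s))"
  by (simp add: l1_def)

lemma mul_l1_mem:
  assumes a: "a \<in> vecs l1" and b: "b \<in> vecs l1"
  shows "mul l1 a b \<in> vecs l1"
proof -
  have "(\<lambda>p. norm (case p of (s, t) \<Rightarrow> a t * b (- t + s))) summable_on (UNIV \<times> UNIV)"
    using convolution_abs_summable[OF assms]
      summable_on_swap[of "\<lambda>(t, s). norm (a t * b (- t + s))" UNIV UNIV]
    by (simp add: case_prod_unfold)
  then have *: "(\<lambda>t. norm (a t * b (- t + s))) summable_on UNIV"
    "(\<lambda>s. \<Sum>\<^sub>\<infinity>t. norm (a t * b (- t + s))) summable_on UNIV" for s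
    unfolding Infinite_Sum.abs_summable_on_Sigma_iff by (auto simp: infsum_nonneg)
  show ?thesis
    unfolding l1_iff mul_l1
    by (rule summable_on_comparison_test[OF *(2)]) (auto intro: norm_infsum_bound *(1))
qed

text \<open>Fubini for the absolutely summable double series, then the substitution s \<mapsto> t +
  s in the inner sum. The outcome is an iterated pairing, the shape that \<open>mul MG\<close> also
  has.\<close>

lemma infsum_convolution:
  assumes a: "a \<in> vecs l1" and b: "b \<in> vecs l1" and F: "F \<in> linf"
  shows "(\<Sum>\<^sub>\<infinity>s. F s * mul l1 a b s) = (\<Sum>\<^sub>\<infinity>t. a t * (\<Sum>\<^sub>\<infinity>s. F (t + s) * b s))"
proof -
  obtain C where C: "\<And>s. norm (F s) \<le> C" using F by (auto simp: linf_iff)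
  have "(\<lambda>p. C * norm (case p of (t, s) \<Rightarrow> a t * b (- t + s))) summable_on UNIV \<times> UNIV"
    using convolution_abs_summable[OF a b] by (rule summable_on_cmult_right)
  then have "(\<lambda>p. norm (case p of (t, s) \<Rightarrow> F s * (a t * b (- t + s)))) summable_on (UNIV \<times> UNIV)"
    by (rule summable_on_comparison_test)
      (use C in \<open>auto simp: norm_mult mult_right_mono\<close>)
  then have sm: "(\<lambda>(t, s). F s * (a t * b (- t + s))) summable_on (UNIV \<times> UNIV)"
    by (rule abs_summable_summable)
  have "(\<Sum>\<^sub>\<infinity>s. F s * mul l1 a b s) = (\<Sum>\<^sub>\<infinity>s. \<Sum>\<^sub>\<infinity>t. F s * (a t * b (- t + s)))"
    by (simp add: mul_l1 infsum_cmult_right')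
  also have "\<dots> = (\<Sum>\<^sub>\<infinity>t. \<Sum>\<^sub>\<infinity>s. F s * (a t * b (- t + s)))"
    by (rule infsum_swap_banach[OF sm, symmetric])
  also have "\<dots> = (\<Sum>\<^sub>\<infinity>t. a t * (\<Sum>\<^sub>\<infinity>s. F (t + s) * b s))"
  proof (rule infsum_cong)
    fix t
    have "(\<Sum>\<^sub>\<infinity>s. F s * (a t * b (- t + s))) = (\<Sum>\<^sub>\<infinity>s. F (t + s) * (a t * b (- t + (t + s))))"
      by (rule infsum_reindex_bij_betw[OF bij_translation, symmetric])
    then show "(\<Sum>\<^sub>\<infinity>s. F s * (a t * b (- t + s))) = a t * (\<Sum>\<^sub>\<infinity>s. F (t + s) * b s)"
      by (simp add: add.assoc[symmetric] infsum_cmult_right'[symmetric] mult.left_commute)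
  qed
  finally show ?thesis .
qed

text \<open>Translates the module action into functions: the orbit of the unit ball consists of
  l^1-combinations of the right translates of F, the point masses giving the translates
  themselves.\<close>

lemma lact_l1_functional:
  assumes F: "F \<in> linf" and a: "a \<in> vecs l1"
  shows "lact l1 a (l1_functional F) = l1_functional (\<lambda>s. \<Sum>\<^sub>\<infinity>t. F (s + t) * a t)"
proof
  fix b :: "'a \<Rightarrow> complex"
  show "lact l1 a (l1_functional F) b = l1_functional (\<lambda>s. \<Sum>\<^sub>\<infinity>t. F (s + t) * a t) b"
    using infsum_convolution[OF _ a F, of b] mul_l1_mem[OF _ a, of b]
    by (simp add: lact_def l1_functional_def mult.commute)
qed

lemma linf_infsum_l1:
  assumes "F \<in> linf" "a \<in> vecs l1"
  shows "(\<lambda>s. \<Sum>\<^sub>\<infinity>t. F (s + t) * a t) \<in> linf"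
proof -
  obtain C where "\<And>s. norm (F s) \<le> C" using assms by (auto simp: linf_iff)
  then show ?thesis using assms by (intro linfI[of _ "C * nrm l1 a"] norm_infsum_linf_l1_le)
qed

lemma WAP_l1_iff:
  assumes F: "F \<in> linf"
  shows "l1_functional F \<in> WAP l1 \<longleftrightarrow>
    (\<exists>K\<subseteq>adual l1. compact (weak_eval (adual l1) (adual_norm l1) ` K) \<and>
      (\<lambda>a. lact l1 a (l1_functional F)) ` {a \<in> vecs l1. nrm l1 a \<le> 1} \<subseteq> K)"
proof -
  have "(\<lambda>a. lact l1 a (l1_functional F)) ` {a \<in> vecs l1. nrm l1 a \<le> 1} \<subseteq> adual l1"
    using F by (auto simp: lact_l1_functional linf_infsum_l1 intro!: l1_functional_adual)
  then show ?thesis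
    unfolding WAP_def using l1_functional_adual[OF F] by (simp add: weakly_compact_iff)
qed

definition point_mass :: "'g \<Rightarrow> 'g \<Rightarrow> complex" where
  "point_mass s = (\<lambda>t. if t = s then 1 else 0)"

lemma infsum_point_mass: "(\<Sum>\<^sub>\<infinity>t. F t * point_mass s t) = F s"
proof -
  have "(\<Sum>\<^sub>\<infinity>t. F t * point_mass s t) = (\<Sum>\<^sub>\<infinity>t\<in>{s}. F t * point_mass s t)"
    by (rule infsum_cong_neutral) (auto simp: point_mass_def)
  then show ?thesis by (simp add: point_mass_def)
qed

lemma point_mass_l1: "point_mass s \<in> vecs l1" "nrm l1 (point_mass s) = 1"
proof -
  have eq: "norm (point_mass s t) = (if t = s then 1 else 0)" for t by (simp add: point_mass_def)
  have "(\<lambda>t. norm (point_mass s t)) summable_on {s}" by simp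
  then show "point_mass s \<in> vecs l1"
    unfolding l1_iff by (rule summable_on_cong_neutral[THEN iffD1, rotated -1]) (auto simp: point_mass_def)
  have "(\<Sum>\<^sub>\<infinity>t. norm (point_mass s t)) = (\<Sum>\<^sub>\<infinity>t\<in>{s}. norm (point_mass s t))"
    by (rule infsum_cong_neutral) (auto simp: point_mass_def)
  then show "nrm l1 (point_mass s) = 1" by (simp add: nrm_l1 eq)
qed

lemma WAP_Gd_linf: "F \<in> WAP_Gd \<Longrightarrow> F \<in> linf"
  by (simp add: WAP_Gd_def linf_def)

text \<open>The map \<open>\<Phi> \<mapsto> (t \<mapsto> \<Phi> (s \<mapsto> F (t + s)))\<close> on the unit ball of \<open>\<ell>\<^sup>\<infinity>\<close>* is weak*-to-weak continuous
  because iterated functionals can be interchanged.\<close>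

lemma iterated_limits_agree_imp_WAP:
  assumes F: "F \<in> linf" and agree: "iterated_limits_agree UNIV (\<lambda>s t. F (s + t))"
  shows "l1_functional F \<in> WAP l1"
  unfolding WAP_l1_iff[OF F]
proof (intro exI conjI)
  obtain C where C: "\<And>s. norm (F s) \<le> C" using F by (auto simp: linf_iff)
  define h where "h = (\<lambda>\<Phi> s. \<Phi> (\<lambda>t. F (s + t)) :: complex)"
  have h: "norm (h \<Phi> s) \<le> C" if "\<Phi> \<in> linf_dual 1" for \<Phi> s
    using linf_dual_bound[OF that, of "\<lambda>t. F (s + t)" C] C by (simp add: h_def)
  then have h_linf: "h \<Phi> \<in> linf" if "\<Phi> \<in> linf_dual 1" for \<Phi> using that by (blast intro: linfI)
  \<comment> \<open>Replacing a in the unit ball of l^1 by an arbitrary \<Phi> of norm at most 1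
    gives a set that is the image of a weak* compact one.\<close>
  let ?K = "(\<lambda>\<Phi>. l1_functional (h \<Phi>)) ` linf_dual 1"
  let ?e = "weak_eval (adual l1) (adual_norm l1)"
  show "?K \<subseteq> adual l1" using h_linf by (auto intro!: l1_functional_adual)
  \<comment> \<open>The function at which \<Phi> must be evaluated to obtain the weak coordinate
    \<phi>; once this is known, the coordinate is continuous in \<Phi>.\<close>
  define k where "k = (\<lambda>\<phi> :: ('a \<Rightarrow> complex) functional. \<lambda>t. \<phi> (l1_functional (\<lambda>s. F (s + t))))"
  have "?e (l1_functional (h \<Phi>)) \<phi> = (if \<phi> \<in> dual (adual l1) (adual_norm l1) then \<Phi> (k \<phi>) else 0)"
    if \<Phi>: "\<Phi> \<in> linf_dual 1" for \<Phi> \<phi>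
  proof (cases "\<phi> \<in> dual (adual l1) (adual_norm l1)")
    case True
    then obtain B where B: "B \<ge> 0" "\<And>\<mu>. \<mu> \<in> adual l1 \<Longrightarrow> norm (\<phi> \<mu>) \<le> B * adual_norm l1 \<mu>"
      using dual_bound_nonneg[OF True] adual_norm_l1_nonneg by metis
    \<comment> \<open>The functional \<phi> read on bounded functions through
      \<open>l1_functional\<close>, so that the interchange of functionals on \<open>linf\<close>
      applies to it.\<close>
    define \<psi> where "\<psi> = (\<lambda>f. if f \<in> linf then \<phi> (l1_functional f) else 0)"
    have "norm (\<psi> f) \<le> B * D" if "\<And>x. norm (f x) \<le> D" for f D
    proof -
      have f: "f \<in> linf" using that by (rule linfI)
      then have "norm (\<psi> f) \<le> B * adual_norm l1 (l1_functional f)"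
        by (simp add: \<psi>_def B l1_functional_adual)
      also have "\<dots> \<le> B * D" by (intro mult_left_mono adual_norm_l1_functional_le that B(1))
      finally show ?thesis .
    qed
    moreover have "\<psi> (\<lambda>x. f x + g x) = \<psi> f + \<psi> g" if "f \<in> linf" "g \<in> linf" for f g
    proof -
      have "l1_functional (\<lambda>x. f x + g x) = (\<lambda>a. l1_functional f a + l1_functional g a)"
        using that
        by (auto simp: l1_functional_def fun_eq_iff distrib_right infsum_add summable_linf_l1)
      then show ?thesis
        using that by (simp add: \<psi>_def linf_add dual_add[OF True] l1_functional_adual)
    qed
    moreover have "\<psi> (\<lambda>x. c * f x) = c * \<psi> f" if "f \<in> linf" for f c
    proof -
      have "l1_functional (\<lambda>x. c * f x) = (\<lambda>a. c * l1_functional f a)"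
        by (auto simp: l1_functional_def fun_eq_iff infsum_cmult_right' mult.assoc)
      then show ?thesis
        using that linf_mult[of "\<lambda>x. c" f]
        by (simp add: \<psi>_def dual_cmult[OF True] l1_functional_adual)
    qed
    ultimately have \<psi>: "\<psi> \<in> linf_dual B"
      by (auto simp: linf_dual_def linear_functional_def \<psi>_def)
    have Ft: "(\<lambda>s. F (s + t)) \<in> linf" for t using F by (rule linf_comp)
    have "?e (l1_functional (h \<Phi>)) \<phi> = \<psi> (\<lambda>s. \<Phi> (\<lambda>t. F (s + t)))"
      using True h_linf[OF \<Phi>] by (simp add: weak_eval_def \<psi>_def h_def)
    also have "\<dots> = \<Phi> (\<lambda>t. \<psi> (\<lambda>s. F (s + t)))"
      by (rule interchange_functionals[OF _ agree \<psi> \<Phi>]) (rule C)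
    also have "(\<lambda>t. \<psi> (\<lambda>s. F (s + t))) = k \<phi>" using Ft by (simp add: \<psi>_def k_def)
    finally show ?thesis using True by simp
  qed (simp add: weak_eval_def)
  then have "?e ` ?K = (\<lambda>\<Phi> \<phi>. if \<phi> \<in> dual (adual l1) (adual_norm l1) then \<Phi> (k \<phi>) else 0) ` linf_dual 1"
    unfolding image_image by (intro image_cong) (auto simp: fun_eq_iff)
  moreover have "compact \<dots>"
  proof (rule compact_continuous_image[OF _ compact_linf_dual])
    show "continuous_on (linf_dual 1)
        (\<lambda>\<Phi> \<phi>. if \<phi> \<in> dual (adual l1) (adual_norm l1) then \<Phi> (k \<phi>) else 0)"
    proof (rule continuous_on_coordinatewise_then_product)
      fix \<phi> :: "('a \<Rightarrow> complex) functional"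
      show "continuous_on (linf_dual 1)
        (\<lambda>\<Phi>. if \<phi> \<in> dual (adual l1) (adual_norm l1) then \<Phi> (k \<phi>) else 0)"
        by (cases "\<phi> \<in> dual (adual l1) (adual_norm l1)")
          (auto intro: continuous_on_subset[OF continuous_on_product_coordinates])
    qed
  qed
  ultimately show "compact (?e ` ?K)" by simp
  show "(\<lambda>a. lact l1 a (l1_functional F)) ` {a \<in> vecs l1. nrm l1 a \<le> 1} \<subseteq> ?K"
  proof clarify
    fix a :: "'a \<Rightarrow> complex" assume a: "a \<in> vecs l1" "nrm l1 a \<le> 1"
    define \<Phi> where "\<Phi> = (\<lambda>f. if f \<in> linf then \<Sum>\<^sub>\<infinity>t. f t * a t else 0)"
    have "norm (\<Phi> f) \<le> 1 * D" if "\<And>x. norm (f x) \<le> D" for f D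
    proof -
      have "0 \<le> D" using that[of undefined] norm_ge_zero order_trans by blast
      have "norm (\<Phi> f) \<le> D * nrm l1 a"
        using norm_infsum_linf_l1_le[where F = f and C = D, OF a(1) that] linfI[where f = f, OF that]
        by (simp add: \<Phi>_def)
      also have "\<dots> \<le> D * 1" using a(2) \<open>0 \<le> D\<close> by (rule mult_left_mono)
      finally show ?thesis by simp
    qed
    then have "\<Phi> \<in> linf_dual 1"
      using linf_mult[of "\<lambda>x. _"] unfolding linf_dual_def linear_functional_def
      by (auto simp: \<Phi>_def linf_add distrib_right infsum_add summable_linf_l1[OF a(1)]
          mult.assoc infsum_cmult_right')
    moreover have "lact l1 a (l1_functional F) = l1_functional (h \<Phi>)"
      using linf_comp[OF F, of "(+) _"] by (simp add: lact_l1_functional[OF F a(1)] h_def \<Phi>_def)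
    ultimately show "lact l1 a (l1_functional F) \<in> ?K" by blast
  qed
qed

text \<open>A weak cluster point g of the right translates by t n is tested against
  \<open>\<psi> r\<close>, the generalized limit of the evaluations at the point masses of r k. For
  r = s this expresses one iterated limit through g, and for constant r it identifies the values of
  g, which yields the other.\<close>

lemma WAP_imp_iterated_limits_agree:
  assumes F: "F \<in> linf" and WAP: "l1_functional F \<in> WAP l1"
  shows "iterated_limits_agree UNIV (\<lambda>s t. F (s + t))"
  unfolding iterated_limits_agree_def
proof (intro allI impI)
  fix s t :: "nat \<Rightarrow> 'a"
  let ?e = "weak_eval (adual l1) (adual_norm l1)"
  obtain K where K: "K \<subseteq> adual l1" "compact (?e ` K)"
    "(\<lambda>a. lact l1 a (l1_functional F)) ` {a \<in> vecs l1. nrm l1 a \<le> 1} \<subseteq> K"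
    using WAP unfolding WAP_l1_iff[OF F] by blast
  define x where "x = (\<lambda>n. l1_functional (\<lambda>s. F (s + t n)))"
  have x: "x n \<in> K" for n
  proof -
    have "x n = lact l1 (point_mass (t n)) (l1_functional F)"
      by (simp add: x_def lact_l1_functional[OF F] point_mass_l1
          infsum_point_mass[of "\<lambda>u. F (_ + u)"])
    then have "x n \<in> (\<lambda>a. lact l1 a (l1_functional F)) ` {a \<in> vecs l1. nrm l1 a \<le> 1}"
      using point_mass_l1[of "t n"] by (intro image_eqI[of _ _ "point_mass (t n)"]) auto
    then show ?thesis using K(3) by blast
  qed
  have x_eval: "x n (point_mass u) = F (u + t n)" for n u
    by (simp add: x_def l1_functional_def point_mass_l1 infsum_point_mass)
  define \<psi> where "\<psi> = (\<lambda>(r :: nat \<Rightarrow> 'a) \<nu>. if \<nu> \<in> adual l1 then ulim (\<lambda>k. \<nu> (point_mass (r k))) else 0 :: complex)"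
  have bound: "norm (\<nu> (point_mass u)) \<le> adual_norm l1 \<nu>" if "\<nu> \<in> adual l1" for \<nu> and u :: 'a
    using norm_le_adual_norm_l1[OF that point_mass_l1(1), of u] by (simp add: point_mass_l1)
  then have bounded: "(\<lambda>k. \<nu> (point_mass (r k))) \<in> linf" if "\<nu> \<in> adual l1" for \<nu> and r :: "nat \<Rightarrow> 'a"
    using that by (blast intro: linfI)
  have \<psi>: "\<psi> r \<in> dual (adual l1) (adual_norm l1)" for r
    unfolding dual_def
  proof (intro CollectI conjI exI[of _ 1] ballI)
    have "\<psi> r (\<lambda>a. \<nu> a + \<nu>' a) = \<psi> r \<nu> + \<psi> r \<nu>'" if "\<nu> \<in> adual l1" "\<nu>' \<in> adual l1" for \<nu> \<nu>'
      using that ulim_add[OF bounded[OF that(1), of r] bounded[OF that(2), of r]]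
      by (simp add: \<psi>_def adual_def dual_add_mem)
    then show "linear_functional (adual l1) (\<psi> r)"
      unfolding linear_functional_def
      by (auto simp: \<psi>_def adual_def dual_cmult_mem ulim_cmult)
    show "norm (\<psi> r \<nu>) \<le> 1 * adual_norm l1 \<nu>" if "\<nu> \<in> adual l1" for \<nu>
      using ulim_norm_le[OF bounded[OF that, of r], of 0] bound[OF that] that by (simp add: \<psi>_def)
  qed
  have "(\<lambda>\<phi>. ulim (\<lambda>n. ?e (x n) \<phi>)) \<in> ?e ` K"
    using x by (intro compact_ulim_mem[OF K(2)]) blast
  then obtain g where g: "g \<in> K" "\<And>\<phi>. ?e g \<phi> = ulim (\<lambda>n. ?e (x n) \<phi>)" by (force simp: fun_eq_iff)
  have g_limit: "ulim (\<lambda>k. g (point_mass (r k))) = ulim (\<lambda>n. ulim (\<lambda>k. F (r k + t n)))" for r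
  proof -
    have "ulim (\<lambda>k. g (point_mass (r k))) = ?e g (\<psi> r)"
      using g(1) K(1) \<psi> by (auto simp: weak_eval_def \<psi>_def)
    also have "\<dots> = ulim (\<lambda>n. ?e (x n) (\<psi> r))" by (rule g(2))
    also have "\<dots> = ulim (\<lambda>n. \<psi> r (x n))" using \<psi> by (simp add: weak_eval_def)
    also have "\<dots> = ulim (\<lambda>n. ulim (\<lambda>k. F (r k + t n)))"
      using x K(1) by (simp add: \<psi>_def x_eval subset_iff)
    finally show ?thesis .
  qed
  \<comment> \<open>For a constant sequence the limit over k disappears and g is read off at a
    single point.\<close>
  from g_limit[of "\<lambda>k. _"] have "g (point_mass u) = ulim (\<lambda>n. F (u + t n))" for u by simp
  with g_limit[of s]
  show "ulim (\<lambda>k. ulim (\<lambda>n. F (s k + t n))) = ulim (\<lambda>n. ulim (\<lambda>k. F (s k + t n)))" by simp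
qed

section \<open>Closure properties of weakly almost periodic functions, and density of G\<close>

theorem WAP_Gd_iff: "F \<in> WAP_Gd \<longleftrightarrow> F \<in> linf \<and> iterated_limits_agree UNIV (\<lambda>s t. F (s + t))"
  using WAP_imp_iterated_limits_agree iterated_limits_agree_imp_WAP
  unfolding WAP_Gd_def linf_def by blast

text \<open>Collects the boundedness conditions that the rules for \<open>ulim\<close> ask for at
  both levels of nesting.\<close>

lemma WAP_Gd_limits:
  assumes "F \<in> WAP_Gd"
  shows "ulim (\<lambda>k. ulim (\<lambda>n. F (s k + t n))) = ulim (\<lambda>n. ulim (\<lambda>k. F (s k + t n)))"
    and "(\<lambda>n. F (u + t n)) \<in> linf" "(\<lambda>k. F (s k + u)) \<in> linf"
    and "(\<lambda>k. ulim (\<lambda>n. F (s k + t n))) \<in> linf" "(\<lambda>n. ulim (\<lambda>k. F (s k + t n))) \<in> linf"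
proof -
  have F: "F \<in> linf" "iterated_limits_agree UNIV (\<lambda>s t. F (s + t))" using assms by (auto simp: WAP_Gd_iff)
  then show "ulim (\<lambda>k. ulim (\<lambda>n. F (s k + t n))) = ulim (\<lambda>n. ulim (\<lambda>k. F (s k + t n)))"
    by (simp add: iterated_limits_agree_def)
  show "(\<lambda>n. F (u + t n)) \<in> linf" "(\<lambda>k. F (s k + u)) \<in> linf" using F(1) by (auto intro: linf_comp)
  obtain C where "\<And>x. norm (F x) \<le> C" using F(1) by (auto simp: linf_iff)
  then show "(\<lambda>k. ulim (\<lambda>n. F (s k + t n))) \<in> linf" "(\<lambda>n. ulim (\<lambda>k. F (s k + t n))) \<in> linf"
    by (auto intro!: linf_ulim)
qed

lemma WAP_Gd_const [simp]: "(\<lambda>x. c) \<in> WAP_Gd"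
  by (simp add: WAP_Gd_iff iterated_limits_agree_def)

lemma WAP_Gd_add: "F \<in> WAP_Gd \<Longrightarrow> H \<in> WAP_Gd \<Longrightarrow> (\<lambda>x. F x + H x) \<in> WAP_Gd"
  by (simp add: WAP_Gd_iff[of "\<lambda>x. F x + H x"] linf_add WAP_Gd_linf iterated_limits_agree_def
      ulim_add WAP_Gd_limits)

lemma WAP_Gd_mult: "F \<in> WAP_Gd \<Longrightarrow> H \<in> WAP_Gd \<Longrightarrow> (\<lambda>x. F x * H x) \<in> WAP_Gd"
  by (simp add: WAP_Gd_iff[of "\<lambda>x. F x * H x"] linf_mult WAP_Gd_linf iterated_limits_agree_def
      ulim_mult WAP_Gd_limits)

lemma WAP_Gd_cnj: "F \<in> WAP_Gd \<Longrightarrow> (\<lambda>x. cnj (F x)) \<in> WAP_Gd"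
  by (simp add: WAP_Gd_iff[of "\<lambda>x. cnj (F x)"] linf_cnj WAP_Gd_linf iterated_limits_agree_def
      ulim_cnj WAP_Gd_limits)

lemma WAP_Gd_diff: "F \<in> WAP_Gd \<Longrightarrow> H \<in> WAP_Gd \<Longrightarrow> (\<lambda>x. F x - H x) \<in> WAP_Gd"
  using WAP_Gd_add[of F "\<lambda>x. (-1) * H x"] WAP_Gd_mult[of "\<lambda>x. -1" H] by simp

lemma WAP_Gd_sum: "(\<And>i. i \<in> I \<Longrightarrow> F i \<in> WAP_Gd) \<Longrightarrow> (\<lambda>x. \<Sum>i\<in>I. F i x) \<in> WAP_Gd"
  by (induction I rule: infinite_finite_induct) (auto intro: WAP_Gd_add)

text \<open>In either order the iterated limit of 1 / F times that of F is the limit of the constant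
  1, by multiplicativity. The limits of F agree, so their inverses do.\<close>

lemma WAP_Gd_inverse:
  assumes F: "F \<in> WAP_Gd" and "c > 0" and c: "\<And>x. c \<le> norm (F x)"
  shows "(\<lambda>x. inverse (F x)) \<in> WAP_Gd"
proof -
  have bound: "norm (inverse (F x)) \<le> inverse c" for x
    using c[of x] \<open>c > 0\<close> by (simp add: norm_inverse le_imp_inverse_le)
  have nz: "F x \<noteq> 0" for x using c[of x] \<open>c > 0\<close> by auto
  have "ulim (\<lambda>k. ulim (\<lambda>n. inverse (F (s k + t n)))) = ulim (\<lambda>n. ulim (\<lambda>k. inverse (F (s k + t n))))"
    for s t
  proof -
    note lim = WAP_Gd_limits[OF F]
    have b: "(\<lambda>n. inverse (F (u + t n))) \<in> linf" "(\<lambda>k. inverse (F (s k + u))) \<in> linf"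
      "(\<lambda>k. ulim (\<lambda>n. inverse (F (s k + t n)))) \<in> linf"
      "(\<lambda>n. ulim (\<lambda>k. inverse (F (s k + t n)))) \<in> linf" for u
      using bound by (auto intro: linfI linf_ulim[where C = "inverse c"])
    have 1: "ulim (\<lambda>n. F (u + t n)) * ulim (\<lambda>n. inverse (F (u + t n))) = 1"
      "ulim (\<lambda>k. F (s k + u)) * ulim (\<lambda>k. inverse (F (s k + u))) = 1" for u
      by (subst ulim_mult[symmetric]; simp add: lim b nz)+
    have "ulim (\<lambda>k. ulim (\<lambda>n. F (s k + t n))) * ulim (\<lambda>k. ulim (\<lambda>n. inverse (F (s k + t n)))) = 1"
      by (subst ulim_mult[symmetric]) (simp_all add: lim b 1)
    moreover have "ulim (\<lambda>n. ulim (\<lambda>k. F (s k + t n))) * ulim (\<lambda>n. ulim (\<lambda>k. inverse (F (s k + t n)))) = 1"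
      by (subst ulim_mult[symmetric]) (simp_all add: lim b 1)
    ultimately show ?thesis using lim(1) by (metis inverse_unique)
  qed
  then show ?thesis
    using bound by (auto simp: WAP_Gd_iff iterated_limits_agree_def intro: linfI)
qed

theorem Gd_wap_embed_dense:
  fixes \<phi> :: "('g::group_add) functional"
  assumes "\<phi> \<in> Gd_wap"
  shows "\<phi> \<in> closure (range Gd_wap_embed)"
  unfolding closure_fun_iff
proof (intro allI impI, rule ccontr)
  fix I :: "('g \<Rightarrow> complex) set" and e :: real
  assume Ie: "finite I \<and> e > 0" and no: "\<not> (\<exists>y\<in>range Gd_wap_embed. \<forall>i\<in>I. norm (y i - \<phi> i) < e)"
  have outside: "\<phi> F = 0" if "F \<notin> WAP_Gd" for F
    using assms that by (auto simp: Gd_wap_def characters_def linear_functional_def)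
  have add: "\<phi> (\<lambda>x. F x + H x) = \<phi> F + \<phi> H" and mult: "\<phi> (\<lambda>x. F x * H x) = \<phi> F * \<phi> H"
    if "F \<in> WAP_Gd" "H \<in> WAP_Gd" for F H
    using assms that by (auto simp: Gd_wap_def characters_def linear_functional_def)
  obtain F0 where F0: "F0 \<in> WAP_Gd" "\<phi> F0 \<noteq> 0" using assms by (auto simp: Gd_wap_def characters_def)
  have one: "\<phi> (\<lambda>x. 1) = 1" using mult[of "\<lambda>x. 1" F0] F0 by simp
  have const: "\<phi> (\<lambda>x. c) = c" for c
  proof -
    have "\<phi> (\<lambda>x. c * F x) = c * \<phi> F" if "F \<in> WAP_Gd" for F
      using assms that by (auto simp: Gd_wap_def characters_def linear_functional_def)
    from this[of "\<lambda>x. 1"] show ?thesis by (simp add: one)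
  qed
  \<comment> \<open>A coordinate outside \<open>WAP_Gd\<close> is 0 for \<phi> and for every
    evaluation, so only these indices can keep them apart.\<close>
  define J where "J = I \<inter> WAP_Gd"
  have "finite J" using Ie by (simp add: J_def)
  define d where "d = (\<lambda>F x. F x - \<phi> F)"
  have d: "d F \<in> WAP_Gd" "(\<lambda>x. cnj (d F x)) \<in> WAP_Gd" if "F \<in> J" for F
    using that by (auto simp: d_def J_def intro!: WAP_Gd_diff WAP_Gd_cnj)
  have \<phi>d: "\<phi> (d F) = 0" if "F \<in> J" for F
    using add[of F "\<lambda>x. - \<phi> F"] that const[of "- \<phi> F"] by (simp add: d_def J_def)
  \<comment> \<open>Each summand is a squared modulus and has the factor \<open>d F\<close>, which
    \<phi> kills, so \<phi> H = 0 by multiplicativity. Yet H is at least e^2 everywhere, since no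
    evaluation is e-close to \<phi> on I.\<close>
  define H where "H = (\<lambda>x. \<Sum>F\<in>J. d F x * cnj (d F x))"
  have H: "H \<in> WAP_Gd" unfolding H_def using d by (intro WAP_Gd_sum WAP_Gd_mult)
  have large: "e\<^sup>2 \<le> norm (H x)" for x
  proof -
    obtain F where F: "F \<in> I" "e \<le> norm (Gd_wap_embed x F - \<phi> F)" using no by (force simp: not_less)
    then have "F \<in> J" using outside[of F] Ie by (auto simp: J_def Gd_wap_embed_def split: if_splits)
    then have "e \<le> norm (d F x)" using F by (simp add: d_def J_def Gd_wap_embed_def)
    then have "e\<^sup>2 \<le> (norm (d F x))\<^sup>2" using Ie by (intro power_mono) auto
    also have "\<dots> \<le> (\<Sum>F\<in>J. (norm (d F x))\<^sup>2)"
      using \<open>finite J\<close> \<open>F \<in> J\<close> by (intro member_le_sum) auto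
    also have "H x = of_real (\<Sum>F\<in>J. (norm (d F x))\<^sup>2)"
      unfolding of_real_sum complex_norm_square H_def ..
    then have "(\<Sum>F\<in>J. (norm (d F x))\<^sup>2) = norm (H x)"
      by (simp add: sum_nonneg del: of_real_sum of_real_power)
    finally show ?thesis .
  qed
  have inv: "(\<lambda>x. inverse (H x)) \<in> WAP_Gd"
    using Ie large by (intro WAP_Gd_inverse[OF H, of "e\<^sup>2"]) auto
  have "\<phi> H = 0"
  proof -
    have "\<phi> (\<lambda>x. \<Sum>F\<in>J'. d F x * cnj (d F x)) = 0" if "J' \<subseteq> J" for J'
      using finite_subset[OF that \<open>finite J\<close>] that
    proof (induction J' rule: finite_induct)
      case (insert F J')
      have "(\<lambda>x. d F x * cnj (d F x)) \<in> WAP_Gd" "(\<lambda>x. \<Sum>F\<in>J'. d F x * cnj (d F x)) \<in> WAP_Gd"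
        using d insert.prems by (auto intro!: WAP_Gd_sum WAP_Gd_mult)
      then show ?case using insert d \<phi>d by (simp add: add mult)
    qed (simp add: const)
    then show ?thesis by (simp add: H_def)
  qed
  moreover have "H x * inverse (H x) = 1" for x using large[of x] Ie by (cases "H x = 0") auto
  ultimately show False using mult[OF H inv] one by simp
qed

subsection \<open>Atoms of measures\<close>

lemma C0_iff: "f \<in> vecs C0 \<longleftrightarrow>
    continuous_on UNIV f \<and> (\<forall>e>0. \<exists>K. compact K \<and> (\<forall>x. x \<notin> K \<longrightarrow> norm (f x) < e))"
  by (simp add: C0_def)

lemma nrm_C0: "nrm C0 f = (SUP x. norm (f x))"
  by (simp add: C0_def)

lemma C0_continuous: "f \<in> vecs C0 \<Longrightarrow> continuous_on UNIV f"
  by (simp add: C0_iff)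

lemma C0_vanishes:
  assumes "f \<in> vecs C0" "e > 0"
  obtains K where "compact K" "\<And>x. x \<notin> K \<Longrightarrow> norm (f x) < e"
  using assms by (auto simp: C0_iff)

lemma C0_linf:
  assumes "f \<in> vecs C0"
  shows "f \<in> linf"
proof -
  obtain K where K: "compact K" "\<And>x. x \<notin> K \<Longrightarrow> norm (f x) < 1"
    using C0_vanishes[OF assms, of 1] by auto
  have "compact (f ` K)"
    using K(1) C0_continuous[OF assms] by (intro compact_continuous_image) (auto intro: continuous_on_subset)
  then obtain B where "\<And>x. x \<in> K \<Longrightarrow> norm (f x) \<le> B"
    using compact_imp_bounded by (fastforce simp: bounded_iff)
  with K(2) have "norm (f x) \<le> max 1 B" for x
    by (cases "x \<in> K") (auto simp: le_max_iff_disj intro: less_imp_le)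
  then show ?thesis by (rule linfI)
qed

lemma le_nrm_C0: "f \<in> vecs C0 \<Longrightarrow> norm (f x) \<le> nrm C0 f"
  unfolding nrm_C0 using C0_linf[of f]
  by (intro cSUP_upper) (auto simp: linf_iff bdd_above_def)

lemma nrm_C0_le: "(\<And>x. norm (f x) \<le> C) \<Longrightarrow> nrm C0 f \<le> C"
  unfolding nrm_C0 by (rule cSUP_least) auto

lemma nrm_C0_zero [simp]: "nrm C0 (\<lambda>x. 0) = 0"
  by (simp add: nrm_C0)

lemma nrm_C0_nonneg: "f \<in> vecs C0 \<Longrightarrow> 0 \<le> nrm C0 f"
  using le_nrm_C0[of f undefined] norm_ge_zero order_trans by blast

lemma C0_dominated:
  assumes g: "g \<in> vecs C0" and f: "continuous_on UNIV f" "\<And>x. norm (f x) \<le> c * norm (g x)"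
  shows "f \<in> vecs C0"
  unfolding C0_iff
proof (intro conjI f(1) allI impI)
  fix e :: real assume "e > 0"
  define d where "d = e / (\<bar>c\<bar> + 1)"
  have "d > 0" using \<open>e > 0\<close> by (simp add: d_def)
  obtain K where K: "compact K" "\<And>x. x \<notin> K \<Longrightarrow> norm (g x) < d" using C0_vanishes[OF g \<open>d > 0\<close>] by blast
  have "norm (f x) < e" if "x \<notin> K" for x
  proof -
    have "norm (f x) \<le> (\<bar>c\<bar> + 1) * norm (g x)"
      using f(2)[of x] by (rule order_trans) (intro mult_right_mono, auto)
    also have "\<dots> < (\<bar>c\<bar> + 1) * d" using K(2)[OF that] by (intro mult_strict_left_mono) auto
    finally show ?thesis by (simp add: d_def)
  qed
  with K(1) show "\<exists>K. compact K \<and> (\<forall>x. x \<notin> K \<longrightarrow> norm (f x) < e)" by blast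
qed

lemma C0_add:
  assumes "f \<in> vecs C0" "g \<in> vecs C0"
  shows "(\<lambda>x. f x + g x) \<in> vecs C0"
  unfolding C0_iff
proof (intro conjI allI impI)
  show "continuous_on UNIV (\<lambda>x. f x + g x)" using assms by (intro continuous_on_add C0_continuous)
  fix e :: real assume "e > 0"
  then have "e / 2 > 0" by simp
  then obtain K L where K: "compact K" "\<And>x. x \<notin> K \<Longrightarrow> norm (f x) < e / 2"
    and L: "compact L" "\<And>x. x \<notin> L \<Longrightarrow> norm (g x) < e / 2"
    using C0_vanishes[OF assms(1)] C0_vanishes[OF assms(2)] by metis
  have "norm (f x + g x) < e" if "x \<notin> K \<union> L" for x
    using norm_triangle_ineq[of "f x" "g x"] K(2)[of x] L(2)[of x] that by simp
  then show "\<exists>K. compact K \<and> (\<forall>x. x \<notin> K \<longrightarrow> norm (f x + g x) < e)"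
    using K(1) L(1) by (intro exI[of _ "K \<union> L"]) (auto intro: compact_Un)
qed

lemma C0_cmult: "f \<in> vecs C0 \<Longrightarrow> (\<lambda>x. c * f x) \<in> vecs C0"
  by (rule C0_dominated[of f _ "norm c"]) (auto simp: norm_mult intro: continuous_on_mult C0_continuous)

lemma C0_diff: "f \<in> vecs C0 \<Longrightarrow> g \<in> vecs C0 \<Longrightarrow> (\<lambda>x. f x - g x) \<in> vecs C0"
  using C0_add[of f "\<lambda>x. (-1) * g x"] C0_cmult[of g "-1"] by simp

lemma C0_zero [simp]: "(\<lambda>x. 0) \<in> vecs C0"
  by (auto simp: C0_iff)

lemma C0_sum: "(\<And>i. i \<in> I \<Longrightarrow> f i \<in> vecs C0) \<Longrightarrow> (\<lambda>x. \<Sum>i\<in>I. f i x) \<in> vecs C0"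
  by (induction I rule: infinite_finite_induct) (auto intro: C0_add)

lemma continuous_on_left_translation:
  "continuous_on UNIV (\<lambda>x. s + x :: 'g::topological_group_add)"
  by (intro continuous_intros)

lemma continuous_on_right_translation:
  "continuous_on UNIV (\<lambda>x. x + s :: 'g::topological_group_add)"
  by (intro continuous_intros)

lemma C0_left_translate:
  fixes f :: "'g::topological_group_add \<Rightarrow> complex"
  assumes "f \<in> vecs C0"
  shows "(\<lambda>t. f (s + t)) \<in> vecs C0"
  unfolding C0_iff
proof (intro conjI allI impI)
  show "continuous_on UNIV (\<lambda>t. f (s + t))"
    by (rule continuous_on_compose2[OF C0_continuous[OF assms] continuous_on_left_translation]) simp
  fix e :: real assume "e > 0"
  then obtain K where K: "compact K" "\<And>x. x \<notin> K \<Longrightarrow> norm (f x) < e" using C0_vanishes[OF assms] by blast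
  have "compact ((\<lambda>x. - s + x) ` K)"
    using K(1) by (intro compact_continuous_image continuous_on_subset[OF continuous_on_left_translation]) auto
  moreover have "norm (f (s + t)) < e" if "t \<notin> (\<lambda>x. - s + x) ` K" for t
  proof (rule K(2), rule notI)
    assume "s + t \<in> K"
    then have "- s + (s + t) \<in> (\<lambda>x. - s + x) ` K" by blast
    with that show False by (simp add: add.assoc[symmetric])
  qed
  ultimately show "\<exists>K. compact K \<and> (\<forall>t. t \<notin> K \<longrightarrow> norm (f (s + t)) < e)" by blast
qed

lemma C0_right_translate:
  fixes f :: "'g::topological_group_add \<Rightarrow> complex"
  assumes "f \<in> vecs C0"
  shows "(\<lambda>t. f (t + s)) \<in> vecs C0"
  unfolding C0_iff
proof (intro conjI allI impI)
  show "continuous_on UNIV (\<lambda>t. f (t + s))"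
    by (rule continuous_on_compose2[OF C0_continuous[OF assms] continuous_on_right_translation]) simp
  fix e :: real assume "e > 0"
  then obtain K where K: "compact K" "\<And>x. x \<notin> K \<Longrightarrow> norm (f x) < e" using C0_vanishes[OF assms] by blast
  have "compact ((\<lambda>x. x + - s) ` K)"
    using K(1) by (intro compact_continuous_image continuous_on_subset[OF continuous_on_right_translation]) auto
  moreover have "norm (f (t + s)) < e" if "t \<notin> (\<lambda>x. x + - s) ` K" for t
  proof (rule K(2), rule notI)
    assume "t + s \<in> K"
    then have "t + s + - s \<in> (\<lambda>x. x + - s) ` K" by blast
    with that show False by (simp add: add.assoc)
  qed
  ultimately show "\<exists>K. compact K \<and> (\<forall>t. t \<notin> K \<longrightarrow> norm (f (t + s)) < e)" by blast
qed

text \<open>Subtracts from f its radial projection onto the disc of radius \<delta>. In contrast to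
  a sharp cut-off this keeps f continuous, moves it by at most \<delta>, and produces an exact 0
  where f was small, which gives control over supports.\<close>

definition soft_truncate :: "real \<Rightarrow> ('g \<Rightarrow> complex) \<Rightarrow> 'g \<Rightarrow> complex" where
  "soft_truncate \<delta> f = (\<lambda>x. f x * of_real (1 - \<delta> / max \<delta> (norm (f x))))"

lemma soft_truncate:
  assumes "\<delta> > 0"
  shows norm_truncate_le: "norm (soft_truncate \<delta> f x) \<le> norm (f x)"
    and soft_truncate_close: "norm (f x - soft_truncate \<delta> f x) \<le> \<delta>"
    and soft_truncate_eq_0: "norm (f x) \<le> \<delta> \<Longrightarrow> soft_truncate \<delta> f x = 0"
proof -
  let ?m = "max \<delta> (norm (f x))"
  have m: "?m > 0" "\<delta> / ?m \<le> 1" "0 \<le> \<delta> / ?m" using assms by (auto simp: field_simps)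
  have "norm (soft_truncate \<delta> f x) = norm (f x) * (1 - \<delta> / ?m)"
    unfolding soft_truncate_def norm_mult norm_of_real using m by simp
  also have "\<dots> \<le> norm (f x) * 1" using m by (intro mult_left_mono) auto
  finally show "norm (soft_truncate \<delta> f x) \<le> norm (f x)" by simp
  have "f x - soft_truncate \<delta> f x = f x * of_real (\<delta> / ?m)" by (simp add: soft_truncate_def algebra_simps)
  then have "norm (f x - soft_truncate \<delta> f x) = norm (f x) * (\<delta> / ?m)"
    using m(3) by (metis abs_of_nonneg norm_mult norm_of_real)
  also have "\<dots> \<le> ?m * (\<delta> / ?m)" using m by (intro mult_right_mono) auto
  also have "\<dots> = \<delta>" using m by simp
  finally show "norm (f x - soft_truncate \<delta> f x) \<le> \<delta>" .
  show "soft_truncate \<delta> f x = 0" if "norm (f x) \<le> \<delta>" using that assms by (simp add: soft_truncate_def max_absorb1)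
qed

lemma soft_truncate_C0:
  assumes "\<delta> > 0" "f \<in> vecs C0"
  shows "soft_truncate \<delta> f \<in> vecs C0"
proof (rule C0_dominated[OF assms(2), of _ 1])
  have "max \<delta> (norm (f x)) \<noteq> 0" for x using assms(1) by (auto simp: max_def)
  then show "continuous_on UNIV (soft_truncate \<delta> f)"
    unfolding soft_truncate_def using C0_continuous[OF assms(2)] by (intro continuous_intros) auto
qed (use norm_truncate_le[OF assms(1)] in auto)

section \<open>Measures as functionals on C0(G)\<close>

lemma vecs_MG: "vecs MG = adual C0"
  and nrm_MG: "nrm MG = adual_norm C0"
  and mul_MG: "mul MG \<mu> \<nu> = (\<lambda>f. if f \<in> vecs C0 then \<mu> (\<lambda>s. \<nu> (\<lambda>t. f (s + t))) else 0)"
  by (simp_all add: MG_def)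

lemma MG_linear:
  assumes "\<mu> \<in> vecs MG"
  shows MG_outside: "f \<notin> vecs C0 \<Longrightarrow> \<mu> f = 0"
    and MG_add: "f \<in> vecs C0 \<Longrightarrow> g \<in> vecs C0 \<Longrightarrow> \<mu> (\<lambda>x. f x + g x) = \<mu> f + \<mu> g"
    and MG_cmult: "f \<in> vecs C0 \<Longrightarrow> \<mu> (\<lambda>x. c * f x) = c * \<mu> f"
  using dualD[of \<mu> "vecs C0" "nrm C0"] assms by (auto simp: vecs_MG adual_def)

lemma MG_diff:
  assumes "\<mu> \<in> vecs MG" "f \<in> vecs C0" "g \<in> vecs C0"
  shows "\<mu> (\<lambda>x. f x - g x) = \<mu> f - \<mu> g"
  using MG_add[OF assms(1,2), of "\<lambda>x. (-1) * g x"] MG_cmult[OF assms(1,3), of "-1"]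
    C0_cmult[OF assms(3), of "-1"] by simp

lemma MG_zero: "\<mu> \<in> vecs MG \<Longrightarrow> \<mu> (\<lambda>x. 0) = 0"
  using MG_cmult[of \<mu> "\<lambda>x. 0" 0] by simp

lemma MG_sum:
  assumes \<mu>: "\<mu> \<in> vecs MG" and "\<And>i. i \<in> I \<Longrightarrow> f i \<in> vecs C0"
  shows "\<mu> (\<lambda>x. \<Sum>i\<in>I. f i x) = (\<Sum>i\<in>I. \<mu> (f i))"
  using assms(2)
  by (induction I rule: infinite_finite_induct) (simp_all add: MG_zero[OF \<mu>] MG_add[OF \<mu>] C0_sum)

lemma nrm_C0_cmult:
  assumes "f \<in> vecs C0"
  shows "nrm C0 (\<lambda>x. c * f x) = norm c * nrm C0 f"
proof (rule antisym)
  show "nrm C0 (\<lambda>x. c * f x) \<le> norm c * nrm C0 f"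
    using le_nrm_C0[OF assms] by (intro nrm_C0_le) (simp add: norm_mult mult_left_mono)
  show "norm c * nrm C0 f \<le> nrm C0 (\<lambda>x. c * f x)"
  proof (cases "c = 0")
    case False
    have "nrm C0 f \<le> nrm C0 (\<lambda>x. c * f x) / norm c"
      using False le_nrm_C0[OF C0_cmult[OF assms], of c]
      by (intro nrm_C0_le) (simp add: norm_mult field_simps)
    then show ?thesis using False by (simp add: field_simps)
  qed (simp add: nrm_C0)
qed

text \<open>Stated for any f with a pointwise bound C: off \<open>vecs C0\<close> the functional is
  0. Estimates can thus be chained without membership proofs.\<close>

lemma MG_bound:
  assumes \<mu>: "\<mu> \<in> vecs MG" and f: "\<And>x. norm (f x) \<le> C"
  shows "norm (\<mu> f) \<le> nrm MG \<mu> * C"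
proof -
  have "0 \<le> C" using f[of undefined] norm_ge_zero order_trans by blast
  have le: "norm (\<mu> g) \<le> nrm MG \<mu> * nrm C0 g" if "g \<in> vecs C0" for g
    using \<mu> that unfolding nrm_MG vecs_MG adual_def adual_norm_def
    by (intro norm_le_dual_norm) (simp_all add: nrm_C0_nonneg C0_cmult nrm_C0_cmult)
  have "norm (\<mu> (\<lambda>x. 0)) \<le> nrm MG \<mu>"
    using \<mu> unfolding nrm_MG vecs_MG adual_def adual_norm_def
    by (intro le_dual_norm) (simp_all add: nrm_C0_nonneg)
  then have "0 \<le> nrm MG \<mu>" by (rule order_trans[OF norm_ge_zero])
  show ?thesis
  proof (cases "f \<in> vecs C0")
    case True
    have "nrm MG \<mu> * nrm C0 f \<le> nrm MG \<mu> * C"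
      using \<open>0 \<le> nrm MG \<mu>\<close> nrm_C0_le[OF f] by (rule mult_left_mono[rotated])
    with le[OF True] show ?thesis by linarith
  next
    case False
    then show ?thesis using MG_outside[OF \<mu>] \<open>0 \<le> C\<close> \<open>0 \<le> nrm MG \<mu>\<close> by simp
  qed
qed

lemma nrm_MG_nonneg:
  assumes "\<mu> \<in> vecs MG"
  shows "0 \<le> nrm MG \<mu>"
  using MG_bound[OF assms, of "\<lambda>x. 0" 1] by (simp add: MG_zero[OF assms])

lemma MG_memI:
  assumes "\<And>f. f \<notin> vecs C0 \<Longrightarrow> \<mu> f = 0"
    and "\<And>f g. f \<in> vecs C0 \<Longrightarrow> g \<in> vecs C0 \<Longrightarrow> \<mu> (\<lambda>x. f x + g x) = \<mu> f + \<mu> g"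
    and "\<And>c f. f \<in> vecs C0 \<Longrightarrow> \<mu> (\<lambda>x. c * f x) = c * \<mu> f"
    and "\<And>f C. f \<in> vecs C0 \<Longrightarrow> (\<And>x. norm (f x) \<le> C) \<Longrightarrow> norm (\<mu> f) \<le> B * C"
  shows "\<mu> \<in> vecs MG"
  unfolding vecs_MG adual_def dual_def linear_functional_def
  using assms le_nrm_C0 by blast

lemma MG_add_mem: "\<mu> \<in> vecs MG \<Longrightarrow> \<nu> \<in> vecs MG \<Longrightarrow> (\<lambda>f. \<mu> f + \<nu> f) \<in> vecs MG"
  unfolding vecs_MG adual_def by (rule dual_add_mem)

lemma MG_cmult_mem: "\<mu> \<in> vecs MG \<Longrightarrow> (\<lambda>f. c * \<mu> f) \<in> vecs MG"
  unfolding vecs_MG adual_def by (rule dual_cmult_mem)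

lemma MG_diff_mem: "\<mu> \<in> vecs MG \<Longrightarrow> \<nu> \<in> vecs MG \<Longrightarrow> (\<lambda>f. \<mu> f - \<nu> f) \<in> vecs MG"
  using MG_add_mem[of \<mu> "\<lambda>f. (-1) * \<nu> f"] MG_cmult_mem[of \<nu> "-1"] by simp

text \<open>\<open>small_on \<mu> U \<epsilon>\<close> means \<open>|\<mu>|(U) \<le> \<epsilon>\<close>, and \<open>has_atom \<mu> s c\<close> means \<open>\<mu> {s} = c\<close>.\<close>

definition small_on :: "'g::topological_group_add functional \<Rightarrow> 'g set \<Rightarrow> real \<Rightarrow> bool" where
  "small_on \<mu> U \<epsilon> \<longleftrightarrow> (\<forall>h\<in>vecs C0. (\<forall>x. norm (h x) \<le> 1) \<longrightarrow> (\<forall>x. x \<notin> U \<longrightarrow> h x = 0) \<longrightarrow> norm (\<mu> h) \<le> \<epsilon>)"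

definition has_atom :: "'g::topological_group_add functional \<Rightarrow> 'g \<Rightarrow> complex \<Rightarrow> bool" where
  "has_atom \<mu> s c \<longleftrightarrow> (\<forall>\<epsilon>>0. \<exists>U. open U \<and> s \<in> U \<and>
     (\<forall>h\<in>vecs C0. (\<forall>x. norm (h x) \<le> 1) \<longrightarrow> (\<forall>x. x \<notin> U \<longrightarrow> h x = 0) \<longrightarrow> norm (\<mu> h - c * h s) \<le> \<epsilon>))"

lemma small_onD:
  "small_on \<mu> U \<epsilon> \<Longrightarrow> h \<in> vecs C0 \<Longrightarrow> (\<And>x. norm (h x) \<le> 1) \<Longrightarrow> (\<And>x. x \<notin> U \<Longrightarrow> h x = 0) \<Longrightarrow> norm (\<mu> h) \<le> \<epsilon>"
  by (simp add: small_on_def)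

lemma small_on_mono: "small_on \<mu> U \<epsilon> \<Longrightarrow> V \<subseteq> U \<Longrightarrow> small_on \<mu> V \<epsilon>"
  unfolding small_on_def by blast

lemma has_atom_0_iff: "has_atom \<mu> s 0 \<longleftrightarrow> (\<forall>\<epsilon>>0. \<exists>U. open U \<and> s \<in> U \<and> small_on \<mu> U \<epsilon>)"
  by (simp add: has_atom_def small_on_def)

lemma has_atomE:
  assumes "has_atom \<mu> s c" "\<epsilon> > 0"
  obtains U where "open U" "s \<in> U"
    "\<And>h. h \<in> vecs C0 \<Longrightarrow> (\<And>x. norm (h x) \<le> 1) \<Longrightarrow> (\<And>x. x \<notin> U \<Longrightarrow> h x = 0) \<Longrightarrow> norm (\<mu> h - c * h s) \<le> \<epsilon>"
proof -
  from assms obtain U where U: "open U" "s \<in> U"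
    "\<forall>h\<in>vecs C0. (\<forall>x. norm (h x) \<le> 1) \<longrightarrow> (\<forall>x. x \<notin> U \<longrightarrow> h x = 0) \<longrightarrow> norm (\<mu> h - c * h s) \<le> \<epsilon>"
    unfolding has_atom_def by blast
  show thesis by (rule that[OF U(1,2)]) (use U(3) in blast)
qed

lemma has_atom_add:
  assumes "has_atom \<mu> s c" "has_atom \<nu> s d"
  shows "has_atom (\<lambda>f. \<mu> f + \<nu> f) s (c + d)"
  unfolding has_atom_def
proof (intro allI impI)
  fix \<epsilon> :: real assume "\<epsilon> > 0"
  then have "\<epsilon> / 2 > 0" by simp
  obtain U where U: "open U" "s \<in> U"
    "\<And>h. h \<in> vecs C0 \<Longrightarrow> (\<And>x. norm (h x) \<le> 1) \<Longrightarrow> (\<And>x. x \<notin> U \<Longrightarrow> h x = 0) \<Longrightarrow> norm (\<mu> h - c * h s) \<le> \<epsilon> / 2"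
    using has_atomE[OF assms(1) \<open>\<epsilon> / 2 > 0\<close>] by metis
  obtain V where V: "open V" "s \<in> V"
    "\<And>h. h \<in> vecs C0 \<Longrightarrow> (\<And>x. norm (h x) \<le> 1) \<Longrightarrow> (\<And>x. x \<notin> V \<Longrightarrow> h x = 0) \<Longrightarrow> norm (\<nu> h - d * h s) \<le> \<epsilon> / 2"
    using has_atomE[OF assms(2) \<open>\<epsilon> / 2 > 0\<close>] by metis
  show "\<exists>U. open U \<and> s \<in> U \<and> (\<forall>h\<in>vecs C0. (\<forall>x. norm (h x) \<le> 1) \<longrightarrow> (\<forall>x. x \<notin> U \<longrightarrow> h x = 0) \<longrightarrow>
      norm (\<mu> h + \<nu> h - (c + d) * h s) \<le> \<epsilon>)"
  proof (intro exI[of _ "U \<inter> V"] conjI ballI impI)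
    fix h assume h: "h \<in> vecs C0" "\<forall>x. norm (h x) \<le> 1" "\<forall>x. x \<notin> U \<inter> V \<longrightarrow> h x = 0"
    have "norm (\<mu> h + \<nu> h - (c + d) * h s) \<le> norm (\<mu> h - c * h s) + norm (\<nu> h - d * h s)"
      using norm_triangle_ineq[of "\<mu> h - c * h s" "\<nu> h - d * h s"] by (simp add: algebra_simps)
    also have "\<dots> \<le> \<epsilon> / 2 + \<epsilon> / 2" using h by (intro add_mono U(3) V(3)) auto
    finally show "norm (\<mu> h + \<nu> h - (c + d) * h s) \<le> \<epsilon>" by simp
  qed (use U V in auto)
qed

lemma has_atom_cmult:
  assumes "has_atom \<mu> s c"
  shows "has_atom (\<lambda>f. d * \<mu> f) s (d * c)"
  unfolding has_atom_def
proof (intro allI impI)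
  fix \<epsilon> :: real assume "\<epsilon> > 0"
  then have "\<epsilon> / (norm d + 1) > 0" by (intro divide_pos_pos) (auto intro: add_nonneg_pos)
  from has_atomE[OF assms this] obtain U where U: "open U" "s \<in> U"
    "\<And>h. h \<in> vecs C0 \<Longrightarrow> (\<And>x. norm (h x) \<le> 1) \<Longrightarrow> (\<And>x. x \<notin> U \<Longrightarrow> h x = 0) \<Longrightarrow>
       norm (\<mu> h - c * h s) \<le> \<epsilon> / (norm d + 1)" by metis
  show "\<exists>U. open U \<and> s \<in> U \<and> (\<forall>h\<in>vecs C0. (\<forall>x. norm (h x) \<le> 1) \<longrightarrow> (\<forall>x. x \<notin> U \<longrightarrow> h x = 0) \<longrightarrow>
      norm (d * \<mu> h - d * c * h s) \<le> \<epsilon>)"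
  proof (intro exI[of _ U] conjI ballI impI U)
    fix h assume h: "h \<in> vecs C0" "\<forall>x. norm (h x) \<le> 1" "\<forall>x. x \<notin> U \<longrightarrow> h x = 0"
    have "norm (d * \<mu> h - d * c * h s) = norm d * norm (\<mu> h - c * h s)"
      by (simp add: norm_mult[symmetric] algebra_simps)
    also have "\<dots> \<le> (norm d + 1) * (\<epsilon> / (norm d + 1))" using h by (intro mult_mono U(3)) auto
    also have "norm d + 1 \<noteq> 0" using norm_ge_zero[of d] by linarith
    then have "(norm d + 1) * (\<epsilon> / (norm d + 1)) = \<epsilon>" by simp
    finally show "norm (d * \<mu> h - d * c * h s) \<le> \<epsilon>" .
  qed
qed

lemma has_atom_diff:
  "has_atom \<mu> s c \<Longrightarrow> has_atom \<nu> s d \<Longrightarrow> has_atom (\<lambda>f. \<mu> f - \<nu> f) s (c - d)"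
  using has_atom_add[of \<mu> s c "\<lambda>f. (-1) * \<nu> f" "(-1) * d"] has_atom_cmult[of \<nu> s d "-1"] by simp

text \<open>\<open>small_on \<mu> U \<epsilon>\<close> says that the supremum in
  \<open>variation_open\<close> is at most \<epsilon>, and the infimum over the neighbourhoods of s
  vanishes exactly if every \<epsilon> is reached. From here on non-atomic measures are handled by
  test functions.\<close>

lemma M_c_iff:
  fixes \<mu> :: "'g::topological_group_add functional"
  shows "\<mu> \<in> M_c \<longleftrightarrow> \<mu> \<in> vecs MG \<and> (\<forall>s. has_atom \<mu> s 0)"
proof (cases "\<mu> \<in> vecs MG")
  case \<mu>: True
  define T where "T = (\<lambda>U :: 'g set. {f \<in> vecs C0. (\<forall>x. norm (f x) \<le> 1) \<and> (\<forall>x. x \<notin> U \<longrightarrow> f x = 0)})"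
  have T: "(\<lambda>x. 0) \<in> T U" for U by (simp add: T_def)
  have bdd: "bdd_above ((\<lambda>f. norm (\<mu> f)) ` T U)" for U
    using MG_bound[OF \<mu>, of _ 1] by (auto simp: bdd_above_def T_def)
  have var: "variation_open \<mu> U = (SUP f\<in>T U. norm (\<mu> f))" for U
    by (simp add: variation_open_def T_def)
  have nonneg: "0 \<le> variation_open \<mu> U" for U
    unfolding var using cSUP_upper[OF T bdd, of U] by (simp add: MG_zero[OF \<mu>])
  have small: "small_on \<mu> U \<epsilon> \<longleftrightarrow> variation_open \<mu> U \<le> \<epsilon>" for U \<epsilon>
  proof
    assume "small_on \<mu> U \<epsilon>"
    then show "variation_open \<mu> U \<le> \<epsilon>"
      unfolding var using T by (intro cSUP_least) (blast, auto simp: small_on_def T_def)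
  next
    assume "variation_open \<mu> U \<le> \<epsilon>"
    then show "small_on \<mu> U \<epsilon>"
      unfolding small_on_def
    proof (intro ballI impI)
      fix h assume "h \<in> vecs C0" "\<forall>x. norm (h x) \<le> 1" "\<forall>x. x \<notin> U \<longrightarrow> h x = 0"
      then have "norm (\<mu> h) \<le> variation_open \<mu> U"
        unfolding var by (intro cSUP_upper bdd) (simp add: T_def)
      with \<open>variation_open \<mu> U \<le> \<epsilon>\<close> show "norm (\<mu> h) \<le> \<epsilon>" by linarith
    qed
  qed
  have "variation_point \<mu> s = 0 \<longleftrightarrow> has_atom \<mu> s 0" for s
  proof -
    let ?\<U> = "{U. open U \<and> s \<in> U}"
    have ne: "?\<U> \<noteq> {}" by blast
    have below: "bdd_below (variation_open \<mu> ` ?\<U>)" using nonneg by (auto simp: bdd_below_def)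
    have ge: "0 \<le> variation_point \<mu> s"
      unfolding variation_point_def using ne nonneg by (intro cINF_greatest) auto
    have less: "variation_point \<mu> s < \<epsilon> \<longleftrightarrow> (\<exists>U. open U \<and> s \<in> U \<and> variation_open \<mu> U < \<epsilon>)" for \<epsilon>
      unfolding variation_point_def cINF_less_iff[OF ne below] by auto
    show ?thesis
      unfolding has_atom_0_iff small
    proof
      assume "variation_point \<mu> s = 0"
      then show "\<forall>\<epsilon>>0. \<exists>U. open U \<and> s \<in> U \<and> variation_open \<mu> U \<le> \<epsilon>"
        using less by (metis less_imp_le)
    next
      assume *: "\<forall>\<epsilon>>0. \<exists>U. open U \<and> s \<in> U \<and> variation_open \<mu> U \<le> \<epsilon>"
      have "variation_point \<mu> s \<le> 0 + \<epsilon>" if "\<epsilon> > 0" for \<epsilon>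
      proof -
        have "\<epsilon> / 2 > 0" using that by simp
        then obtain U where "open U" "s \<in> U" "variation_open \<mu> U \<le> \<epsilon> / 2" using * by blast
        then have "variation_point \<mu> s < \<epsilon>" unfolding less using that by (intro exI[of _ U]) auto
        then show ?thesis by simp
      qed
      then have "variation_point \<mu> s \<le> 0" by (rule field_le_epsilon)
      with ge show "variation_point \<mu> s = 0" by simp
    qed
  qed
  then show ?thesis using \<mu> by (simp add: M_c_def)
qed (simp add: M_c_def)

text \<open>If this failed, test functions with disjoint supports accumulating at \<open>s\<close> would add up to
  contradict the boundedness of \<open>\<mu>\<close>.\<close>

lemma small_on_punctured:
  assumes \<mu>: "\<mu> \<in> vecs MG" and "\<epsilon> > 0"
  shows "\<exists>U. open U \<and> s \<in> U \<and> (\<forall>h\<in>vecs C0. (\<forall>x. norm (h x) \<le> 1) \<longrightarrow>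
    (\<forall>x. x \<notin> U \<longrightarrow> h x = 0) \<longrightarrow> h s = 0 \<longrightarrow> norm (\<mu> h) \<le> \<epsilon>)"
proof (rule ccontr)
  assume no: "\<not> ?thesis"
  \<comment> \<open>Truncating at level \<delta> changes the value of \<mu> by at most \<epsilon> /
    2, so at least \<epsilon> / 2 of the assumed value survives.\<close>
  define \<delta> where "\<delta> = \<epsilon> / (2 * (nrm MG \<mu> + 1))"
  have nn: "0 \<le> nrm MG \<mu>" using \<mu> by (rule nrm_MG_nonneg)
  then have "\<delta> > 0" "nrm MG \<mu> * \<delta> \<le> \<epsilon> / 2" using \<open>\<epsilon> > 0\<close> by (auto simp: \<delta>_def field_simps)
  have "\<exists>U g. open U \<and> s \<in> U \<and> g \<in> vecs C0 \<and> (\<forall>x. norm (g x) \<le> 1) \<and> (\<forall>x\<in>U. g x = 0) \<and>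
      real n * (\<epsilon> / 2) \<le> Re (\<mu> g)" for n
  proof (induction n)
    case 0
    show ?case
      by (rule exI[of _ UNIV], rule exI[of _ "\<lambda>x. 0"]) (simp add: MG_zero[OF \<mu>])
  next
    case (Suc n)
    then obtain U g where U: "open U" "s \<in> U" and g: "g \<in> vecs C0" "\<And>x. norm (g x) \<le> 1"
      "\<And>x. x \<in> U \<Longrightarrow> g x = 0" "real n * (\<epsilon> / 2) \<le> Re (\<mu> g)" by blast
    obtain h where h: "h \<in> vecs C0" "\<And>x. norm (h x) \<le> 1" "\<And>x. x \<notin> U \<Longrightarrow> h x = 0" "h s = 0"
      "norm (\<mu> h) > \<epsilon>" using no U by (meson not_le)
    \<comment> \<open>h is only known to vanish at s itself; its truncation vanishes on the whole
      neighbourhood of s where h is below \<delta>, which leaves room for the next test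
      function.\<close>
    define k where "k = soft_truncate \<delta> h"
    note tr = soft_truncate[OF \<open>\<delta> > 0\<close>, of h]
    have k: "k \<in> vecs C0" unfolding k_def by (rule soft_truncate_C0[OF \<open>\<delta> > 0\<close> h(1)])
    have "norm (\<mu> h - \<mu> k) \<le> nrm MG \<mu> * \<delta>"
      unfolding MG_diff[OF \<mu> h(1) k, symmetric] by (intro MG_bound[OF \<mu>]) (simp add: k_def tr(2))
    then have \<mu>k: "\<epsilon> / 2 \<le> norm (\<mu> k)"
      using norm_triangle_ineq2[of "\<mu> h" "\<mu> k"] h(5) \<open>nrm MG \<mu> * \<delta> \<le> \<epsilon> / 2\<close> by linarith
    define c where "c = cnj (sgn (\<mu> k))"
    define g' where "g' = (\<lambda>x. g x + c * k x)"
    have "g' \<in> vecs C0" unfolding g'_def by (intro C0_add C0_cmult g k)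
    moreover have "norm (g' x) \<le> 1" for x
      unfolding g'_def
    proof (rule norm_disjoint_add_le)
      have "k x = 0" if "h x = 0" using tr(1)[of x] that by (simp add: k_def)
      then show "g x = 0 \<or> c * k x = 0" using g(3)[of x] h(3)[of x] by auto
      have "norm (k x) \<le> 1" using tr(1)[of x] h(2)[of x] by (simp add: k_def)
      then show "norm (c * k x) \<le> 1"
        using norm_cnj_sgn_le[of "\<mu> k"] by (simp add: norm_mult c_def mult_le_one)
    qed (rule g)
    moreover have "real (Suc n) * (\<epsilon> / 2) \<le> Re (\<mu> g')"
    proof -
      have "\<mu> g' = \<mu> g + of_real (norm (\<mu> k))"
        unfolding g'_def using g(1) k
        by (simp add: MG_add[OF \<mu>] MG_cmult[OF \<mu>] C0_cmult c_def cnj_sgn_mult)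
      then show ?thesis using g(4) \<mu>k by (simp add: field_simps)
    qed
    moreover have "open (U \<inter> {x. norm (h x) < \<delta>})"
      using U(1) C0_continuous[OF h(1)]
      by (intro open_Int open_Collect_less continuous_intros) auto
    moreover have "g' x = 0" if "x \<in> U \<inter> {x. norm (h x) < \<delta>}" for x
      using that g(3)[of x] tr(3)[of x] by (simp add: g'_def k_def)
    ultimately show ?case
      using U(2) h(4) \<open>\<delta> > 0\<close>
      by (intro exI[of _ "U \<inter> {x. norm (h x) < \<delta>}"] exI[of _ g']) auto
  qed
  moreover obtain n :: nat where "nrm MG \<mu> < real n * (\<epsilon> / 2)"
    using \<open>\<epsilon> > 0\<close> ex_less_of_nat_mult[of "\<epsilon> / 2"] by auto
  ultimately obtain g where g: "\<And>x. norm (g x) \<le> 1" "nrm MG \<mu> < Re (\<mu> g)"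
    by (meson less_le_trans)
  have "norm (\<mu> g) \<le> nrm MG \<mu> * 1" by (rule MG_bound[OF \<mu> g(1)])
  then show False using g(2) complex_Re_le_cmod[of "\<mu> g"] by linarith
qed

section \<open>Atomic measures given by l^1(G)\<close>

lemma infsum_split_finite:
  fixes a f :: "'g::group_add \<Rightarrow> complex"
  assumes E: "finite E" and f: "f \<in> linf" and a: "a \<in> vecs l1"
  shows "(\<lambda>t. if t \<in> E then 0 else a t) \<in> vecs l1"
    and "(\<Sum>\<^sub>\<infinity>t. a t * f t) = (\<Sum>t\<in>E. a t * f t) + (\<Sum>\<^sub>\<infinity>t. (if t \<in> E then 0 else a t) * f t)"
    and "nrm l1 a = (\<Sum>t\<in>E. norm (a t)) + nrm l1 (\<lambda>t. if t \<in> E then 0 else a t)"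
proof -
  let ?a = "\<lambda>t. if t \<in> E then 0 else a t"
  show mem: "?a \<in> vecs l1"
    using a unfolding l1_iff by (rule summable_on_comparison_test) auto
  have fin: "(\<lambda>t. if t \<in> E then g t else 0) summable_on UNIV"
    "(\<Sum>\<^sub>\<infinity>t. if t \<in> E then g t else 0) = (\<Sum>t\<in>E. g t)"
    for g :: "'g \<Rightarrow> 'b::{topological_comm_monoid_add,t2_space}"
    using E summable_on_cong_neutral[of UNIV E "\<lambda>t. if t \<in> E then g t else 0" g]
      infsum_cong_neutral[of UNIV E "\<lambda>t. if t \<in> E then g t else 0" g] by auto
  have "(\<Sum>\<^sub>\<infinity>t. a t * f t) = (\<Sum>\<^sub>\<infinity>t. (if t \<in> E then a t * f t else 0) + ?a t * f t)"
    by (rule infsum_cong) auto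
  also have "\<dots> = (\<Sum>t\<in>E. a t * f t) + (\<Sum>\<^sub>\<infinity>t. ?a t * f t)"
    using summable_linf_l1[OF mem f] by (subst infsum_add) (auto simp: fin mult.commute)
  finally show "(\<Sum>\<^sub>\<infinity>t. a t * f t) = (\<Sum>t\<in>E. a t * f t) + (\<Sum>\<^sub>\<infinity>t. ?a t * f t)" .
  have "nrm l1 a = (\<Sum>\<^sub>\<infinity>t. (if t \<in> E then norm (a t) else 0) + norm (?a t))"
    unfolding nrm_l1 by (rule infsum_cong) auto
  also have "\<dots> = (\<Sum>t\<in>E. norm (a t)) + nrm l1 ?a"
    using mem unfolding nrm_l1 l1_iff by (subst infsum_add) (auto simp: fin)
  finally show "nrm l1 a = (\<Sum>t\<in>E. norm (a t)) + nrm l1 ?a" .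
qed

lemma l1_finite_approximation:
  fixes a :: "'g::group_add \<Rightarrow> complex"
  assumes a: "a \<in> vecs l1" and "\<epsilon> > 0"
  obtains E where "finite E" "\<And>E'. finite E' \<Longrightarrow> E \<subseteq> E' \<Longrightarrow> nrm l1 (\<lambda>t. if t \<in> E' then 0 else a t) \<le> \<epsilon>"
proof -
  obtain E where E: "finite E" "dist (\<Sum>t\<in>E. norm (a t)) (\<Sum>\<^sub>\<infinity>t. norm (a t)) \<le> \<epsilon>"
    using infsum_finite_approximation[of "\<lambda>t. norm (a t)" UNIV] assms by (auto simp: l1_iff)
  have "nrm l1 (\<lambda>t. if t \<in> E' then 0 else a t) \<le> \<epsilon>" if "finite E'" "E \<subseteq> E'" for E'
  proof -
    have "(\<Sum>t\<in>E. norm (a t)) \<le> (\<Sum>t\<in>E'. norm (a t))" using that by (intro sum_mono2) auto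
    then show ?thesis
      using infsum_split_finite(3)[OF that(1) linf_const[of 0] a] E(2) by (simp add: dist_real_def nrm_l1)
  qed
  with E(1) show thesis by (rule that)
qed

lemma norm_infsum_l1_linf_le:
  "a \<in> vecs l1 \<Longrightarrow> (\<And>s. norm (F s) \<le> C) \<Longrightarrow> norm (\<Sum>\<^sub>\<infinity>s. a s * F s) \<le> C * nrm l1 a"
  using norm_infsum_linf_l1_le[of a F C] by (simp add: mult.commute)

lemma atomic_measure_mem:
  assumes a: "a \<in> vecs l1"
  shows "atomic_measure a \<in> vecs MG"
proof (rule MG_memI[where B = "nrm l1 a"])
  have sm: "(\<lambda>s. a s * f s) summable_on UNIV" if "f \<in> vecs C0" for f
    using summable_linf_l1[OF a C0_linf[OF that]] by (simp add: mult.commute)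
  show "atomic_measure a f = 0" if "f \<notin> vecs C0" for f using that by (simp add: atomic_measure_def)
  show "atomic_measure a (\<lambda>x. f x + g x) = atomic_measure a f + atomic_measure a g"
    if "f \<in> vecs C0" "g \<in> vecs C0" for f g
    using that by (simp add: atomic_measure_def C0_add distrib_left infsum_add sm)
  show "atomic_measure a (\<lambda>x. c * f x) = c * atomic_measure a f" if "f \<in> vecs C0" for c f
    using that by (simp add: atomic_measure_def C0_cmult infsum_cmult_right'[symmetric] mult.left_commute)
  show "norm (atomic_measure a f) \<le> nrm l1 a * C" if "f \<in> vecs C0" "\<And>x. norm (f x) \<le> C" for f C
    using norm_infsum_l1_linf_le[OF a that(2)] that(1) by (simp add: atomic_measure_def mult.commute)
qed

text \<open>A finite set E carries all but \<epsilon> of a. The complement of E - {s} is a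
  neighbourhood of s, finite sets being closed, and a test function supported there sees only the
  mass at s and the tail.\<close>

lemma has_atom_atomic_measure:
  fixes a :: "'g::{topological_group_add, t2_space} \<Rightarrow> complex"
  assumes a: "a \<in> vecs l1"
  shows "has_atom (atomic_measure a) s (a s)"
  unfolding has_atom_def
proof (intro allI impI)
  fix \<epsilon> :: real assume "\<epsilon> > 0"
  then obtain E where E: "finite E"
    "\<And>E'. finite E' \<Longrightarrow> E \<subseteq> E' \<Longrightarrow> nrm l1 (\<lambda>t. if t \<in> E' then 0 else a t) \<le> \<epsilon>"
    using l1_finite_approximation[OF a] by metis
  let ?E = "insert s E"
  let ?a = "\<lambda>t. if t \<in> ?E then 0 else a t"
  show "\<exists>U. open U \<and> s \<in> U \<and> (\<forall>h\<in>vecs C0. (\<forall>x. norm (h x) \<le> 1) \<longrightarrow> (\<forall>x. x \<notin> U \<longrightarrow> h x = 0) \<longrightarrow>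
      norm (atomic_measure a h - a s * h s) \<le> \<epsilon>)"
  proof (intro exI[of _ "- (E - {s})"] conjI ballI impI)
    show "open (- (E - {s}))" using E(1) by (intro open_Compl finite_imp_closed) auto
    fix h assume h: "h \<in> vecs C0" "\<forall>x. norm (h x) \<le> 1" "\<forall>x. x \<notin> - (E - {s}) \<longrightarrow> h x = 0"
    have "atomic_measure a h = (\<Sum>t\<in>?E. a t * h t) + (\<Sum>\<^sub>\<infinity>t. ?a t * h t)"
      using infsum_split_finite(2)[OF _ C0_linf[OF h(1)] a, of ?E] E(1) h(1)
      by (simp only: atomic_measure_def finite_insert if_True)
    also have "(\<Sum>t\<in>?E. a t * h t) = (\<Sum>t\<in>{s}. a t * h t)"
      using E(1) h(3) by (intro sum.mono_neutral_right) auto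
    finally have "norm (atomic_measure a h - a s * h s) = norm (\<Sum>\<^sub>\<infinity>t. ?a t * h t)" by simp
    also have "\<dots> \<le> 1 * nrm l1 ?a"
      using infsum_split_finite(1)[OF _ linf_const[of 0] a, of ?E] E(1) h(2)
      by (intro norm_infsum_l1_linf_le) auto
    also have "\<dots> \<le> \<epsilon>" using E(2)[of ?E] E(1) by auto
    finally show "norm (atomic_measure a h - a s * h s) \<le> \<epsilon>" .
  qed simp
qed

lemma ex_disjoint_neighbourhoods:
  fixes E :: "'g::t2_space set"
  assumes "finite E"
  obtains V where "\<And>s. open (V s)" "\<And>s. s \<in> V s" "\<And>s t. s \<in> E \<Longrightarrow> t \<in> E \<Longrightarrow> s \<noteq> t \<Longrightarrow> V s \<inter> V t = {}"
proof -
  have "\<exists>P Q. open P \<and> open Q \<and> s \<in> P \<and> t \<in> Q \<and> (s \<noteq> t \<longrightarrow> P \<inter> Q = {})" for s t :: 'g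
    by (metis hausdorff open_UNIV UNIV_I)
  then obtain P Q where PQ: "\<And>s t :: 'g. open (P s t)" "\<And>s t :: 'g. open (Q s t)"
    "\<And>s t :: 'g. s \<in> P s t" "\<And>s t :: 'g. t \<in> Q s t" "\<And>s t :: 'g. s \<noteq> t \<Longrightarrow> P s t \<inter> Q s t = {}"
    by metis
  define V where "V = (\<lambda>s. \<Inter>t\<in>E. P s t \<inter> Q t s)"
  have "open (V s)" for s unfolding V_def using assms PQ by (intro open_INT) auto
  moreover have "s \<in> V s" for s by (simp add: V_def PQ)
  moreover have "V s \<inter> V t = {}" if "s \<in> E" "t \<in> E" "s \<noteq> t" for s t
    using that PQ(5)[of s t] by (auto simp: V_def)
  ultimately show thesis by (rule that)
qed

text \<open>A function that almost attains the norm of \<open>\<nu>\<close> is, after truncation, supported on a compact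
  set, and leaves no mass for functions supported off that set.\<close>

lemma MG_tight:
  assumes \<nu>: "\<nu> \<in> vecs MG" and "\<epsilon> > 0"
  obtains K where "compact K" "small_on \<nu> (- K) \<epsilon>"
proof -
  let ?B = "{f \<in> vecs C0. nrm C0 f \<le> 1}"
  \<comment> \<open>\<epsilon> is spent in halves: on f falling short of the norm, and on its
    truncation.\<close>
  define \<delta> where "\<delta> = \<epsilon> / (2 * (nrm MG \<nu> + 1))"
  have nn: "0 \<le> nrm MG \<nu>" using \<nu> by (rule nrm_MG_nonneg)
  then have "\<delta> > 0" "nrm MG \<nu> * \<delta> \<le> \<epsilon> / 2" using \<open>\<epsilon> > 0\<close> by (auto simp: \<delta>_def field_simps)
  have unit: "norm (f x) \<le> 1" if "f \<in> ?B" for f x using le_nrm_C0[of f x] that by auto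
  have "norm (\<nu> f) \<le> nrm MG \<nu> * 1" if "f \<in> ?B" for f using unit[OF that] by (rule MG_bound[OF \<nu>])
  then have bdd: "bdd_above ((\<lambda>f. norm (\<nu> f)) ` ?B)" unfolding bdd_above_def by blast
  have "(\<lambda>x. 0) \<in> ?B" by (simp add: nrm_C0)
  then have ne: "?B \<noteq> {}" by blast
  have "nrm MG \<nu> - \<epsilon> / 2 < (SUP f\<in>?B. norm (\<nu> f))"
    using \<open>\<epsilon> > 0\<close> by (simp add: nrm_MG adual_norm_def dual_norm_def)
  then obtain f where f: "f \<in> ?B" "nrm MG \<nu> - \<epsilon> / 2 < norm (\<nu> f)"
    unfolding less_cSUP_iff[OF ne bdd] by blast
  then have fC: "f \<in> vecs C0" by simp
  obtain K where K: "compact K" "\<And>x. x \<notin> K \<Longrightarrow> norm (f x) < \<delta>" using C0_vanishes[OF fC \<open>\<delta> > 0\<close>] by blast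
  define k where "k = soft_truncate \<delta> f"
  note tr = soft_truncate[OF \<open>\<delta> > 0\<close>, of f]
  have k: "k \<in> vecs C0" unfolding k_def by (rule soft_truncate_C0[OF \<open>\<delta> > 0\<close> fC])
  have "norm (\<nu> f - \<nu> k) \<le> nrm MG \<nu> * \<delta>"
    unfolding MG_diff[OF \<nu> fC k, symmetric] by (intro MG_bound[OF \<nu>]) (simp add: k_def tr(2))
  then have \<nu>k: "nrm MG \<nu> - \<epsilon> \<le> norm (\<nu> k)"
    using norm_triangle_ineq2[of "\<nu> f" "\<nu> k"] f(2) \<open>nrm MG \<nu> * \<delta> \<le> \<epsilon> / 2\<close> by linarith
  have "small_on \<nu> (- K) \<epsilon>"
    unfolding small_on_def
  proof (intro ballI impI)
    fix h assume h: "h \<in> vecs C0" "\<forall>x. norm (h x) \<le> 1" "\<forall>x. x \<notin> - K \<longrightarrow> h x = 0"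
    \<comment> \<open>k lives in K and h off K, so the sum of the rotated functions is still bounded
      by 1, while the moduli of their values add up; k alone uses up all of the norm but
      \<epsilon>.\<close>
    define g where "g = (\<lambda>x. cnj (sgn (\<nu> k)) * k x + cnj (sgn (\<nu> h)) * h x)"
    have "norm (g x) \<le> 1" for x
      unfolding g_def
    proof (rule norm_disjoint_add_le)
      have "norm (f x) \<le> \<delta>" if "x \<notin> K" using K(2)[OF that] by simp
      then show "cnj (sgn (\<nu> k)) * k x = 0 \<or> cnj (sgn (\<nu> h)) * h x = 0"
        using h(3) tr(3)[of x] by (cases "x \<in> K") (auto simp: k_def)
      have "norm (k x) \<le> 1" using tr(1)[of x] unit[OF f(1), of x] by (simp add: k_def)
      then show "norm (cnj (sgn (\<nu> k)) * k x) \<le> 1"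
        using norm_cnj_sgn_le[of "\<nu> k"] by (simp add: norm_mult mult_le_one)
      show "norm (cnj (sgn (\<nu> h)) * h x) \<le> 1"
        using norm_cnj_sgn_le[of "\<nu> h"] h(2) by (simp add: norm_mult mult_le_one)
    qed
    then have "norm (\<nu> g) \<le> nrm MG \<nu> * 1" by (rule MG_bound[OF \<nu>])
    moreover have "\<nu> g = of_real (norm (\<nu> k) + norm (\<nu> h))"
      unfolding g_def using k h(1)
      by (simp add: MG_add[OF \<nu>] MG_cmult[OF \<nu>] C0_cmult cnj_sgn_mult)
    ultimately have "norm (\<nu> k) + norm (\<nu> h) \<le> nrm MG \<nu>" by (simp del: of_real_add)
    with \<nu>k show "norm (\<nu> h) \<le> \<epsilon>" by linarith
  qed
  with K(1) show thesis by (rule that)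
qed

text \<open>The truncation of h at \<delta> is supported off K and, divided by B, is a test function
  for the small tail of \<nu>; what is cut away is uniformly small. This plays the part of splitting
  an integral over K and its complement.\<close>

lemma MG_tight_uniform:
  assumes \<nu>: "\<nu> \<in> vecs MG" and "\<epsilon> > 0" and "B > 0"
  obtains K \<delta> where "compact K" "\<delta> > 0"
    "\<And>h. h \<in> vecs C0 \<Longrightarrow> (\<And>x. norm (h x) \<le> B) \<Longrightarrow> (\<And>x. x \<in> K \<Longrightarrow> norm (h x) \<le> \<delta>) \<Longrightarrow> norm (\<nu> h) \<le> \<epsilon>"
proof -
  have "\<epsilon> / (2 * B) > 0" using assms by simp
  then obtain K where K: "compact K" "small_on \<nu> (- K) (\<epsilon> / (2 * B))" using MG_tight[OF \<nu>] by blast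
  define \<delta> where "\<delta> = \<epsilon> / (2 * (nrm MG \<nu> + 1))"
  have nn: "0 \<le> nrm MG \<nu>" using \<nu> by (rule nrm_MG_nonneg)
  then have "\<delta> > 0" "nrm MG \<nu> * \<delta> \<le> \<epsilon> / 2" using \<open>\<epsilon> > 0\<close> by (auto simp: \<delta>_def field_simps)
  have "norm (\<nu> h) \<le> \<epsilon>" if h: "h \<in> vecs C0" "\<And>x. norm (h x) \<le> B" "\<And>x. x \<in> K \<Longrightarrow> norm (h x) \<le> \<delta>" for h
  proof -
    define k where "k = soft_truncate \<delta> h"
    note tr = soft_truncate[OF \<open>\<delta> > 0\<close>, of h]
    have k: "k \<in> vecs C0" unfolding k_def by (rule soft_truncate_C0[OF \<open>\<delta> > 0\<close> h(1)])
    have "norm (\<nu> h - \<nu> k) \<le> nrm MG \<nu> * \<delta>"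
      unfolding MG_diff[OF \<nu> h(1) k, symmetric] by (intro MG_bound[OF \<nu>]) (simp add: k_def tr(2))
    moreover have "norm (\<nu> (\<lambda>x. of_real (1 / B) * k x)) \<le> \<epsilon> / (2 * B)"
    proof (rule small_onD[OF K(2)])
      show "(\<lambda>x. of_real (1 / B) * k x) \<in> vecs C0" using k by (rule C0_cmult)
      show "norm (of_real (1 / B) * k x) \<le> 1" for x
        using tr(1)[of x] h(2)[of x] \<open>B > 0\<close> by (simp add: k_def norm_mult norm_divide field_simps)
      show "of_real (1 / B) * k x = 0" if "x \<notin> - K" for x using tr(3)[of x] h(3)[of x] that by (simp add: k_def)
    qed
    then have "norm (of_real (1 / B) * \<nu> k) \<le> \<epsilon> / (2 * B)" by (simp only: MG_cmult[OF \<nu> k])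
    then have "norm (\<nu> k) \<le> \<epsilon> / 2"
      using \<open>B > 0\<close> by (simp add: norm_mult norm_divide field_simps)
    ultimately show ?thesis
      using norm_triangle_ineq2[of "\<nu> h" "\<nu> k"] \<open>nrm MG \<nu> * \<delta> \<le> \<epsilon> / 2\<close> by linarith
  qed
  with K(1) \<open>\<delta> > 0\<close> show thesis by (rule that)
qed

text \<open>Without this the outer functional in \<open>mul MG\<close> would return its default 0.
  Near s0 the translates of h are uniformly close on a compact K that carries almost all of \<nu>,
  which gives continuity; for s far away they are uniformly small on K, which gives vanishing at
  infinity.\<close>

lemma convolution_inner_C0:
  fixes \<nu> :: "'g::topological_group_add functional"
  assumes \<nu>: "\<nu> \<in> vecs MG" and h: "h \<in> vecs C0"
  shows "(\<lambda>s. \<nu> (\<lambda>t. h (s + t))) \<in> vecs C0"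
proof -
  obtain B where B: "B > 0" "\<And>x. norm (h x) \<le> B" using linf_bound[OF C0_linf[OF h]] by blast
  have tr: "(\<lambda>t. h (s + t)) \<in> vecs C0" for s using h by (rule C0_left_translate)
  show ?thesis
    unfolding C0_iff
  proof (intro conjI allI impI)
    show "continuous_on UNIV (\<lambda>s. \<nu> (\<lambda>t. h (s + t)))"
      unfolding continuous_on_def
    proof (intro ballI tendstoI)
      fix s0 :: 'g and e :: real assume "e > 0"
      have "e / 2 > 0" "2 * B > 0" using \<open>e > 0\<close> B by auto
      then obtain K \<delta> where K: "compact K" "\<delta> > 0" "\<And>h. h \<in> vecs C0 \<Longrightarrow> (\<And>x. norm (h x) \<le> 2 * B) \<Longrightarrow>
          (\<And>x. x \<in> K \<Longrightarrow> norm (h x) \<le> \<delta>) \<Longrightarrow> norm (\<nu> h) \<le> e / 2"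
        using MG_tight_uniform[OF \<nu>] by metis
      have cont: "continuous_on (UNIV \<times> K) (\<lambda>p. h (fst p + snd p))"
        by (rule continuous_on_compose2[OF C0_continuous[OF h]]) (auto intro!: continuous_intros)
      obtain X0 where X0: "s0 \<in> X0" "open X0"
        "\<forall>s\<in>X0 \<inter> UNIV. \<forall>t\<in>K. dist (h (fst (s, t) + snd (s, t))) (h (fst (s0, t) + snd (s0, t))) \<le> \<delta>"
        using continuous_on_prod_compactE[OF cont K(1) UNIV_I K(2)] by metis
      have "dist (\<nu> (\<lambda>t. h (s + t))) (\<nu> (\<lambda>t. h (s0 + t))) < e" if "s \<in> X0" for s
      proof -
        have "norm (\<nu> (\<lambda>t. h (s + t) - h (s0 + t))) \<le> e / 2"
        proof (rule K(3))
          show "(\<lambda>t. h (s + t) - h (s0 + t)) \<in> vecs C0" using tr by (intro C0_diff)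
          show "norm (h (s + t) - h (s0 + t)) \<le> 2 * B" for t
            using norm_triangle_ineq4[of "h (s + t)" "h (s0 + t)"] B(2)[of "s + t"] B(2)[of "s0 + t"] by linarith
          show "norm (h (s + t) - h (s0 + t)) \<le> \<delta>" if "t \<in> K" for t
            using X0(3) \<open>s \<in> X0\<close> that by (simp add: dist_norm)
        qed
        then show ?thesis using \<open>e > 0\<close> by (simp add: dist_norm MG_diff[OF \<nu> tr tr])
      qed
      then have "\<forall>\<^sub>F s in nhds s0. dist (\<nu> (\<lambda>t. h (s + t))) (\<nu> (\<lambda>t. h (s0 + t))) < e"
        using X0 unfolding eventually_nhds by blast
      then show "\<forall>\<^sub>F s in at s0. dist (\<nu> (\<lambda>t. h (s + t))) (\<nu> (\<lambda>t. h (s0 + t))) < e"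
        by (simp add: eventually_at_filter eventually_mono)
    qed
  next
    fix e :: real assume "e > 0"
    then have "e / 2 > 0" by simp
    obtain K \<delta> where K: "compact K" "\<delta> > 0" "\<And>h. h \<in> vecs C0 \<Longrightarrow> (\<And>x. norm (h x) \<le> B) \<Longrightarrow>
        (\<And>x. x \<in> K \<Longrightarrow> norm (h x) \<le> \<delta>) \<Longrightarrow> norm (\<nu> h) \<le> e / 2"
      using MG_tight_uniform[OF \<nu> \<open>e / 2 > 0\<close> B(1)] by metis
    obtain L where L: "compact L" "\<And>x. x \<notin> L \<Longrightarrow> norm (h x) < \<delta>" using C0_vanishes[OF h K(2)] by blast
    \<comment> \<open>The set L - K: for s outside it, s + t misses L for all t \<in> K.\<close>
    define S where "S = (\<lambda>p. fst p + - snd p) ` (L \<times> K)"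
    have "compact S"
      unfolding S_def using K(1) L(1) by (intro compact_continuous_image continuous_intros compact_Times)
    moreover have "norm (\<nu> (\<lambda>t. h (s + t))) < e" if "s \<notin> S" for s
    proof -
      have "norm (h (s + t)) \<le> \<delta>" if "t \<in> K" for t
      proof -
        have "s + t \<notin> L"
        proof
          assume "s + t \<in> L"
          then have "s + t + - t \<in> S" unfolding S_def using that by force
          with \<open>s \<notin> S\<close> show False by (simp add: add.assoc)
        qed
        then show ?thesis using L(2) by (simp add: less_imp_le)
      qed
      then have "norm (\<nu> (\<lambda>t. h (s + t))) \<le> e / 2" using B(2) tr by (intro K(3)) auto
      then show ?thesis using \<open>e > 0\<close> by simp
    qed
    ultimately show "\<exists>K. compact K \<and> (\<forall>s. s \<notin> K \<longrightarrow> norm (\<nu> (\<lambda>t. h (s + t))) < e)" by blast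
  qed
qed

lemma mul_MG_mem:
  fixes \<mu> \<nu> :: "'g::topological_group_add functional"
  assumes \<mu>: "\<mu> \<in> vecs MG" and \<nu>: "\<nu> \<in> vecs MG"
  shows "mul MG \<mu> \<nu> \<in> vecs MG"
proof (rule MG_memI[where B = "nrm MG \<mu> * nrm MG \<nu>"])
  note inner = convolution_inner_C0[OF \<nu>]
  show "mul MG \<mu> \<nu> f = 0" if "f \<notin> vecs C0" for f using that by (simp add: mul_MG)
  show "mul MG \<mu> \<nu> (\<lambda>x. f x + g x) = mul MG \<mu> \<nu> f + mul MG \<mu> \<nu> g"
    if "f \<in> vecs C0" "g \<in> vecs C0" for f g
    using that
    by (simp add: mul_MG C0_add MG_add[OF \<nu>] C0_left_translate MG_add[OF \<mu>] inner)
  show "mul MG \<mu> \<nu> (\<lambda>x. c * f x) = c * mul MG \<mu> \<nu> f" if "f \<in> vecs C0" for c f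
    using that by (simp add: mul_MG C0_cmult MG_cmult[OF \<nu>] C0_left_translate MG_cmult[OF \<mu>] inner)
  show "norm (mul MG \<mu> \<nu> f) \<le> nrm MG \<mu> * nrm MG \<nu> * C" if "f \<in> vecs C0" "\<And>x. norm (f x) \<le> C" for f C
    using that MG_bound[OF \<mu>, of "\<lambda>s. \<nu> (\<lambda>t. f (s + t))" "nrm MG \<nu> * C"] MG_bound[OF \<nu>, of _ C]
    by (simp add: mul_MG mult.assoc)
qed

text \<open>Uniformity over all translates q + W comes from compactness. A translate that misses K
  lies where \<nu> is small; one that meets K is contained in one of finitely many sets of small
  mass.\<close>

lemma nonatomic_uniformly_small:
  fixes \<nu> :: "'g::topological_group_add functional"
  assumes \<nu>: "\<nu> \<in> vecs MG" and nonatomic: "\<And>s. has_atom \<nu> s 0" and "\<epsilon> > 0"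
  obtains W where "open W" "0 \<in> W" "\<And>q. small_on \<nu> {x. - q + x \<in> W} \<epsilon>"
proof -
  define plus where "plus = (\<lambda>(A :: 'g set) B. {a + b |a b. a \<in> A \<and> b \<in> B})"
  obtain K where K: "compact K" "small_on \<nu> (- K) \<epsilon>" using MG_tight[OF \<nu> \<open>\<epsilon> > 0\<close>] by blast
  have "\<exists>A B. open A \<and> open B \<and> x \<in> A \<and> 0 \<in> B \<and> small_on \<nu> (plus A B) \<epsilon>" for x
  proof -
    obtain U where U: "open U" "x \<in> U" "small_on \<nu> U \<epsilon>"
      using nonatomic[of x] \<open>\<epsilon> > 0\<close> by (auto simp: has_atom_0_iff)
    have "open ((\<lambda>p. fst p + snd p) -` U)"
      using U(1) by (intro open_vimage continuous_intros)
    then obtain A B where "open A" "open B" "(x, 0) \<in> A \<times> B" "A \<times> B \<subseteq> (\<lambda>p. fst p + snd p) -` U"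
      using U(2) by (elim open_prod_elim[of _ "(x, 0)"]) auto
    then show ?thesis
      using small_on_mono[OF U(3), of "plus A B"]
      by (intro exI[of _ A] exI[of _ B]) (force simp: plus_def)
  qed
  then obtain A B where AB: "\<And>x. open (A x)" "\<And>x. open (B x)" "\<And>x. x \<in> A x" "\<And>x. 0 \<in> B x"
    "\<And>x. small_on \<nu> (plus (A x) (B x)) \<epsilon>" by metis
  have cover: "K \<subseteq> (\<Union>x\<in>K. A x)" using AB(3) by blast
  obtain D where D: "D \<subseteq> K" "finite D" "K \<subseteq> (\<Union>x\<in>D. A x)"
    using compactE_image[OF K(1) _ cover] AB(1) by metis
  define N where "N = (\<Inter>x\<in>D. B x)"
  have "open N" "0 \<in> N" unfolding N_def using AB D(2) by (auto intro: open_INT)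
  \<comment> \<open>W will satisfy - W + W \<subseteq> N, so that two points of the same translate q
    + W differ by an element of N.\<close>
  have "open ((\<lambda>p. - fst p + snd p) -` N)"
    using \<open>open N\<close> by (intro open_vimage continuous_intros)
  then obtain V1 V2 where V: "open V1" "open V2" "(0, 0) \<in> V1 \<times> V2" "V1 \<times> V2 \<subseteq> (\<lambda>p. - fst p + snd p) -` N"
    using \<open>0 \<in> N\<close> by (elim open_prod_elim[of _ "(0, 0)"]) auto
  define W where "W = V1 \<inter> V2"
  have "small_on \<nu> {x. - q + x \<in> W} \<epsilon>" for q
  proof (cases "\<exists>y\<in>K. - q + y \<in> W")
    case True
    then obtain y x where y: "y \<in> K" "- q + y \<in> W" "x \<in> D" "y \<in> A x" using D(3) by blast
    have "{z. - q + z \<in> W} \<subseteq> plus (A x) (B x)"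
    proof
      fix z assume "z \<in> {z. - q + z \<in> W}"
      then have "- (- q + y) + (- q + z) \<in> N" using V(4) y(2) by (auto simp: W_def)
      then have "- y + z \<in> B x" using y(3) by (simp add: minus_add add.assoc N_def)
      moreover have "z = y + (- y + z)" by (simp add: add.assoc[symmetric])
      ultimately show "z \<in> plus (A x) (B x)" using y(4) unfolding plus_def by blast
    qed
    then show ?thesis by (rule small_on_mono[OF AB(5)])
  next
    case False
    then show ?thesis by (intro small_on_mono[OF K(2)]) auto
  qed
  moreover have "open W" "0 \<in> W" using V by (auto simp: W_def)
  ultimately show thesis using that by blast
qed

text \<open>For h supported near p, the inner function t \<mapsto> h (s + t) is supported in a
  translate of W, which has small mass for \<nu> whatever s is; applying \<mu> costs the factor
  \<open>nrm MG \<mu>\<close>.\<close>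

lemma has_atom_mul_nonatomic_right:
  fixes \<mu> \<nu> :: "'g::topological_group_add functional"
  assumes \<mu>: "\<mu> \<in> vecs MG" and \<nu>: "\<nu> \<in> vecs MG" and nonatomic: "\<And>s. has_atom \<nu> s 0"
  shows "has_atom (mul MG \<mu> \<nu>) p 0"
  unfolding has_atom_0_iff
proof (intro allI impI)
  fix \<epsilon> :: real assume "\<epsilon> > 0"
  define \<epsilon>' where "\<epsilon>' = \<epsilon> / (nrm MG \<mu> + 1)"
  have nn: "0 \<le> nrm MG \<mu>" using \<mu> by (rule nrm_MG_nonneg)
  then have "\<epsilon>' > 0" "nrm MG \<mu> * \<epsilon>' \<le> \<epsilon>" using \<open>\<epsilon> > 0\<close> by (auto simp: \<epsilon>'_def field_simps)
  obtain W where W: "open W" "0 \<in> W" "\<And>q. small_on \<nu> {x. - q + x \<in> W} \<epsilon>'"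
    using nonatomic_uniformly_small[OF \<nu> nonatomic \<open>\<epsilon>' > 0\<close>] by blast
  show "\<exists>U. open U \<and> p \<in> U \<and> small_on (mul MG \<mu> \<nu>) U \<epsilon>"
  proof (intro exI[of _ "(\<lambda>x. - p + x) -` W"] conjI)
    show "open ((\<lambda>x. - p + x) -` W)"
      using W(1) by (intro open_vimage continuous_on_left_translation)
    show "p \<in> (\<lambda>x. - p + x) -` W" using W(2) by simp
    show "small_on (mul MG \<mu> \<nu>) ((\<lambda>x. - p + x) -` W) \<epsilon>"
      unfolding small_on_def
    proof (intro ballI impI)
      fix h assume h: "h \<in> vecs C0" "\<forall>x. norm (h x) \<le> 1" "\<forall>x. x \<notin> (\<lambda>x. - p + x) -` W \<longrightarrow> h x = 0"
      \<comment> \<open>h (s + t) \<noteq> 0 forces t into q + W with q = - s + p.\<close>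
      have "norm (\<nu> (\<lambda>t. h (s + t))) \<le> \<epsilon>'" for s
        using h by (intro small_onD[OF W(3)[of "- s + p"]] C0_left_translate)
          (auto simp: minus_add add.assoc)
      then have "norm (mul MG \<mu> \<nu> h) \<le> nrm MG \<mu> * \<epsilon>'"
        using MG_bound[OF \<mu>] h(1) by (simp add: mul_MG)
      with \<open>nrm MG \<mu> * \<epsilon>' \<le> \<epsilon>\<close> show "norm (mul MG \<mu> \<nu> h) \<le> \<epsilon>" by linarith
    qed
  qed
qed

text \<open>Up to its tail, b is a finite combination of point masses at t \<in> E. Right
  translation by t carries the question to the point p - t, where \<mu> has no atom, and the
  finitely many neighbourhoods are intersected.\<close>

lemma has_atom_mul_nonatomic_left:
  fixes \<mu> :: "'g::{topological_group_add, t2_space} functional"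
  assumes \<mu>: "\<mu> \<in> vecs MG" and nonatomic: "\<And>s. has_atom \<mu> s 0" and b: "b \<in> vecs l1"
  shows "has_atom (mul MG \<mu> (atomic_measure b)) p 0"
  unfolding has_atom_0_iff
proof (intro allI impI)
  fix \<epsilon> :: real assume "\<epsilon> > 0"
  define \<epsilon>1 where "\<epsilon>1 = \<epsilon> / (2 * (nrm MG \<mu> + 1))"
  define \<epsilon>2 where "\<epsilon>2 = \<epsilon> / (2 * (nrm l1 b + 1))"
  have nn: "0 \<le> nrm MG \<mu>" "0 \<le> nrm l1 b" using \<mu> by (auto intro: nrm_MG_nonneg nrm_l1_nonneg)
  then have \<epsilon>: "\<epsilon>1 > 0" "nrm MG \<mu> * \<epsilon>1 \<le> \<epsilon> / 2" "\<epsilon>2 > 0" "nrm l1 b * \<epsilon>2 \<le> \<epsilon> / 2"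
    using \<open>\<epsilon> > 0\<close> by (auto simp: \<epsilon>1_def \<epsilon>2_def field_simps)
  obtain E where E: "finite E" "nrm l1 (\<lambda>t. if t \<in> E then 0 else b t) \<le> \<epsilon>1"
    using l1_finite_approximation[OF b \<epsilon>(1)] by (metis order_refl)
  let ?b = "\<lambda>t. if t \<in> E then 0 else b t"
  have "\<forall>t. \<exists>V. open V \<and> p + - t \<in> V \<and> small_on \<mu> V \<epsilon>2"
    using nonatomic \<epsilon>(3) unfolding has_atom_0_iff by blast
  then obtain V where V: "\<And>t. open (V t)" "\<And>t. p + - t \<in> V t" "\<And>t. small_on \<mu> (V t) \<epsilon>2" by metis
  define U where "U = (\<Inter>t\<in>E. (\<lambda>x. x + - t) -` V t)"
  show "\<exists>U. open U \<and> p \<in> U \<and> small_on (mul MG \<mu> (atomic_measure b)) U \<epsilon>"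
  proof (intro exI[of _ U] conjI)
    show "open U" unfolding U_def
      using E(1) V(1) by (intro open_INT ballI open_vimage continuous_on_right_translation)
    show "p \<in> U" using V(2) by (simp add: U_def)
    show "small_on (mul MG \<mu> (atomic_measure b)) U \<epsilon>"
      unfolding small_on_def
    proof (intro ballI impI)
      fix h assume h: "h \<in> vecs C0" "\<forall>x. norm (h x) \<le> 1" "\<forall>x. x \<notin> U \<longrightarrow> h x = 0"
      define g where "g = (\<lambda>s. \<Sum>t\<in>E. b t * h (s + t))"
      define k where "k = (\<lambda>s. atomic_measure b (\<lambda>t. h (s + t)))"
      have k: "k \<in> vecs C0" unfolding k_def by (rule convolution_inner_C0[OF atomic_measure_mem[OF b] h(1)])
      have ht: "(\<lambda>s. b t * h (s + t)) \<in> vecs C0" for t using h(1) by (intro C0_cmult C0_right_translate)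
      then have g: "g \<in> vecs C0" unfolding g_def by (intro C0_sum)
      have "norm (k s - g s) \<le> \<epsilon>1" for s
      proof -
        have hs: "(\<lambda>t. h (s + t)) \<in> vecs C0" using h(1) by (rule C0_left_translate)
        have "k s - g s = (\<Sum>\<^sub>\<infinity>t. ?b t * h (s + t))"
          using infsum_split_finite(2)[OF E(1) C0_linf[OF hs] b] hs
          by (simp add: k_def g_def atomic_measure_def)
        also have "norm \<dots> \<le> 1 * nrm l1 ?b"
          using h(2) by (intro norm_infsum_l1_linf_le infsum_split_finite(1)[OF E(1) linf_const[of 0] b]) auto
        finally show ?thesis using E(2) by simp
      qed
      then have "norm (\<mu> k - \<mu> g) \<le> nrm MG \<mu> * \<epsilon>1"
        unfolding MG_diff[OF \<mu> k g, symmetric] by (rule MG_bound[OF \<mu>])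
      moreover have "norm (\<mu> g) \<le> nrm l1 b * \<epsilon>2"
      proof -
        have small: "norm (\<mu> (\<lambda>s. h (s + t))) \<le> \<epsilon>2" if "t \<in> E" for t
        proof (rule small_onD[OF V(3)[of t]])
          show "(\<lambda>s. h (s + t)) \<in> vecs C0" using h(1) by (rule C0_right_translate)
          show "h (s + t) = 0" if "s \<notin> V t" for s
          proof -
            have "s + t + - t \<notin> V t" using that by (simp add: add.assoc)
            then have "s + t \<notin> U" using \<open>t \<in> E\<close> unfolding U_def by blast
            then show ?thesis using h(3) by blast
          qed
        qed (use h(2) in auto)
        have "\<mu> g = (\<Sum>t\<in>E. b t * \<mu> (\<lambda>s. h (s + t)))"
          unfolding g_def using ht h(1) by (simp add: MG_sum[OF \<mu>] MG_cmult[OF \<mu>] C0_right_translate)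
        also have "norm \<dots> \<le> (\<Sum>t\<in>E. norm (b t) * \<epsilon>2)"
          using small by (intro sum_norm_le) (auto simp: norm_mult intro: mult_left_mono)
        also have "\<dots> = (\<Sum>t\<in>E. norm (b t)) * \<epsilon>2" by (simp add: sum_distrib_right)
        also have "\<dots> \<le> nrm l1 b * \<epsilon>2"
          using infsum_split_finite(3)[OF E(1) linf_const[of 0] b] nrm_l1_nonneg[of ?b] \<epsilon>(3)
          by (intro mult_right_mono) auto
        finally show ?thesis .
      qed
      ultimately have "norm (\<mu> k) \<le> \<epsilon>"
        using \<epsilon> norm_triangle_ineq2[of "\<mu> k" "\<mu> g"] by linarith
      then show "norm (mul MG \<mu> (atomic_measure b) h) \<le> \<epsilon>" using h(1) by (simp add: mul_MG k_def)
    qed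
  qed
qed

lemma mul_atomic_measures:
  assumes a: "a \<in> vecs l1" and b: "b \<in> vecs l1"
  shows "mul MG (atomic_measure a) (atomic_measure b) = atomic_measure (mul l1 a b)"
proof
  fix h :: "'a \<Rightarrow> complex"
  show "mul MG (atomic_measure a) (atomic_measure b) h = atomic_measure (mul l1 a b) h"
  proof (cases "h \<in> vecs C0")
    case True
    then show ?thesis
      using infsum_convolution[OF a b C0_linf[OF True]] convolution_inner_C0[OF atomic_measure_mem[OF b] True]
      by (simp add: mul_MG atomic_measure_def C0_left_translate mult.commute)
  qed (simp add: mul_MG atomic_measure_def)
qed

section \<open>Point masses and atomic parts on a locally compact Hausdorff group\<close>

context
  assumes lc: "locally_compact_space (euclidean :: 'g::{topological_group_add, t2_space} topology)"
begin

text \<open>Locally compact Hausdorff spaces are completely regular. Separating s from the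
  complement of U \<inter> V, with V inside a compact set, makes the function vanish off that
  compact set.\<close>

lemma ex_bump:
  fixes U :: "'g set"
  assumes U: "open U" "s \<in> U"
  obtains b where "b \<in> vecs C0" "\<And>x. norm (b x) \<le> 1" "\<And>x. x \<notin> U \<Longrightarrow> b x = 0" "b s = 1"
proof -
  have "Hausdorff_space (euclidean :: 'g topology)"
    unfolding Hausdorff_space_def disjnt_def by (auto dest!: hausdorff)
  then have cr: "completely_regular_space (euclidean :: 'g topology)"
    using lc by (intro locally_compact_regular_imp_completely_regular_space) auto
  obtain V K where V: "open V" "compact K" "s \<in> V" "V \<subseteq> K"
    using lc unfolding locally_compact_space_def by (metis UNIV_I compactin_euclidean_iff open_openin topspace_euclidean)
  have "closedin euclidean (- (U \<inter> V))"     using U(1) V(1) by (metis closed_Compl closed_closedin open_Int)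
  then obtain f :: "'g \<Rightarrow> real" where f: "continuous_map euclidean (top_of_set {0..1}) f" "f s = 0"
    "f ` (- (U \<inter> V)) \<subseteq> {1}"
    using cr U(2) V(3) unfolding completely_regular_space_def by (metis Compl_iff Diff_iff IntI UNIV_I topspace_euclidean)
  have cont: "continuous_on UNIV f" and f01: "\<And>x. 0 \<le> f x \<and> f x \<le> 1"
    using f(1) by (auto simp: continuous_map_in_subtopology image_subset_iff)
  define b where "b = (\<lambda>x. complex_of_real (1 - f x))"
  have outside: "b x = 0" if "x \<notin> U \<inter> V" for x using f(3) that by (auto simp: b_def)
  have "b \<in> vecs C0"
    unfolding C0_iff
  proof (intro conjI allI impI)
    show "continuous_on UNIV b" unfolding b_def using cont by (intro continuous_intros)
    show "\<exists>K. compact K \<and> (\<forall>x. x \<notin> K \<longrightarrow> norm (b x) < e)" if "e > 0" for e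
      using outside V that by (intro exI[of _ K]) (metis IntD2 norm_zero subsetD)
  qed
  moreover have "norm (b x) \<le> 1" for x
    unfolding b_def norm_of_real using f01[of x] by auto
  moreover have "b s = 1" using f(2) by (simp add: b_def)
  ultimately show thesis using that outside by blast
qed

text \<open>Subtracting, the zero functional would have mass c - d at s; a bump with value 1 at s
  tests this.\<close>

lemma has_atom_unique:
  fixes \<mu> :: "'g functional"
  assumes c: "has_atom \<mu> s c" and d: "has_atom \<mu> s d"
  shows "c = d"
proof (rule ccontr)
  assume "c \<noteq> d"
  define \<epsilon> where "\<epsilon> = norm (c - d) / 3"
  have "\<epsilon> > 0" using \<open>c \<noteq> d\<close> by (simp add: \<epsilon>_def)
  obtain U where U: "open U" "s \<in> U"
    "\<And>h. h \<in> vecs C0 \<Longrightarrow> (\<And>x. norm (h x) \<le> 1) \<Longrightarrow> (\<And>x. x \<notin> U \<Longrightarrow> h x = 0) \<Longrightarrow>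
       norm (\<mu> h - \<mu> h - (c - d) * h s) \<le> \<epsilon>"
    using has_atomE[OF has_atom_diff[OF c d] \<open>\<epsilon> > 0\<close>] by metis
  obtain b where b: "b \<in> vecs C0" "\<And>x. norm (b x) \<le> 1" "\<And>x. x \<notin> U \<Longrightarrow> b x = 0" "b s = 1"
    using ex_bump[OF U(1,2)] by metis
  have "norm (\<mu> b - \<mu> b - (c - d) * b s) \<le> \<epsilon>" by (rule U(3)[OF b(1-3)])
  then have "norm (c - d) \<le> \<epsilon>" by (simp add: b(4) norm_minus_commute)
  then show False using \<open>\<epsilon> > 0\<close> by (simp add: \<epsilon>_def)
qed

text \<open>The mass is the generalized limit of \<mu> on bumps at s with shrinking supports. For h
  supported near s, the difference of h and h s times a late bump vanishes at s, so
  \<open>small_on_punctured\<close> makes \<mu> almost blind to it.\<close>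

lemma ex_atom:
  fixes \<mu> :: "'g functional"
  assumes \<mu>: "\<mu> \<in> vecs MG"
  shows "\<exists>c. has_atom \<mu> s c"
proof -
  have "\<forall>n. \<exists>U. open U \<and> s \<in> U \<and> (\<forall>h\<in>vecs C0. (\<forall>x. norm (h x) \<le> 1) \<longrightarrow>
    (\<forall>x. x \<notin> U \<longrightarrow> h x = 0) \<longrightarrow> h s = 0 \<longrightarrow> norm (\<mu> h) \<le> 1 / real (Suc n))"
    by (intro allI small_on_punctured[OF \<mu>]) simp
  then obtain U where U: "\<And>n. open (U n)" "\<And>n. s \<in> U n"
    "\<And>n h. h \<in> vecs C0 \<Longrightarrow> (\<And>x. norm (h x) \<le> 1) \<Longrightarrow>
      (\<And>x. x \<notin> U n \<Longrightarrow> h x = 0) \<Longrightarrow> h s = 0 \<Longrightarrow> norm (\<mu> h) \<le> 1 / real (Suc n)" by metis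
  \<comment> \<open>The sets U n come from a choice and need not decrease; V n places the late bumps
    in all earlier U i.\<close>
  define V where "V = (\<lambda>n. \<Inter>i\<le>n. U i)"
  have "open (V n)" "s \<in> V n" for n using U by (auto simp: V_def intro: open_INT)
  then have "\<forall>n. \<exists>b. b \<in> vecs C0 \<and> (\<forall>x. norm (b x) \<le> 1) \<and> (\<forall>x. x \<notin> V n \<longrightarrow> b x = 0) \<and> b s = 1"
    using ex_bump by metis
  then obtain b where b: "\<And>n. b n \<in> vecs C0" "\<And>n x. norm (b n x) \<le> 1" "\<And>n x. x \<notin> V n \<Longrightarrow> b n x = 0"
    "\<And>n. b n s = 1" by metis
  define c where "c = ulim (\<lambda>n. \<mu> (b n))"
  have \<mu>b: "(\<lambda>n. \<mu> (b n)) \<in> linf" using MG_bound[OF \<mu> b(2)] by (rule linfI)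
  have "has_atom \<mu> s c"
    unfolding has_atom_def
  proof (intro allI impI)
    fix \<epsilon> :: real assume "\<epsilon> > 0"
    then obtain N where N: "inverse (real (Suc N)) < \<epsilon> / 2" using reals_Archimedean[of "\<epsilon> / 2"] by auto
    show "\<exists>U. open U \<and> s \<in> U \<and> (\<forall>h\<in>vecs C0. (\<forall>x. norm (h x) \<le> 1) \<longrightarrow> (\<forall>x. x \<notin> U \<longrightarrow> h x = 0) \<longrightarrow>
        norm (\<mu> h - c * h s) \<le> \<epsilon>)"
    proof (intro exI[of _ "U N"] conjI ballI impI U)
      fix h assume h: "h \<in> vecs C0" "\<forall>x. norm (h x) \<le> 1" "\<forall>x. x \<notin> U N \<longrightarrow> h x = 0"
      have close: "norm (\<mu> h - h s * \<mu> (b n)) \<le> \<epsilon>" if "n \<ge> N" for n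
      proof -
        have hs: "(\<lambda>x. h s * b n x) \<in> vecs C0" using b(1) by (rule C0_cmult)
        then have k: "(\<lambda>x. h x - h s * b n x) \<in> vecs C0" using h(1) by (intro C0_diff)
        have "V n \<subseteq> U N" using that by (auto simp: V_def)
        \<comment> \<open>The factor 1 / 2 brings a difference of two functions bounded by 1 back
          into the unit ball; N was chosen for \<epsilon> / 2 accordingly.\<close>
        have "norm (\<mu> (\<lambda>x. (1 / 2) * (h x - h s * b n x))) \<le> 1 / real (Suc N)"
        proof (rule U(3))
          show "(\<lambda>x. (1 / 2) * (h x - h s * b n x)) \<in> vecs C0" using k by (rule C0_cmult)
          show "norm ((1 / 2) * (h x - h s * b n x)) \<le> 1" for x
          proof -
            have "norm (h s * b n x) \<le> 1" using h(2) b(2) by (simp add: norm_mult mult_le_one)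
            moreover have "norm (h x) \<le> 1" using h(2) by simp
            ultimately have "norm (h x - h s * b n x) \<le> 2"
              using norm_triangle_ineq4[of "h x" "h s * b n x"] by linarith
            then show ?thesis by (simp add: norm_mult)
          qed
          show "(1 / 2) * (h x - h s * b n x) = 0" if "x \<notin> U N" for x
            using that h(3) b(3)[of x n] \<open>V n \<subseteq> U N\<close> by auto
        qed (simp add: b(4))
        also have "\<mu> (\<lambda>x. (1 / 2) * (h x - h s * b n x)) = (1 / 2) * (\<mu> h - h s * \<mu> (b n))"
          using k hs h(1) b(1) by (simp only: MG_cmult[OF \<mu>] MG_diff[OF \<mu>])
        finally have "norm (\<mu> h - h s * \<mu> (b n)) / 2 \<le> inverse (real (Suc N))"
          by (simp add: norm_mult norm_divide inverse_eq_divide)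
        then show ?thesis using N by linarith
      qed
      have "(\<lambda>n. h s * \<mu> (b n)) \<in> linf" using linf_mult[OF linf_const \<mu>b] .
      then have "ulim (\<lambda>n. \<mu> h - h s * \<mu> (b n)) = \<mu> h - h s * c"
        and "(\<lambda>n. \<mu> h - h s * \<mu> (b n)) \<in> linf"
        by (simp_all add: ulim_diff ulim_cmult c_def linf_diff)
      then show "norm (\<mu> h - c * h s) \<le> \<epsilon>"
        using ulim_norm_le[of "\<lambda>n. \<mu> h - h s * \<mu> (b n)" N \<epsilon>] close by (simp add: mult.commute)
    qed
  qed
  then show ?thesis ..
qed

text \<open>Bumps on disjoint neighbourhoods of the points of E, rotated by the phases of their
  values, sum to a function bounded by 1. Its value under \<mu> is the sum of the moduli, which
  approximates the sum of the masses.\<close>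

lemma sum_atoms_le:
  fixes \<mu> :: "'g functional"
  assumes \<mu>: "\<mu> \<in> vecs MG" and a: "\<And>s. has_atom \<mu> s (a s)" and E: "finite E"
  shows "(\<Sum>s\<in>E. norm (a s)) \<le> nrm MG \<mu>"
proof (rule field_le_epsilon)
  fix e :: real assume "e > 0"
  define \<epsilon> where "\<epsilon> = e / (real (card E) + 1)"
  have "\<epsilon> > 0" "real (card E) * \<epsilon> \<le> e" using \<open>e > 0\<close> by (auto simp: \<epsilon>_def field_simps)
  obtain V where V: "\<And>s. open (V s)" "\<And>s. s \<in> V s"
    "\<And>s t. s \<in> E \<Longrightarrow> t \<in> E \<Longrightarrow> s \<noteq> t \<Longrightarrow> V s \<inter> V t = {}"
    using ex_disjoint_neighbourhoods[OF E] by metis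
  have "\<exists>b. b \<in> vecs C0 \<and> (\<forall>x. norm (b x) \<le> 1) \<and> (\<forall>x. x \<notin> V s \<longrightarrow> b x = 0) \<and> norm (\<mu> b - a s) \<le> \<epsilon>" for s
  proof -
    obtain U where U: "open U" "s \<in> U" "\<And>h. h \<in> vecs C0 \<Longrightarrow> (\<And>x. norm (h x) \<le> 1) \<Longrightarrow>
        (\<And>x. x \<notin> U \<Longrightarrow> h x = 0) \<Longrightarrow> norm (\<mu> h - a s * h s) \<le> \<epsilon>"
      using has_atomE[OF a[of s] \<open>\<epsilon> > 0\<close>] by metis
    obtain b where b: "b \<in> vecs C0" "\<And>x. norm (b x) \<le> 1" "\<And>x. x \<notin> U \<inter> V s \<Longrightarrow> b x = 0" "b s = 1"
      using ex_bump[of "U \<inter> V s" s] U(1,2) V(1,2) by (metis IntI open_Int)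
    have "norm (\<mu> b - a s * b s) \<le> \<epsilon>" using b by (intro U(3)) auto
    then show ?thesis using b by (intro exI[of _ b]) auto
  qed
  then obtain b where b: "\<And>s. b s \<in> vecs C0" "\<And>s x. norm (b s x) \<le> 1" "\<And>s x. x \<notin> V s \<Longrightarrow> b s x = 0"
    "\<And>s. norm (\<mu> (b s) - a s) \<le> \<epsilon>" by metis
  define g where "g = (\<lambda>x. \<Sum>s\<in>E. cnj (sgn (\<mu> (b s))) * b s x)"
  have "norm (g x) \<le> 1" for x
  proof (cases "\<exists>s\<in>E. x \<in> V s")
    case True
    then obtain s where s: "s \<in> E" "x \<in> V s" by blast
    have "b t x = 0" if "t \<in> E - {s}" for t using V(3)[of s t] s that b(3)[of x t] by auto
    then have "g x = cnj (sgn (\<mu> (b s))) * b s x"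
      unfolding g_def using E s(1) by (subst sum.remove[of _ s]) auto
    then show ?thesis using norm_cnj_sgn_le[of "\<mu> (b s)"] b(2)[of s x] by (simp add: norm_mult mult_le_one)
  next
    case False
    then show ?thesis using b(3) by (simp add: g_def)
  qed
  then have "norm (\<mu> g) \<le> nrm MG \<mu> * 1" by (rule MG_bound[OF \<mu>])
  moreover have "\<mu> g = of_real (\<Sum>s\<in>E. norm (\<mu> (b s)))"
    unfolding g_def using b(1) by (simp add: MG_sum[OF \<mu>] MG_cmult[OF \<mu>] C0_cmult cnj_sgn_mult)
  ultimately have "(\<Sum>s\<in>E. norm (\<mu> (b s))) \<le> nrm MG \<mu>" by (simp add: sum_nonneg del: of_real_sum)
  moreover have "(\<Sum>s\<in>E. norm (a s)) \<le> (\<Sum>s\<in>E. norm (\<mu> (b s)) + \<epsilon>)"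
  proof (rule sum_mono)
    fix s
    show "norm (a s) \<le> norm (\<mu> (b s)) + \<epsilon>"
      using norm_triangle_ineq2[of "a s" "\<mu> (b s)"] b(4)[of s] by (simp add: norm_minus_commute)
  qed
  ultimately show "(\<Sum>s\<in>E. norm (a s)) \<le> nrm MG \<mu> + e"
    using \<open>real (card E) * \<epsilon> \<le> e\<close> by (simp add: sum.distrib)
qed

lemma atoms_l1:
  fixes \<mu> :: "'g functional"
  assumes \<mu>: "\<mu> \<in> vecs MG" and a: "\<And>s. has_atom \<mu> s (a s)"
  shows "a \<in> vecs l1" "nrm l1 a \<le> nrm MG \<mu>"
proof -
  show mem: "a \<in> vecs l1"
    unfolding l1_iff
  proof (rule nonneg_bdd_above_summable_on)
    show "bdd_above (sum (\<lambda>s. norm (a s)) ` {F. F \<subseteq> UNIV \<and> finite F})"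
      using sum_atoms_le[OF \<mu> a] by (auto simp: bdd_above_def)
  qed simp
  show "nrm l1 a \<le> nrm MG \<mu>"
    unfolding nrm_l1 using mem sum_atoms_le[OF \<mu> a]
    by (intro infsum_le_finite_sums) (auto simp: l1_iff)
qed

text \<open>Evaluates the description in \<open>atomic_part\<close>: removing all point masses
  leaves a measure in \<open>M_c\<close>, and any other candidate has the same masses because atoms
  are unique. So P is computed point by point from \<open>has_atom\<close>.\<close>

lemma atomic_part_eqI:
  fixes \<mu> :: "'g functional"
  assumes \<mu>: "\<mu> \<in> vecs MG" and a: "\<And>s. has_atom \<mu> s (a s)"
  shows "atomic_part \<mu> = a"
  unfolding atomic_part_def
proof (rule the_equality)
  have "a \<in> vecs l1" by (rule atoms_l1[OF \<mu> a])
  then show "a \<in> vecs l1 \<and> (\<lambda>f. \<mu> f - atomic_measure a f) \<in> M_c"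
    using has_atom_diff[OF a has_atom_atomic_measure[of a]] \<mu>
    by (simp add: M_c_iff MG_diff_mem atomic_measure_mem)
next
  fix b assume b: "b \<in> vecs l1 \<and> (\<lambda>f. \<mu> f - atomic_measure b f) \<in> M_c"
  show "b = a"
  proof
    fix s
    have "has_atom (\<lambda>f. \<mu> f - atomic_measure b f) s (a s - b s)"
      using b by (intro has_atom_diff a has_atom_atomic_measure) auto
    moreover have "has_atom (\<lambda>f. \<mu> f - atomic_measure b f) s 0" using b by (simp add: M_c_iff)
    ultimately have "a s - b s = 0" by (rule has_atom_unique)
    then show "b s = a s" by simp
  qed
qed

lemma atomic_part:
  fixes \<mu> :: "'g functional"
  assumes \<mu>: "\<mu> \<in> vecs MG"
  shows has_atom_atomic_part: "has_atom \<mu> s (atomic_part \<mu> s)"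
    and atomic_part_l1: "atomic_part \<mu> \<in> vecs l1"
    and nrm_atomic_part_le: "nrm l1 (atomic_part \<mu>) \<le> nrm MG \<mu>"
proof -
  obtain a where a: "\<And>s. has_atom \<mu> s (a s)" using ex_atom[OF \<mu>] by metis
  have "atomic_part \<mu> = a" by (rule atomic_part_eqI[OF \<mu> a])
  then show "has_atom \<mu> s (atomic_part \<mu> s)" "atomic_part \<mu> \<in> vecs l1"
    "nrm l1 (atomic_part \<mu>) \<le> nrm MG \<mu>"
    using a atoms_l1[OF \<mu> a] by simp_all
qed

lemma atomic_part_add:
  fixes \<mu> \<nu> :: "'g functional"
  assumes "\<mu> \<in> vecs MG" "\<nu> \<in> vecs MG"
  shows "atomic_part (\<lambda>f. \<mu> f + \<nu> f) = (\<lambda>s. atomic_part \<mu> s + atomic_part \<nu> s)"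
  using assms by (intro atomic_part_eqI has_atom_add MG_add_mem has_atom_atomic_part)

lemma atomic_part_cmult:
  fixes \<mu> :: "'g functional"
  assumes "\<mu> \<in> vecs MG"
  shows "atomic_part (\<lambda>f. c * \<mu> f) = (\<lambda>s. c * atomic_part \<mu> s)"
  using assms by (intro atomic_part_eqI has_atom_cmult MG_cmult_mem has_atom_atomic_part)

text \<open>With \<open>\<mu>c\<close> and \<open>\<nu>c\<close> the non-atomic parts, the product
  expands into \<mu> times \<open>\<nu>c\<close>, \<open>\<mu>c\<close> times b, and a times b; the
  first two terms have no atoms and the third is atomic.\<close>

theorem atomic_part_mul:
  fixes \<mu> \<nu> :: "'g functional"
  assumes \<mu>: "\<mu> \<in> vecs MG" and \<nu>: "\<nu> \<in> vecs MG"
  shows "atomic_part (mul MG \<mu> \<nu>) = mul l1 (atomic_part \<mu>) (atomic_part \<nu>)"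
proof (rule atomic_part_eqI[OF mul_MG_mem[OF \<mu> \<nu>]])
  fix p
  define a where "a = atomic_part \<mu>"
  define b where "b = atomic_part \<nu>"
  define \<mu>c where "\<mu>c = (\<lambda>f. \<mu> f - atomic_measure a f)"
  define \<nu>c where "\<nu>c = (\<lambda>f. \<nu> f - atomic_measure b f)"
  have ab: "a \<in> vecs l1" "b \<in> vecs l1" using \<mu> \<nu> by (simp_all add: a_def b_def atomic_part_l1)
  note atomic = atomic_measure_mem[OF ab(1)] atomic_measure_mem[OF ab(2)]
  have c: "\<mu>c \<in> vecs MG" "\<nu>c \<in> vecs MG" unfolding \<mu>c_def \<nu>c_def using \<mu> \<nu> atomic by (intro MG_diff_mem; simp)+
  have "has_atom \<mu>c s 0" "has_atom \<nu>c s 0" for s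
    using has_atom_diff[OF has_atom_atomic_part[OF \<mu>] has_atom_atomic_measure[OF ab(1)], of s]
      has_atom_diff[OF has_atom_atomic_part[OF \<nu>] has_atom_atomic_measure[OF ab(2)], of s]
    by (simp_all add: \<mu>c_def \<nu>c_def a_def b_def)
  then have "has_atom (\<lambda>f. mul MG \<mu> \<nu>c f + (mul MG \<mu>c (atomic_measure b) f + atomic_measure (mul l1 a b) f)) p
      (0 + (0 + mul l1 a b p))"
    by (intro has_atom_add has_atom_mul_nonatomic_right has_atom_mul_nonatomic_left
        has_atom_atomic_measure mul_l1_mem \<mu> c ab)
  also have "(\<lambda>f. mul MG \<mu> \<nu>c f + (mul MG \<mu>c (atomic_measure b) f + atomic_measure (mul l1 a b) f)) = mul MG \<mu> \<nu>"
  proof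
    fix f
    show "mul MG \<mu> \<nu>c f + (mul MG \<mu>c (atomic_measure b) f + atomic_measure (mul l1 a b) f) = mul MG \<mu> \<nu> f"
    proof (cases "f \<in> vecs C0")
      case True
      \<comment> \<open>Linearity in the second factor needs the inner functions to lie in C0; in
        the first factor it holds by the definition of \<open>mul MG\<close>.\<close>
      have "\<mu> (\<lambda>s. \<nu>c (\<lambda>t. f (s + t))) + \<mu> (\<lambda>s. atomic_measure b (\<lambda>t. f (s + t))) =
          \<mu> (\<lambda>s. \<nu>c (\<lambda>t. f (s + t)) + atomic_measure b (\<lambda>t. f (s + t)))"
        using True c atomic by (intro MG_add[OF \<mu>, symmetric] convolution_inner_C0)
      also have "\<dots> = \<mu> (\<lambda>s. \<nu> (\<lambda>t. f (s + t)))" by (simp add: \<nu>c_def)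
      finally show ?thesis
        using True unfolding mul_atomic_measures[OF ab, symmetric]
        by (simp add: mul_MG \<mu>c_def)
    qed (simp add: mul_MG atomic_measure_def)
  qed
  finally show "has_atom (mul MG \<mu> \<nu>) p (mul l1 (atomic_part \<mu>) (atomic_part \<nu>) p)"
    by (simp add: a_def b_def)
qed

end

subsection \<open>The homomorphisms between the compactifications\<close>

lemma atomic_part_dirac:
  assumes lc: "locally_compact_space (euclidean :: 'g::{topological_group_add, t2_space} topology)"
  shows "atomic_part (dirac s :: 'g functional) = point_mass s"
proof -
  have "dirac s = atomic_measure (point_mass s)"
    unfolding dirac_def atomic_measure_def using infsum_point_mass[of _ s]
    by (simp add: mult.commute fun_eq_iff)
  then show ?thesis
    using has_atom_atomic_measure[OF point_mass_l1(1), of s] atomic_measure_mem[OF point_mass_l1(1), of s]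
    by (intro atomic_part_eqI[OF lc]) auto
qed

text \<open>Q is the adjoint of P. As P is multiplicative, m acting on Q \<mu> is Q applied to the
  action of P m on \<mu>, and as P is contractive, P m stays in the unit ball. So the orbit lies in
  the image under Q of a weakly compact set, and Q is weak-to-weak continuous.\<close>

theorem atomic_part_adj_WAP:
  fixes F :: "'g::{topological_group_add, t2_space} \<Rightarrow> complex"
  assumes lc: "locally_compact_space (euclidean :: 'g topology)" and F: "F \<in> WAP_Gd"
  shows "atomic_part_adj F \<in> WAP MG"
proof -
  define Q where "Q = (\<lambda>(\<mu> :: 'g functional) (m :: 'g functional).
    if m \<in> vecs MG then \<mu> (atomic_part m) else 0)"
  note part = atomic_part_l1[OF lc] nrm_atomic_part_le[OF lc]
  have bound: "norm (Q \<mu> m) \<le> adual_norm l1 \<mu> * nrm MG m" if "\<mu> \<in> adual l1" "m \<in> vecs MG" for \<mu> m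
  proof -
    have "norm (\<mu> (atomic_part m)) \<le> adual_norm l1 \<mu> * nrm l1 (atomic_part m)"
      using that part by (intro norm_le_adual_norm_l1) auto
    also have "\<dots> \<le> adual_norm l1 \<mu> * nrm MG m"
      using that part by (intro mult_left_mono adual_norm_l1_nonneg) auto
    finally show ?thesis using that by (simp add: Q_def)
  qed
  have Q: "Q \<mu> \<in> adual MG" if \<mu>: "\<mu> \<in> adual l1" for \<mu>
  proof -
    have "Q \<mu> (\<lambda>f. m f + n f) = Q \<mu> m + Q \<mu> n" if "m \<in> vecs MG" "n \<in> vecs MG" for m n
      using that \<mu> by (simp add: Q_def MG_add_mem atomic_part_add[OF lc] adual_def dual_add part)
    moreover have "Q \<mu> (\<lambda>f. c * m f) = c * Q \<mu> m" if "m \<in> vecs MG" for c m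
      using that \<mu> by (simp add: Q_def MG_cmult_mem atomic_part_cmult[OF lc] adual_def dual_cmult part)
    moreover have "Q \<mu> m = 0" if "m \<notin> vecs MG" for m using that by (simp add: Q_def)
    ultimately show ?thesis
      using bound[OF \<mu>] unfolding adual_def dual_def linear_functional_def by blast
  qed
  have zero: "(\<lambda>f. 0) \<in> vecs (MG :: ('g \<Rightarrow> complex) balgebra)"
    "nrm (MG :: ('g \<Rightarrow> complex) balgebra) (\<lambda>f. 0) \<le> 1"
  proof -
    show "(\<lambda>f. 0) \<in> vecs (MG :: ('g \<Rightarrow> complex) balgebra)" by (rule MG_memI[where B = 0]) auto
    show "nrm (MG :: ('g \<Rightarrow> complex) balgebra) (\<lambda>f. 0) \<le> 1"
      unfolding nrm_MG adual_norm_def by (rule dual_norm_le[where ?f0.0 = "\<lambda>x. 0"]) auto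
  qed
  have Q_norm: "adual_norm MG (Q \<mu>) \<le> adual_norm l1 \<mu>" if \<mu>: "\<mu> \<in> adual l1" for \<mu>
    unfolding adual_norm_def[of MG]
  proof (rule dual_norm_le)
    fix m :: "'g functional" assume m: "m \<in> vecs MG" "nrm MG m \<le> 1"
    have "norm (Q \<mu> m) \<le> adual_norm l1 \<mu> * nrm MG m" by (rule bound[OF \<mu> m(1)])
    also have "\<dots> \<le> adual_norm l1 \<mu> * 1" using m(2) adual_norm_l1_nonneg[OF \<mu>] by (rule mult_left_mono)
    finally show "norm (Q \<mu> m) \<le> adual_norm l1 \<mu>" by simp
  qed (rule zero)+
  have adj: "atomic_part_adj F = Q (l1_functional F)"
    by (simp add: atomic_part_adj_def Q_def)
  have l1F: "l1_functional F \<in> adual l1" "l1_functional F \<in> WAP l1"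
    using F by (auto simp: WAP_Gd_def WAP_Gd_linf intro: l1_functional_adual)
  let ?e1 = "weak_eval (adual l1) (adual_norm l1) :: 'g functional \<Rightarrow> _"
  let ?e2 = "weak_eval (adual MG) (adual_norm MG) :: ('g functional \<Rightarrow> complex) \<Rightarrow> _"
  obtain K where K: "K \<subseteq> adual l1" "compact (?e1 ` K)"
    "(\<lambda>a. lact l1 a (l1_functional F)) ` {a \<in> vecs l1. nrm l1 a \<le> 1} \<subseteq> K"
    using l1F(2) unfolding WAP_l1_iff[OF WAP_Gd_linf[OF F]] by blast
  have image: "(\<lambda>m. lact MG m (atomic_part_adj F)) ` {m \<in> vecs MG. nrm MG m \<le> 1} \<subseteq> Q ` K"
  proof clarify
    fix m :: "'g functional" assume m: "m \<in> vecs MG" "nrm MG m \<le> 1"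
    have "lact MG m (atomic_part_adj F) = Q (lact l1 (atomic_part m) (l1_functional F))"
    proof
      fix n
      show "lact MG m (atomic_part_adj F) n = Q (lact l1 (atomic_part m) (l1_functional F)) n"
        using m(1) part
        by (simp add: adj Q_def lact_def mul_MG_mem atomic_part_mul[OF lc])
    qed
    moreover have "lact l1 (atomic_part m) (l1_functional F) \<in> K"
      using K(3) part[OF m(1)] m(2) by (auto simp: image_subset_iff)
    ultimately show "lact MG m (atomic_part_adj F) \<in> Q ` K" by blast
  qed
  moreover have QK: "Q ` K \<subseteq> adual MG" using K(1) Q by blast
  moreover have "compact (?e2 ` Q ` K)"
  proof -
    \<comment> \<open>\<phi> composed with Q, a functional on the dual of l^1; this is what makes Q
      weakly continuous.\<close>
    define k where "k = (\<lambda>(\<phi> :: 'g functional functional) \<mu>. if \<mu> \<in> adual l1 then \<phi> (Q \<mu>) else 0)"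
    have k: "k \<phi> \<in> dual (adual l1) (adual_norm l1)" if \<phi>: "\<phi> \<in> dual (adual MG) (adual_norm MG)" for \<phi>
    proof -
      obtain B where B: "\<And>\<nu>. \<nu> \<in> adual MG \<Longrightarrow> norm (\<phi> \<nu>) \<le> B * adual_norm MG \<nu>"
        using \<phi> by (auto simp: dual_def)
      have "norm (k \<phi> \<mu>) \<le> \<bar>B\<bar> * adual_norm l1 \<mu>" if \<mu>: "\<mu> \<in> adual l1" for \<mu>
      proof -
        have "0 \<le> adual_norm MG (Q \<mu>)"
        proof -
          have "norm (Q \<mu> (\<lambda>f. 0)) \<le> adual_norm MG (Q \<mu>)"
            using Q[OF \<mu>] unfolding adual_norm_def adual_def
            by (intro le_dual_norm nrm_MG_nonneg zero)
          then show ?thesis by (rule order_trans[OF norm_ge_zero])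
        qed
        have "norm (k \<phi> \<mu>) \<le> B * adual_norm MG (Q \<mu>)" using B[OF Q[OF \<mu>]] \<mu> by (simp add: k_def)
        also have "\<dots> \<le> \<bar>B\<bar> * adual_norm l1 \<mu>"
          using Q_norm[OF \<mu>] \<open>0 \<le> adual_norm MG (Q \<mu>)\<close> by (intro mult_mono) auto
        finally show ?thesis .
      qed
      moreover have "k \<phi> (\<lambda>a. \<mu> a + \<nu> a) = k \<phi> \<mu> + k \<phi> \<nu>" if "\<mu> \<in> adual l1" "\<nu> \<in> adual l1" for \<mu> \<nu>
      proof -
        have "Q (\<lambda>a. \<mu> a + \<nu> a) = (\<lambda>m. Q \<mu> m + Q \<nu> m)" by (auto simp: Q_def)
        then show ?thesis
          using that dual_add_mem[of \<mu> "vecs l1" "nrm l1" \<nu>] dual_add[OF \<phi> Q Q] by (simp add: k_def adual_def)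
      qed
      moreover have "k \<phi> (\<lambda>a. c * \<mu> a) = c * k \<phi> \<mu>" if "\<mu> \<in> adual l1" for c \<mu>
      proof -
        have "Q (\<lambda>a. c * \<mu> a) = (\<lambda>m. c * Q \<mu> m)" by (auto simp: Q_def)
        then show ?thesis
          using that dual_cmult_mem[of \<mu> "vecs l1" "nrm l1" c] dual_cmult[OF \<phi> Q] by (simp add: k_def adual_def)
      qed
      moreover have "k \<phi> \<mu> = 0" if "\<mu> \<notin> adual l1" for \<mu> using that by (simp add: k_def)
      ultimately show ?thesis unfolding dual_def linear_functional_def by blast
    qed
    \<comment> \<open>On weak coordinates Q is just the relabelling \<phi> \<mapsto> k \<phi>,
      continuous for pointwise convergence.\<close>
    define c where "c = (\<lambda>y \<phi>. if \<phi> \<in> dual (adual MG) (adual_norm MG) then y (k \<phi>) else 0 :: complex)"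
    have "?e2 (Q \<mu>) = c (?e1 \<mu>)" if "\<mu> \<in> K" for \<mu>
      using k that K(1) by (auto simp: weak_eval_def c_def k_def fun_eq_iff)
    then have "?e2 ` Q ` K = c ` ?e1 ` K" unfolding image_image by (rule image_cong[OF refl])
    moreover have "continuous_on (?e1 ` K) c"
      unfolding c_def
    proof (rule continuous_on_coordinatewise_then_product)
      fix \<phi>
      show "continuous_on (?e1 ` K) (\<lambda>y. if \<phi> \<in> dual (adual MG) (adual_norm MG) then y (k \<phi>) else 0)"
        by (cases "\<phi> \<in> dual (adual MG) (adual_norm MG)")
          (auto intro: continuous_on_subset[OF continuous_on_product_coordinates])
    qed
    ultimately show ?thesis using compact_continuous_image[OF _ K(2)] by metis
  qed
  ultimately show ?thesis
    unfolding WAP_def using Q[OF l1F(1)] adj by (subst mem_Collect_eq, subst weakly_compact_iff) auto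
qed

text \<open>\<open>atomic_part_adj F\<close> lies in \<open>WAP MG\<close>, so
  \<open>theta s\<close> evaluates it at the point measure at s; P maps that measure to the point
  mass in l^1, whose pairing with F is F s.\<close>

lemma theta1_theta:
  fixes s :: "'g::{topological_group_add, t2_space}"
  assumes lc: "locally_compact_space (euclidean :: 'g topology)"
  shows "theta1 (theta s) = Gd_wap_embed s"
proof
  fix F :: "'g \<Rightarrow> complex"
  have "dirac s \<in> vecs MG"
    by (rule MG_memI[where B = 1]) (auto simp: dirac_def C0_add C0_cmult)
  then show "theta1 (theta s) F = Gd_wap_embed s F"
    using atomic_part_adj_WAP[OF lc, of F]
    by (simp add: theta1_def theta_def Gd_wap_embed_def atomic_part_adj_def atomic_part_dirac[OF lc]
        l1_functional_def point_mass_l1 infsum_point_mass)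
qed

lemma Gd_wap_embed_mem: "Gd_wap_embed s \<in> Gd_wap"
  using WAP_Gd_mult[of "\<lambda>x. _"] unfolding Gd_wap_def characters_def linear_functional_def
  by (auto simp: Gd_wap_embed_def WAP_Gd_add WAP_Gd_mult intro!: bexI[of _ "\<lambda>x. 1"])

lemma continuous_on_theta1: "continuous_on S theta1"
proof (rule continuous_on_coordinatewise_then_product)
  fix F :: "'a \<Rightarrow> complex"
  show "continuous_on S (\<lambda>k. theta1 k F)"
    by (cases "F \<in> WAP_Gd")
      (auto simp: theta1_def intro: continuous_on_subset[OF continuous_on_product_coordinates])
qed

theorem lemma5p5:
  fixes theta_wap ::
    "('g::{topological_group_add, t2_space}) functional \<Rightarrow> ('g functional) functional"
  assumes "locally_compact_space (euclidean :: 'g topology)"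
    and "is_theta_wap theta_wap"
  shows "(\<forall>\<phi>\<in>Gd_wap. (theta1 \<circ> theta_wap) \<phi> = \<phi>) \<and>
         (\<exists>h. homeomorphism Gd_wap (theta_wap ` Gd_wap) theta_wap h)"
proof -
  have cont: "continuous_on Gd_wap theta_wap" and ext: "\<And>s. theta_wap (Gd_wap_embed s) = theta s"
    using assms(2) by (auto simp: is_theta_wap_def)
  have id: "theta1 (theta_wap \<phi>) = \<phi>" if \<phi>: "\<phi> \<in> Gd_wap" for \<phi>
  proof
    fix F
    \<comment> \<open>For each coordinate F the two maps are compared through one continuous scalar
      function on \<open>Gd_wap\<close>.\<close>
    define f where "f = (\<lambda>\<psi>. theta1 (theta_wap \<psi>) F - \<psi> F)"
    have "continuous_on Gd_wap (\<lambda>\<psi>. theta1 (theta_wap \<psi>))"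
      by (rule continuous_on_compose2[OF continuous_on_theta1 cont]) auto
    from continuous_on_product_then_coordinatewise[OF this, of F] have "continuous_on Gd_wap f"
      unfolding f_def
      by (intro continuous_on_diff continuous_on_subset[OF continuous_on_product_coordinates]) auto
    \<comment> \<open>The zero set is closed relative to \<open>Gd_wap\<close>; density is stated in
      the ambient function space, so a closed set C of that space is taken.\<close>
    then obtain C where C: "closed C" "C \<inter> Gd_wap = f -` {0} \<inter> Gd_wap"
      unfolding continuous_on_closed_invariant by (meson closed_singleton)
    have "range Gd_wap_embed \<subseteq> C"
    proof clarify
      fix s
      have "f (Gd_wap_embed s) = 0" by (simp add: f_def ext theta1_theta[OF assms(1)])
      then show "Gd_wap_embed s \<in> C" using C(2) Gd_wap_embed_mem[of s] by blast
    qed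
    then have "closure (range Gd_wap_embed) \<subseteq> C" using C(1) by (rule closure_minimal)
    then have "f \<phi> = 0" using Gd_wap_embed_dense[OF \<phi>] \<phi> C(2) by blast
    then show "theta1 (theta_wap \<phi>) F = \<phi> F" by (simp add: f_def)
  qed
  \<comment> \<open>\<open>theta1\<close> is continuous on the whole function space and so serves as
    the continuous inverse on the range.\<close>
  then have "homeomorphism Gd_wap (theta_wap ` Gd_wap) theta_wap theta1"
    using cont by (auto simp: homeomorphism_def continuous_on_theta1 image_image)
  with id show ?thesis by auto
qed

end
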